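(* The 2-category $\mathbf{QRD}$ of relational doctrines with quotients and the 2-category $\mathrm T_q\text{-}\mathbf{Alg}^{ps}$ of pseudoalgebras and pseudomorphisms for the 2-monad $\mathrm T_q$ on $\mathbf{RD}$ are equivalent.
   Context: $\mathbf{Pos}$ is the category of posets and monotone maps. A relational doctrine consists of a category $\mathcal C$ (its base); a functor $R:(\mathcal C\times\mathcal C)^{op}\to\mathbf{Pos}$ (for $f:X\to A$, $g:Y\to B$ write $R_{f,g}:R(A,B)\to R(X,Y)$); elements $d_X\in R(X,X)$ with $d_X\le R_{f,f}(d_Y)$ for all $f:X\to Y$; monotone maps $;:R(X,Y)\times R(Y,Z)\to R(X,Z)$ with $R_{f,g}(\alpha);R_{g,h}(\beta)\le R_{f,h}(\alpha;\beta)$; monotone maps $(-)^\bot:R(X,Y)\to R(Y,X)$ with $(R_{f,g}(\alpha))^\bot\le R_{g,f}(\alpha^\bot)$; such that $;$ is associative with units $d$, $(\alpha;\beta)^\bot=\beta^\bot;\alpha^\bot$, $d_X^\bot=d_X$, $\alpha^{\bot\bot}=\alpha$. The graph of $f:X\to Y$ is $\Gamma_f=R_{f,\mathrm{id}_Y}(d_Y)\in R(X,Y)$. An $R$-equivalence relation on $X$ is $\rho\in R(X,X)$ with $d_X\le\rho$, $\rho^\bot\le\rho$, $\rho;\rho\le\rho$. A quotient arrow of $\rho$ is $q:X\to W$ with $\rho\le\Gamma_q;\Gamma_q^\bot$ such that for every $f:X\to Z$ with $\rho\le\Gamma_f;\Gamma_f^\bot$ there is a unique $h:W\to Z$ with $f=h\circ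 q$. It is effective if $\rho=\Gamma_q;\Gamma_q^\bot$, and descent if $d_W\le\Gamma_q^\bot;\Gamma_q$. $R$ has quotients if every $R$-equivalence relation admits an effective descent quotient arrow. The 2-category $\mathbf{RD}$: objects are relational doctrines; a 1-arrow $F:R\to S$ (bases $\mathcal C,\mathcal D$) is a pair of a functor $\widehat F:\mathcal C\to\mathcal D$ and a natural transformation with components $\overline F_{X,Y}:R(X,Y)\to S(\widehat FX,\widehat FY)$ strictly preserving $d$, $;$ and $(-)^\bot$; a 2-arrow $\theta:F\Rightarrow G$ is a natural transformation $\theta:\widehat F\to\widehat G$ with $\overline F_{X,Y}(\alpha)\le S_{\theta_X,\theta_Y}(\overline G_{X,Y}(\alpha))$. $\mathbf{QRD}$ is the sub-2-category (full on 2-arrows) of relational doctrines with quotients and 1-arrows $F$ preserving quotient arrows: if $q$ is a quotient arrow of $\rho$ on $X$ then $\widehat Fq$ is a quotient arrow of $\overline F_{X,X}(\rho)$. Intensional quotient completion $R^q$ of $R$ (base $\mathcal C$): the base has objects the pairs $(X,\rho)$ with $\rho$ an $R$-equivalence relation on $X$; arrows $(X,\rho)\to(Y,\sigma)$ are the arrows $f:X\to Y$ of $\mathcal C$ with $\rho\le R_{f,f}(\sigma)$; composition and identities as in $\mathcal C$. The fibres are $R^q((X,\rho),(Y,\sigma))=\{\alpha\in R(X,Y)\mid\rho^\bot;\alpha;\sigma\le\alpha\}$, reindexing, composition and converse are those of $R$, and $d_{(X,\rho)}=\rho$. The strict 2-monad $\mathrm T_q$ on $\mathbf{RD}$: $\mathrm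 T_q(R)=R^q$; for a 1-arrow $F$, $\mathrm T_q(F)=F^q$ with $\widehat{F^q}(X,\rho)=(\widehat FX,\overline F_{X,X}(\rho))$, $\widehat{F^q}f=\widehat Ff$, $\overline{F^q}(\alpha)=\overline F_{X,Y}(\alpha)$; for a 2-arrow $\theta$, $\mathrm T_q(\theta)_{(X,\rho)}=\theta_X$. Its unit is $E^R:R\to R^q$, with $\widehat{E^R}X=(X,d_X)$, $\widehat{E^R}f=f$, $\overline{E^R}$ the identity. Its multiplication is $M^R:(R^q)^q\to R^q$, with $\widehat{M^R}((X,\rho),\sigma)=(X,\sigma)$, $\widehat{M^R}f=f$, $\overline{M^R}$ componentwise the identity. $\mathrm T_q\text{-}\mathbf{Alg}^{ps}$ is the usual 2-category of pseudoalgebras, pseudomorphisms and algebra 2-cells for this 2-monad. *)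

theory Defs
  imports Main "HOL-Library.FuncSet"
begin

section \<open>Strict 2-categories\<close>

text \<open>
  Cells carry their boundaries. \<open>vc \<phi> \<theta>\<close> is "\<open>\<phi>\<close> after \<open>\<theta>\<close>" along a 1-cell and
  \<open>hc \<phi> \<theta>\<close> is "\<open>\<phi>\<close> after \<open>\<theta>\<close>" along an object. Operations are only constrained on
  composable cells of the carriers.
\<close>

record ('o, 'm, 'c) two_cat =
  Obj :: "'o set"
  One :: "'m set"
  Two :: "'c set"
  src1 :: "'m \<Rightarrow> 'o"
  trg1 :: "'m \<Rightarrow> 'o"
  src2 :: "'c \<Rightarrow> 'm"
  trg2 :: "'c \<Rightarrow> 'm"
  id1 :: "'o \<Rightarrow> 'm"
  c1 :: "'m \<Rightarrow> 'm \<Rightarrow> 'm"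
  id2 :: "'m \<Rightarrow> 'c"
  vc :: "'c \<Rightarrow> 'c \<Rightarrow> 'c"
  hc :: "'c \<Rightarrow> 'c \<Rightarrow> 'c"

definition one :: "('o, 'm, 'c) two_cat \<Rightarrow> 'o \<Rightarrow> 'o \<Rightarrow> 'm set" where
  "one K A B = {f \<in> One K. src1 K f = A \<and> trg1 K f = B}"

definition two :: "('o, 'm, 'c) two_cat \<Rightarrow> 'm \<Rightarrow> 'm \<Rightarrow> 'c set" where
  "two K f g = {\<theta> \<in> Two K. src2 K \<theta> = f \<and> trg2 K \<theta> = g}"

locale two_category =
  fixes K :: "('o, 'm, 'c) two_cat"
  assumes bd1: "f \<in> One K \<Longrightarrow> src1 K f \<in> Obj K" "f \<in> One K \<Longrightarrow> trg1 K f \<in> Obj K"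
    and bd2: "\<theta> \<in> Two K \<Longrightarrow> src2 K \<theta> \<in> One K" "\<theta> \<in> Two K \<Longrightarrow> trg2 K \<theta> \<in> One K"
    and parallel: "\<theta> \<in> Two K \<Longrightarrow> src1 K (trg2 K \<theta>) = src1 K (src2 K \<theta>)"
      "\<theta> \<in> Two K \<Longrightarrow> trg1 K (trg2 K \<theta>) = trg1 K (src2 K \<theta>)"
    and id1_one: "A \<in> Obj K \<Longrightarrow> id1 K A \<in> one K A A"
    and c1_one: "\<lbrakk>f \<in> One K; g \<in> One K; src1 K g = trg1 K f\<rbrakk> \<Longrightarrow>
      c1 K g f \<in> one K (src1 K f) (trg1 K g)"
    and c1_id: "f \<in> One K \<Longrightarrow> c1 K f (id1 K (src1 K f)) = f"
      "f \<in> One K \<Longrightarrow> c1 K (id1 K (trg1 K f)) f = f"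
    and c1_assoc: "\<lbrakk>f \<in> One K; g \<in> One K; h \<in> One K; src1 K g = trg1 K f; src1 K h = trg1 K g\<rbrakk> \<Longrightarrow>
      c1 K h (c1 K g f) = c1 K (c1 K h g) f"
    and id2_two: "f \<in> One K \<Longrightarrow> id2 K f \<in> two K f f"
    and vc_two: "\<lbrakk>\<theta> \<in> Two K; \<phi> \<in> Two K; src2 K \<phi> = trg2 K \<theta>\<rbrakk> \<Longrightarrow>
      vc K \<phi> \<theta> \<in> two K (src2 K \<theta>) (trg2 K \<phi>)"
    and vc_id: "\<theta> \<in> Two K \<Longrightarrow> vc K \<theta> (id2 K (src2 K \<theta>)) = \<theta>"
      "\<theta> \<in> Two K \<Longrightarrow> vc K (id2 K (trg2 K \<theta>)) \<theta> = \<theta>"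
    and vc_assoc: "\<lbrakk>\<theta> \<in> Two K; \<phi> \<in> Two K; \<chi> \<in> Two K; src2 K \<phi> = trg2 K \<theta>; src2 K \<chi> = trg2 K \<phi>\<rbrakk> \<Longrightarrow>
      vc K \<chi> (vc K \<phi> \<theta>) = vc K (vc K \<chi> \<phi>) \<theta>"
    and hc_two: "\<lbrakk>\<theta> \<in> Two K; \<phi> \<in> Two K; src1 K (src2 K \<phi>) = trg1 K (src2 K \<theta>)\<rbrakk> \<Longrightarrow>
      hc K \<phi> \<theta> \<in> two K (c1 K (src2 K \<phi>) (src2 K \<theta>)) (c1 K (trg2 K \<phi>) (trg2 K \<theta>))"
    and hc_id: "\<theta> \<in> Two K \<Longrightarrow> hc K \<theta> (id2 K (id1 K (src1 K (src2 K \<theta>)))) = \<theta>"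
      "\<theta> \<in> Two K \<Longrightarrow> hc K (id2 K (id1 K (trg1 K (src2 K \<theta>)))) \<theta> = \<theta>"
    and hc_assoc: "\<lbrakk>\<theta> \<in> Two K; \<phi> \<in> Two K; \<chi> \<in> Two K; src1 K (src2 K \<phi>) = trg1 K (src2 K \<theta>);
      src1 K (src2 K \<chi>) = trg1 K (src2 K \<phi>)\<rbrakk> \<Longrightarrow> hc K \<chi> (hc K \<phi> \<theta>) = hc K (hc K \<chi> \<phi>) \<theta>"
    and hc_id2: "\<lbrakk>f \<in> One K; g \<in> One K; src1 K g = trg1 K f\<rbrakk> \<Longrightarrow>
      hc K (id2 K g) (id2 K f) = id2 K (c1 K g f)"
    and interchange: "\<lbrakk>\<theta> \<in> Two K; \<theta>' \<in> Two K; \<phi> \<in> Two K; \<phi>' \<in> Two K; src2 K \<theta>' = trg2 K \<theta>;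
      src2 K \<phi>' = trg2 K \<phi>; src1 K (src2 K \<phi>) = trg1 K (src2 K \<theta>)\<rbrakk> \<Longrightarrow>
      hc K (vc K \<phi>' \<phi>) (vc K \<theta>' \<theta>) = vc K (hc K \<phi>' \<theta>') (hc K \<phi> \<theta>)"

definition iso1 :: "('o, 'm, 'c) two_cat \<Rightarrow> 'm \<Rightarrow> bool" where
  "iso1 K f \<longleftrightarrow> f \<in> One K \<and> (\<exists>g\<in>one K (trg1 K f) (src1 K f).
      c1 K g f = id1 K (src1 K f) \<and> c1 K f g = id1 K (trg1 K f))"

definition iso2 :: "('o, 'm, 'c) two_cat \<Rightarrow> 'c \<Rightarrow> bool" where
  "iso2 K \<theta> \<longleftrightarrow> \<theta> \<in> Two K \<and> (\<exists>\<phi>\<in>two K (trg2 K \<theta>) (src2 K \<theta>).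
      vc K \<phi> \<theta> = id2 K (src2 K \<theta>) \<and> vc K \<theta> \<phi> = id2 K (trg2 K \<theta>))"

record ('o, 'm, 'c, 'p, 'n, 'd) two_map =
  on0 :: "'o \<Rightarrow> 'p"
  on1 :: "'m \<Rightarrow> 'n"
  on2 :: "'c \<Rightarrow> 'd"

locale two_functor =
  fixes K :: "('o, 'm, 'c) two_cat" and L :: "('p, 'n, 'd) two_cat"
    and F :: "('o, 'm, 'c, 'p, 'n, 'd) two_map"
  assumes on0_Obj: "A \<in> Obj K \<Longrightarrow> on0 F A \<in> Obj L"
    and on1_one: "f \<in> One K \<Longrightarrow> on1 F f \<in> one L (on0 F (src1 K f)) (on0 F (trg1 K f))"
    and on2_two: "\<theta> \<in> Two K \<Longrightarrow> on2 F \<theta> \<in> two L (on1 F (src2 K \<theta>)) (on1 F (trg2 K \<theta>))"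
    and on1_id1: "A \<in> Obj K \<Longrightarrow> on1 F (id1 K A) = id1 L (on0 F A)"
    and on1_c1: "\<lbrakk>f \<in> One K; g \<in> One K; src1 K g = trg1 K f\<rbrakk> \<Longrightarrow>
      on1 F (c1 K g f) = c1 L (on1 F g) (on1 F f)"
    and on2_id2: "f \<in> One K \<Longrightarrow> on2 F (id2 K f) = id2 L (on1 F f)"
    and on2_vc: "\<lbrakk>\<theta> \<in> Two K; \<phi> \<in> Two K; src2 K \<phi> = trg2 K \<theta>\<rbrakk> \<Longrightarrow>
      on2 F (vc K \<phi> \<theta>) = vc L (on2 F \<phi>) (on2 F \<theta>)"
    and on2_hc: "\<lbrakk>\<theta> \<in> Two K; \<phi> \<in> Two K; src1 K (src2 K \<phi>) = trg1 K (src2 K \<theta>)\<rbrakk> \<Longrightarrow>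
      on2 F (hc K \<phi> \<theta>) = hc L (on2 F \<phi>) (on2 F \<theta>)"

definition two_id :: "('o, 'm, 'c, 'o, 'm, 'c) two_map" where
  "two_id = \<lparr>on0 = id, on1 = id, on2 = id\<rparr>"

definition two_comp ::
  "('p, 'n, 'd, 'q, 'k, 'e) two_map \<Rightarrow> ('o, 'm, 'c, 'p, 'n, 'd) two_map \<Rightarrow> ('o, 'm, 'c, 'q, 'k, 'e) two_map"
where
  "two_comp G F = \<lparr>on0 = on0 G \<circ> on0 F, on1 = on1 G \<circ> on1 F, on2 = on2 G \<circ> on2 F\<rparr>"

locale two_natural =
  fixes K :: "('o, 'm, 'c) two_cat" and L :: "('p, 'n, 'd) two_cat"
    and F G :: "('o, 'm, 'c, 'p, 'n, 'd) two_map" and t :: "'o \<Rightarrow> 'n"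
  assumes component: "A \<in> Obj K \<Longrightarrow> t A \<in> one L (on0 F A) (on0 G A)"
    and natural1: "f \<in> One K \<Longrightarrow> c1 L (t (trg1 K f)) (on1 F f) = c1 L (on1 G f) (t (src1 K f))"
    and natural2: "\<theta> \<in> Two K \<Longrightarrow>
      hc L (id2 L (t (trg1 K (src2 K \<theta>)))) (on2 F \<theta>) = hc L (on2 G \<theta>) (id2 L (t (src1 K (src2 K \<theta>))))"

definition two_isomorphic ::
  "('o, 'm, 'c) two_cat \<Rightarrow> ('p, 'n, 'd) two_cat \<Rightarrow> ('o, 'm, 'c, 'p, 'n, 'd) two_map \<Rightarrow>
   ('o, 'm, 'c, 'p, 'n, 'd) two_map \<Rightarrow> bool" where
  "two_isomorphic K L F G \<longleftrightarrow> (\<exists>t. two_natural K L F G t \<and> (\<forall>A\<in>Obj K. iso1 L (t A)))"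

text \<open>Equivalence of 2-categories, in the sense of equivalence in the 2-category of
  2-categories, 2-functors and 2-natural transformations.\<close>

definition two_equivalent :: "('o, 'm, 'c) two_cat \<Rightarrow> ('p, 'n, 'd) two_cat \<Rightarrow> bool" where
  "two_equivalent K L \<longleftrightarrow>
    two_category K \<and> two_category L \<and>
    (\<exists>F G. two_functor K L F \<and> two_functor L K G \<and>
       two_isomorphic K K (two_comp G F) two_id \<and>
       two_isomorphic L L (two_comp F G) two_id)"


section \<open>Strict 2-monads and their pseudoalgebras\<close>

text \<open>The data of a strict 2-monad: an endo-2-functor with unit and multiplication.\<close>

record ('o, 'm, 'c) two_monad_data = "('o, 'm, 'c, 'o, 'm, 'c) two_map" +
  unit :: "'o \<Rightarrow> 'm"
  mult :: "'o \<Rightarrow> 'm"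

text \<open>
  A pseudoalgebra is \<open>a : TA \<rightarrow> A\<close> with invertible 2-cells \<open>\<iota> : id \<Rightarrow> a \<circ> \<eta>\<close> and
  \<open>\<kappa> : a \<circ> Ta \<Rightarrow> a \<circ> \<mu>\<close>. Whiskering is horizontal composition with an identity 2-cell.
\<close>

record ('o, 'm, 'c) psalg =
  carr :: 'o
  act :: 'm
  iota :: 'c
  kappa :: 'c

definition pseudoalgebra ::
  "('o, 'm, 'c) two_cat \<Rightarrow> ('o, 'm, 'c) two_monad_data \<Rightarrow> ('o, 'm, 'c) psalg \<Rightarrow> bool" where
  "pseudoalgebra K T \<A> \<longleftrightarrow>
    (let A = carr \<A>; a = act \<A>; \<iota> = iota \<A>; \<kappa> = kappa \<A>; \<eta> = unit T; \<mu> = mult T in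
     A \<in> Obj K \<and> a \<in> one K (on0 T A) A \<and>
     \<iota> \<in> two K (id1 K A) (c1 K a (\<eta> A)) \<and> iso2 K \<iota> \<and>
     \<kappa> \<in> two K (c1 K a (on1 T a)) (c1 K a (\<mu> A)) \<and> iso2 K \<kappa> \<and>
     vc K (hc K \<kappa> (id2 K (\<mu> (on0 T A)))) (hc K \<kappa> (id2 K (on1 T (on1 T a)))) =
       vc K (hc K \<kappa> (id2 K (on1 T (\<mu> A)))) (hc K (id2 K a) (on2 T \<kappa>)) \<and>
     vc K (hc K \<kappa> (id2 K (on1 T (\<eta> A)))) (hc K (id2 K a) (on2 T \<iota>)) = id2 K a \<and>
     vc K (hc K \<kappa> (id2 K (\<eta> (on0 T A)))) (hc K \<iota> (id2 K a)) = id2 K a)"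

text \<open>A pseudomorphism \<open>(A, a) \<rightarrow> (B, b)\<close> is \<open>f : A \<rightarrow> B\<close> with an invertible
  \<open>\<phi> : b \<circ> Tf \<Rightarrow> f \<circ> a\<close>.\<close>

record ('o, 'm, 'c) psmor =
  psrc :: "('o, 'm, 'c) psalg"
  ptrg :: "('o, 'm, 'c) psalg"
  pmap :: 'm
  pcell :: 'c

definition pseudomorphism ::
  "('o, 'm, 'c) two_cat \<Rightarrow> ('o, 'm, 'c) two_monad_data \<Rightarrow> ('o, 'm, 'c) psmor \<Rightarrow> bool" where
  "pseudomorphism K T h \<longleftrightarrow>
    pseudoalgebra K T (psrc h) \<and> pseudoalgebra K T (ptrg h) \<and>
    (let A = carr (psrc h); a = act (psrc h); b = act (ptrg h); f = pmap h; \<phi> = pcell h;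
         \<eta> = unit T; \<mu> = mult T in
     f \<in> one K A (carr (ptrg h)) \<and>
     \<phi> \<in> two K (c1 K b (on1 T f)) (c1 K f a) \<and> iso2 K \<phi> \<and>
     vc K (hc K (id2 K f) (kappa (psrc h)))
          (vc K (hc K \<phi> (id2 K (on1 T a))) (hc K (id2 K b) (on2 T \<phi>))) =
       vc K (hc K \<phi> (id2 K (\<mu> A))) (hc K (kappa (ptrg h)) (id2 K (on1 T (on1 T f)))) \<and>
     vc K (hc K \<phi> (id2 K (\<eta> A))) (hc K (iota (ptrg h)) (id2 K f)) =
       hc K (id2 K f) (iota (psrc h)))"

record ('o, 'm, 'c) pscell =
  pcsrc :: "('o, 'm, 'c) psmor"
  pctrg :: "('o, 'm, 'c) psmor"
  under :: 'c

definition algebra_cell ::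
  "('o, 'm, 'c) two_cat \<Rightarrow> ('o, 'm, 'c) two_monad_data \<Rightarrow> ('o, 'm, 'c) pscell \<Rightarrow> bool" where
  "algebra_cell K T t \<longleftrightarrow>
    (let f = pcsrc t; g = pctrg t; \<theta> = under t in
     pseudomorphism K T f \<and> pseudomorphism K T g \<and> psrc f = psrc g \<and> ptrg f = ptrg g \<and>
     \<theta> \<in> two K (pmap f) (pmap g) \<and>
     vc K (hc K \<theta> (id2 K (act (psrc f)))) (pcell f) =
       vc K (pcell g) (hc K (id2 K (act (ptrg f))) (on2 T \<theta>)))"

definition ps_comp ::
  "('o, 'm, 'c) two_cat \<Rightarrow> ('o, 'm, 'c) two_monad_data \<Rightarrow>
   ('o, 'm, 'c) psmor \<Rightarrow> ('o, 'm, 'c) psmor \<Rightarrow> ('o, 'm, 'c) psmor" where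
  "ps_comp K T g f = \<lparr>psrc = psrc f, ptrg = ptrg g, pmap = c1 K (pmap g) (pmap f),
     pcell = vc K (hc K (id2 K (pmap g)) (pcell f)) (hc K (pcell g) (id2 K (on1 T (pmap f))))\<rparr>"

definition PsAlg ::
  "('o, 'm, 'c) two_cat \<Rightarrow> ('o, 'm, 'c) two_monad_data \<Rightarrow>
   (('o, 'm, 'c) psalg, ('o, 'm, 'c) psmor, ('o, 'm, 'c) pscell) two_cat" where
  "PsAlg K T = \<lparr>
     Obj = {\<A>. pseudoalgebra K T \<A>},
     One = {h. pseudomorphism K T h},
     Two = {t. algebra_cell K T t},
     src1 = psrc, trg1 = ptrg, src2 = pcsrc, trg2 = pctrg,
     id1 = (\<lambda>\<A>. \<lparr>psrc = \<A>, ptrg = \<A>, pmap = id1 K (carr \<A>), pcell = id2 K (act \<A>)\<rparr>),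
     c1 = ps_comp K T,
     id2 = (\<lambda>f. \<lparr>pcsrc = f, pctrg = f, under = id2 K (pmap f)\<rparr>),
     vc = (\<lambda>u t. \<lparr>pcsrc = pcsrc t, pctrg = pctrg u, under = vc K (under u) (under t)\<rparr>),
     hc = (\<lambda>u t. \<lparr>pcsrc = ps_comp K T (pcsrc u) (pcsrc t), pctrg = ps_comp K T (pctrg u) (pctrg t),
       under = hc K (under u) (under t)\<rparr>)\<rparr>"


section \<open>Relational doctrines\<close>

text \<open>
  The base is given by families of hom-sets, which need not be disjoint; in particular an arrow
  of a quotient completion is literally an arrow of the original base. Likewise the fibres
  \<open>Rel X Y\<close> need not be disjoint. As in HOL-Algebra, only the values of the record fields on
  the carriers are relevant.

  \<open>Cmp C X Y Z g f\<close> is \<open>g \<circ> f\<close> for \<open>f : X \<rightarrow> Y\<close>, \<open>g : Y \<rightarrow> Z\<close>;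
  \<open>Rix R X A Y B f g\<close> is \<open>R\<^bsub>f,g\<^esub> : R(A,B) \<rightarrow> R(X,Y)\<close> for \<open>f : X \<rightarrow> A\<close>, \<open>g : Y \<rightarrow> B\<close>;
  \<open>Rcmp R X Y Z \<alpha> \<beta>\<close> is \<open>\<alpha> ; \<beta>\<close> in diagrammatic order, \<open>Dia R X\<close> is \<open>d\<^sub>X\<close>, and
  \<open>Conv R X Y \<alpha>\<close> is the converse, in \<open>R(Y,X)\<close>.
\<close>

record ('o, 'a) cat_data =
  Ob :: "'o set"
  Hom :: "'o \<Rightarrow> 'o \<Rightarrow> 'a set"
  Idt :: "'o \<Rightarrow> 'a"
  Cmp :: "'o \<Rightarrow> 'o \<Rightarrow> 'o \<Rightarrow> 'a \<Rightarrow> 'a \<Rightarrow> 'a"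

locale category =
  fixes C :: "('o, 'a, 'z) cat_data_scheme"
  assumes Idt_Hom: "X \<in> Ob C \<Longrightarrow> Idt C X \<in> Hom C X X"
    and Cmp_Hom: "\<lbrakk>X \<in> Ob C; Y \<in> Ob C; Z \<in> Ob C; f \<in> Hom C X Y; g \<in> Hom C Y Z\<rbrakk> \<Longrightarrow>
      Cmp C X Y Z g f \<in> Hom C X Z"
    and Cmp_Idt: "\<lbrakk>X \<in> Ob C; Y \<in> Ob C; f \<in> Hom C X Y\<rbrakk> \<Longrightarrow> Cmp C X X Y f (Idt C X) = f"
      "\<lbrakk>X \<in> Ob C; Y \<in> Ob C; f \<in> Hom C X Y\<rbrakk> \<Longrightarrow> Cmp C X Y Y (Idt C Y) f = f"
    and Cmp_assoc: "\<lbrakk>X \<in> Ob C; Y \<in> Ob C; Z \<in> Ob C; W \<in> Ob C;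
      f \<in> Hom C X Y; g \<in> Hom C Y Z; h \<in> Hom C Z W\<rbrakk> \<Longrightarrow>
      Cmp C X Z W h (Cmp C X Y Z g f) = Cmp C X Y W (Cmp C Y Z W h g) f"

record ('o, 'a, 'r) rel_doctrine = "('o, 'a) cat_data" +
  Rel :: "'o \<Rightarrow> 'o \<Rightarrow> 'r set"
  Leq :: "'o \<Rightarrow> 'o \<Rightarrow> 'r \<Rightarrow> 'r \<Rightarrow> bool"
  Rix :: "'o \<Rightarrow> 'o \<Rightarrow> 'o \<Rightarrow> 'o \<Rightarrow> 'a \<Rightarrow> 'a \<Rightarrow> 'r \<Rightarrow> 'r"
  Dia :: "'o \<Rightarrow> 'r"
  Rcmp :: "'o \<Rightarrow> 'o \<Rightarrow> 'o \<Rightarrow> 'r \<Rightarrow> 'r \<Rightarrow> 'r"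
  Conv :: "'o \<Rightarrow> 'o \<Rightarrow> 'r \<Rightarrow> 'r"

locale relational_doctrine = category R for R :: "('o, 'a, 'r) rel_doctrine" +
  assumes Leq_refl: "\<lbrakk>X \<in> Ob R; Y \<in> Ob R; \<alpha> \<in> Rel R X Y\<rbrakk> \<Longrightarrow> Leq R X Y \<alpha> \<alpha>"
    and Leq_antisym: "\<lbrakk>X \<in> Ob R; Y \<in> Ob R; \<alpha> \<in> Rel R X Y; \<beta> \<in> Rel R X Y;
      Leq R X Y \<alpha> \<beta>; Leq R X Y \<beta> \<alpha>\<rbrakk> \<Longrightarrow> \<alpha> = \<beta>"
    and Leq_trans: "\<lbrakk>X \<in> Ob R; Y \<in> Ob R; \<alpha> \<in> Rel R X Y; \<beta> \<in> Rel R X Y; \<gamma> \<in> Rel R X Y;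
      Leq R X Y \<alpha> \<beta>; Leq R X Y \<beta> \<gamma>\<rbrakk> \<Longrightarrow> Leq R X Y \<alpha> \<gamma>"
    and Rix_Rel: "\<lbrakk>X \<in> Ob R; Y \<in> Ob R; A \<in> Ob R; B \<in> Ob R; f \<in> Hom R X A; g \<in> Hom R Y B;
      \<alpha> \<in> Rel R A B\<rbrakk> \<Longrightarrow> Rix R X A Y B f g \<alpha> \<in> Rel R X Y"
    and Rix_mono: "\<lbrakk>X \<in> Ob R; Y \<in> Ob R; A \<in> Ob R; B \<in> Ob R; f \<in> Hom R X A; g \<in> Hom R Y B;
      \<alpha> \<in> Rel R A B; \<beta> \<in> Rel R A B; Leq R A B \<alpha> \<beta>\<rbrakk> \<Longrightarrow>
      Leq R X Y (Rix R X A Y B f g \<alpha>) (Rix R X A Y B f g \<beta>)"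
    and Rix_Idt: "\<lbrakk>X \<in> Ob R; Y \<in> Ob R; \<alpha> \<in> Rel R X Y\<rbrakk> \<Longrightarrow>
      Rix R X X Y Y (Idt R X) (Idt R Y) \<alpha> = \<alpha>"
    and Rix_Cmp: "\<lbrakk>X \<in> Ob R; X' \<in> Ob R; X'' \<in> Ob R; Y \<in> Ob R; Y' \<in> Ob R; Y'' \<in> Ob R;
      f \<in> Hom R X X'; f' \<in> Hom R X' X''; g \<in> Hom R Y Y'; g' \<in> Hom R Y' Y''; \<alpha> \<in> Rel R X'' Y''\<rbrakk> \<Longrightarrow>
      Rix R X X'' Y Y'' (Cmp R X X' X'' f' f) (Cmp R Y Y' Y'' g' g) \<alpha> =
      Rix R X X' Y Y' f g (Rix R X' X'' Y' Y'' f' g' \<alpha>)"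
    and Dia_Rel: "X \<in> Ob R \<Longrightarrow> Dia R X \<in> Rel R X X"
    and Dia_lax: "\<lbrakk>X \<in> Ob R; Y \<in> Ob R; f \<in> Hom R X Y\<rbrakk> \<Longrightarrow>
      Leq R X X (Dia R X) (Rix R X Y X Y f f (Dia R Y))"
    and Rcmp_Rel: "\<lbrakk>X \<in> Ob R; Y \<in> Ob R; Z \<in> Ob R; \<alpha> \<in> Rel R X Y; \<beta> \<in> Rel R Y Z\<rbrakk> \<Longrightarrow>
      Rcmp R X Y Z \<alpha> \<beta> \<in> Rel R X Z"
    and Rcmp_mono: "\<lbrakk>X \<in> Ob R; Y \<in> Ob R; Z \<in> Ob R; \<alpha> \<in> Rel R X Y; \<alpha>' \<in> Rel R X Y;
      \<beta> \<in> Rel R Y Z; \<beta>' \<in> Rel R Y Z; Leq R X Y \<alpha> \<alpha>'; Leq R Y Z \<beta> \<beta>'\<rbrakk> \<Longrightarrow>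
      Leq R X Z (Rcmp R X Y Z \<alpha> \<beta>) (Rcmp R X Y Z \<alpha>' \<beta>')"
    and Rcmp_lax: "\<lbrakk>X \<in> Ob R; Y \<in> Ob R; Z \<in> Ob R; A \<in> Ob R; B \<in> Ob R; C \<in> Ob R;
      f \<in> Hom R X A; g \<in> Hom R Y B; h \<in> Hom R Z C; \<alpha> \<in> Rel R A B; \<beta> \<in> Rel R B C\<rbrakk> \<Longrightarrow>
      Leq R X Z (Rcmp R X Y Z (Rix R X A Y B f g \<alpha>) (Rix R Y B Z C g h \<beta>))
        (Rix R X A Z C f h (Rcmp R A B C \<alpha> \<beta>))"
    and Conv_Rel: "\<lbrakk>X \<in> Ob R; Y \<in> Ob R; \<alpha> \<in> Rel R X Y\<rbrakk> \<Longrightarrow> Conv R X Y \<alpha> \<in> Rel R Y X"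
    and Conv_mono: "\<lbrakk>X \<in> Ob R; Y \<in> Ob R; \<alpha> \<in> Rel R X Y; \<beta> \<in> Rel R X Y; Leq R X Y \<alpha> \<beta>\<rbrakk> \<Longrightarrow>
      Leq R Y X (Conv R X Y \<alpha>) (Conv R X Y \<beta>)"
    and Conv_lax: "\<lbrakk>X \<in> Ob R; Y \<in> Ob R; A \<in> Ob R; B \<in> Ob R; f \<in> Hom R X A; g \<in> Hom R Y B;
      \<alpha> \<in> Rel R A B\<rbrakk> \<Longrightarrow>
      Leq R Y X (Conv R X Y (Rix R X A Y B f g \<alpha>)) (Rix R Y B X A g f (Conv R A B \<alpha>))"
    and Rcmp_assoc: "\<lbrakk>X \<in> Ob R; Y \<in> Ob R; Z \<in> Ob R; W \<in> Ob R;
      \<alpha> \<in> Rel R X Y; \<beta> \<in> Rel R Y Z; \<gamma> \<in> Rel R Z W\<rbrakk> \<Longrightarrow>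
      Rcmp R X Y W \<alpha> (Rcmp R Y Z W \<beta> \<gamma>) = Rcmp R X Z W (Rcmp R X Y Z \<alpha> \<beta>) \<gamma>"
    and Rcmp_Dia: "\<lbrakk>X \<in> Ob R; Y \<in> Ob R; \<alpha> \<in> Rel R X Y\<rbrakk> \<Longrightarrow> Rcmp R X X Y (Dia R X) \<alpha> = \<alpha>"
      "\<lbrakk>X \<in> Ob R; Y \<in> Ob R; \<alpha> \<in> Rel R X Y\<rbrakk> \<Longrightarrow> Rcmp R X Y Y \<alpha> (Dia R Y) = \<alpha>"
    and Conv_Rcmp: "\<lbrakk>X \<in> Ob R; Y \<in> Ob R; Z \<in> Ob R; \<alpha> \<in> Rel R X Y; \<beta> \<in> Rel R Y Z\<rbrakk> \<Longrightarrow>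
      Conv R X Z (Rcmp R X Y Z \<alpha> \<beta>) = Rcmp R Z Y X (Conv R Y Z \<beta>) (Conv R X Y \<alpha>)"
    and Conv_Dia: "X \<in> Ob R \<Longrightarrow> Conv R X X (Dia R X) = Dia R X"
    and Conv_Conv: "\<lbrakk>X \<in> Ob R; Y \<in> Ob R; \<alpha> \<in> Rel R X Y\<rbrakk> \<Longrightarrow> Conv R Y X (Conv R X Y \<alpha>) = \<alpha>"

definition graph :: "('o, 'a, 'r) rel_doctrine \<Rightarrow> 'o \<Rightarrow> 'o \<Rightarrow> 'a \<Rightarrow> 'r" where
  "graph R X Y f = Rix R X Y Y Y f (Idt R Y) (Dia R Y)"

definition equiv_rel :: "('o, 'a, 'r) rel_doctrine \<Rightarrow> 'o \<Rightarrow> 'r \<Rightarrow> bool" where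
  "equiv_rel R X \<rho> \<longleftrightarrow> \<rho> \<in> Rel R X X \<and> Leq R X X (Dia R X) \<rho> \<and>
     Leq R X X (Conv R X X \<rho>) \<rho> \<and> Leq R X X (Rcmp R X X X \<rho> \<rho>) \<rho>"

definition kernel :: "('o, 'a, 'r) rel_doctrine \<Rightarrow> 'o \<Rightarrow> 'o \<Rightarrow> 'a \<Rightarrow> 'r" where
  "kernel R X Y f = Rcmp R X Y X (graph R X Y f) (Conv R X Y (graph R X Y f))"

definition quotient_arrow :: "('o, 'a, 'r) rel_doctrine \<Rightarrow> 'o \<Rightarrow> 'r \<Rightarrow> 'o \<Rightarrow> 'a \<Rightarrow> bool" where
  "quotient_arrow R X \<rho> W q \<longleftrightarrow>
    W \<in> Ob R \<and> q \<in> Hom R X W \<and> Leq R X X \<rho> (kernel R X W q) \<and>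
    (\<forall>Z\<in>Ob R. \<forall>f\<in>Hom R X Z. Leq R X X \<rho> (kernel R X Z f) \<longrightarrow>
       (\<exists>!h. h \<in> Hom R W Z \<and> f = Cmp R X W Z h q))"

definition effective :: "('o, 'a, 'r) rel_doctrine \<Rightarrow> 'o \<Rightarrow> 'r \<Rightarrow> 'o \<Rightarrow> 'a \<Rightarrow> bool" where
  "effective R X \<rho> W q \<longleftrightarrow> \<rho> = kernel R X W q"

definition descent :: "('o, 'a, 'r) rel_doctrine \<Rightarrow> 'o \<Rightarrow> 'o \<Rightarrow> 'a \<Rightarrow> bool" where
  "descent R X W q \<longleftrightarrow>
     Leq R W W (Dia R W) (Rcmp R W X W (Conv R X W (graph R X W q)) (graph R X W q))"

definition has_quotients :: "('o, 'a, 'r) rel_doctrine \<Rightarrow> bool" where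
  "has_quotients R \<longleftrightarrow> (\<forall>X\<in>Ob R. \<forall>\<rho>. equiv_rel R X \<rho> \<longrightarrow>
     (\<exists>W q. quotient_arrow R X \<rho> W q \<and> effective R X \<rho> W q \<and> descent R X W q))"


section \<open>The 2-categories of relational doctrines\<close>

text \<open>1-arrows and 2-arrows are made extensional, so that equality of records is equality of
  the functors and natural transformations they represent. Preservation of order by \<open>mr\<close> is
  part of its being a natural transformation of functors into posets.\<close>

locale rd_morphism =
  R: relational_doctrine R + S: relational_doctrine S
  for R S :: "('o, 'a, 'r) rel_doctrine" +
  fixes mo :: "'o \<Rightarrow> 'o" and ma :: "'o \<Rightarrow> 'o \<Rightarrow> 'a \<Rightarrow> 'a" and mr :: "'o \<Rightarrow> 'o \<Rightarrow> 'r \<Rightarrow> 'r"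
  assumes mo_PiE: "mo \<in> Ob R \<rightarrow>\<^sub>E Ob S"
    and ma_PiE: "ma \<in> (\<Pi>\<^sub>E X\<in>Ob R. \<Pi>\<^sub>E Y\<in>Ob R. Hom R X Y \<rightarrow>\<^sub>E Hom S (mo X) (mo Y))"
    and mr_PiE: "mr \<in> (\<Pi>\<^sub>E X\<in>Ob R. \<Pi>\<^sub>E Y\<in>Ob R. Rel R X Y \<rightarrow>\<^sub>E Rel S (mo X) (mo Y))"
    and ma_Idt: "X \<in> Ob R \<Longrightarrow> ma X X (Idt R X) = Idt S (mo X)"
    and ma_Cmp: "\<lbrakk>X \<in> Ob R; Y \<in> Ob R; Z \<in> Ob R; f \<in> Hom R X Y; g \<in> Hom R Y Z\<rbrakk> \<Longrightarrow>
      ma X Z (Cmp R X Y Z g f) = Cmp S (mo X) (mo Y) (mo Z) (ma Y Z g) (ma X Y f)"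
    and mr_mono: "\<lbrakk>X \<in> Ob R; Y \<in> Ob R; \<alpha> \<in> Rel R X Y; \<beta> \<in> Rel R X Y; Leq R X Y \<alpha> \<beta>\<rbrakk> \<Longrightarrow>
      Leq S (mo X) (mo Y) (mr X Y \<alpha>) (mr X Y \<beta>)"
    and mr_Rix: "\<lbrakk>X \<in> Ob R; Y \<in> Ob R; A \<in> Ob R; B \<in> Ob R; f \<in> Hom R X A; g \<in> Hom R Y B;
      \<alpha> \<in> Rel R A B\<rbrakk> \<Longrightarrow>
      mr X Y (Rix R X A Y B f g \<alpha>) =
      Rix S (mo X) (mo A) (mo Y) (mo B) (ma X A f) (ma Y B g) (mr A B \<alpha>)"
    and mr_Dia: "X \<in> Ob R \<Longrightarrow> mr X X (Dia R X) = Dia S (mo X)"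
    and mr_Rcmp: "\<lbrakk>X \<in> Ob R; Y \<in> Ob R; Z \<in> Ob R; \<alpha> \<in> Rel R X Y; \<beta> \<in> Rel R Y Z\<rbrakk> \<Longrightarrow>
      mr X Z (Rcmp R X Y Z \<alpha> \<beta>) = Rcmp S (mo X) (mo Y) (mo Z) (mr X Y \<alpha>) (mr Y Z \<beta>)"
    and mr_Conv: "\<lbrakk>X \<in> Ob R; Y \<in> Ob R; \<alpha> \<in> Rel R X Y\<rbrakk> \<Longrightarrow>
      mr Y X (Conv R X Y \<alpha>) = Conv S (mo X) (mo Y) (mr X Y \<alpha>)"

record ('o, 'a, 'r) rd_map =
  dsrc :: "('o, 'a, 'r) rel_doctrine"
  dtrg :: "('o, 'a, 'r) rel_doctrine"
  fo :: "'o \<Rightarrow> 'o"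
  fa :: "'o \<Rightarrow> 'o \<Rightarrow> 'a \<Rightarrow> 'a"
  fr :: "'o \<Rightarrow> 'o \<Rightarrow> 'r \<Rightarrow> 'r"

definition rd_arrow :: "('o, 'a, 'r) rd_map \<Rightarrow> bool" where
  "rd_arrow F \<longleftrightarrow> rd_morphism (dsrc F) (dtrg F) (fo F) (fa F) (fr F)"

locale rd_transformation =
  fixes R S :: "('o, 'a, 'r) rel_doctrine" and F G :: "('o, 'a, 'r) rd_map" and t :: "'o \<Rightarrow> 'a"
  assumes F_arrow: "rd_arrow F" and F_bd: "dsrc F = R" "dtrg F = S"
    and G_arrow: "rd_arrow G" and G_bd: "dsrc G = R" "dtrg G = S"
    and t_PiE: "t \<in> (\<Pi>\<^sub>E X\<in>Ob R. Hom S (fo F X) (fo G X))"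
    and t_natural: "\<lbrakk>X \<in> Ob R; Y \<in> Ob R; f \<in> Hom R X Y\<rbrakk> \<Longrightarrow>
      Cmp S (fo F X) (fo F Y) (fo G Y) (t Y) (fa F X Y f) =
      Cmp S (fo F X) (fo G X) (fo G Y) (fa G X Y f) (t X)"
    and t_lax: "\<lbrakk>X \<in> Ob R; Y \<in> Ob R; \<alpha> \<in> Rel R X Y\<rbrakk> \<Longrightarrow>
      Leq S (fo F X) (fo F Y) (fr F X Y \<alpha>)
        (Rix S (fo F X) (fo G X) (fo F Y) (fo G Y) (t X) (t Y) (fr G X Y \<alpha>))"

record ('o, 'a, 'r) rd_cell =
  msrc :: "('o, 'a, 'r) rd_map"
  mtrg :: "('o, 'a, 'r) rd_map"
  cpt :: "'o \<Rightarrow> 'a"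

definition rd_two_arrow :: "('o, 'a, 'r) rd_cell \<Rightarrow> bool" where
  "rd_two_arrow \<theta> \<longleftrightarrow>
    rd_transformation (dsrc (msrc \<theta>)) (dtrg (msrc \<theta>)) (msrc \<theta>) (mtrg \<theta>) (cpt \<theta>)"

definition rd_id :: "('o, 'a, 'r) rel_doctrine \<Rightarrow> ('o, 'a, 'r) rd_map" where
  "rd_id R = \<lparr>dsrc = R, dtrg = R,
     fo = (\<lambda>X\<in>Ob R. X),
     fa = (\<lambda>X\<in>Ob R. \<lambda>Y\<in>Ob R. \<lambda>f\<in>Hom R X Y. f),
     fr = (\<lambda>X\<in>Ob R. \<lambda>Y\<in>Ob R. \<lambda>\<alpha>\<in>Rel R X Y. \<alpha>)\<rparr>"

definition rd_comp :: "('o, 'a, 'r) rd_map \<Rightarrow> ('o, 'a, 'r) rd_map \<Rightarrow> ('o, 'a, 'r) rd_map" where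
  "rd_comp G F = (let R = dsrc F in \<lparr>dsrc = R, dtrg = dtrg G,
     fo = (\<lambda>X\<in>Ob R. fo G (fo F X)),
     fa = (\<lambda>X\<in>Ob R. \<lambda>Y\<in>Ob R. \<lambda>f\<in>Hom R X Y. fa G (fo F X) (fo F Y) (fa F X Y f)),
     fr = (\<lambda>X\<in>Ob R. \<lambda>Y\<in>Ob R. \<lambda>\<alpha>\<in>Rel R X Y. fr G (fo F X) (fo F Y) (fr F X Y \<alpha>))\<rparr>)"

definition rd_id2 :: "('o, 'a, 'r) rd_map \<Rightarrow> ('o, 'a, 'r) rd_cell" where
  "rd_id2 F = \<lparr>msrc = F, mtrg = F, cpt = (\<lambda>X\<in>Ob (dsrc F). Idt (dtrg F) (fo F X))\<rparr>"

definition rd_vcomp :: "('o, 'a, 'r) rd_cell \<Rightarrow> ('o, 'a, 'r) rd_cell \<Rightarrow> ('o, 'a, 'r) rd_cell" where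
  "rd_vcomp \<phi> \<theta> =
    (let F = msrc \<theta>; G = mtrg \<theta>; H = mtrg \<phi> in \<lparr>msrc = F, mtrg = H,
     cpt = (\<lambda>X\<in>Ob (dsrc F). Cmp (dtrg F) (fo F X) (fo G X) (fo H X) (cpt \<phi> X) (cpt \<theta> X))\<rparr>)"

text \<open>For \<open>\<theta> : F \<Rightarrow> G\<close> and \<open>\<phi> : H \<Rightarrow> K\<close> the Godement product has components
  \<open>\<phi>\<^bsub>GX\<^esub> \<circ> H \<theta>\<^sub>X\<close>.\<close>

definition rd_hcomp :: "('o, 'a, 'r) rd_cell \<Rightarrow> ('o, 'a, 'r) rd_cell \<Rightarrow> ('o, 'a, 'r) rd_cell" where
  "rd_hcomp \<phi> \<theta> =
    (let F = msrc \<theta>; G = mtrg \<theta>; H = msrc \<phi>; K = mtrg \<phi> in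
     \<lparr>msrc = rd_comp H F, mtrg = rd_comp K G,
      cpt = (\<lambda>X\<in>Ob (dsrc F).
        Cmp (dtrg H) (fo H (fo F X)) (fo H (fo G X)) (fo K (fo G X))
          (cpt \<phi> (fo G X)) (fa H (fo F X) (fo G X) (cpt \<theta> X)))\<rparr>)"

type_synonym ('o, 'a, 'r) rd_two_cat =
  "(('o, 'a, 'r) rel_doctrine, ('o, 'a, 'r) rd_map, ('o, 'a, 'r) rd_cell) two_cat"

definition RD :: "('o, 'a, 'r) rd_two_cat" where
  "RD = \<lparr>Obj = {R. relational_doctrine R}, One = {F. rd_arrow F}, Two = {\<theta>. rd_two_arrow \<theta>},
     src1 = dsrc, trg1 = dtrg, src2 = msrc, trg2 = mtrg,
     id1 = rd_id, c1 = rd_comp, id2 = rd_id2, vc = rd_vcomp, hc = rd_hcomp\<rparr>"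

definition preserves_quotient_arrows :: "('o, 'a, 'r) rd_map \<Rightarrow> bool" where
  "preserves_quotient_arrows F \<longleftrightarrow>
    (\<forall>X\<in>Ob (dsrc F). \<forall>\<rho> W q. equiv_rel (dsrc F) X \<rho> \<longrightarrow> quotient_arrow (dsrc F) X \<rho> W q \<longrightarrow>
       quotient_arrow (dtrg F) (fo F X) (fr F X X \<rho>) (fo F W) (fa F X W q))"

definition qrd_arrow :: "('o, 'a, 'r) rd_map \<Rightarrow> bool" where
  "qrd_arrow F \<longleftrightarrow> rd_arrow F \<and> has_quotients (dsrc F) \<and> has_quotients (dtrg F) \<and>
     preserves_quotient_arrows F"

definition QRD :: "('o, 'a, 'r) rd_two_cat" where
  "QRD = RD\<lparr>Obj := {R. relational_doctrine R \<and> has_quotients R},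
     One := {F. qrd_arrow F},
     Two := {\<theta>. rd_two_arrow \<theta> \<and> qrd_arrow (msrc \<theta>) \<and> qrd_arrow (mtrg \<theta>)}\<rparr>"


section \<open>The intensional quotient completion\<close>

text \<open>
  The objects of a doctrine are drawn from a type \<open>'o\<close>, which plays the role of a universe. For
  the quotient completion to be an operation on doctrines over the same universe, pairs
  \<open>(X, \<rho>)\<close> are coded in \<open>'o\<close> by a function \<open>pr\<close>, which has to be injective for the
  definitions below to be meaningful (e.g. any pairing function if \<open>'o = 'r\<close> is infinite);
  \<open>und\<close> and \<open>erel\<close> recover the two components of a coded pair.
\<close>

definition und :: "('o \<times> 'r \<Rightarrow> 'o) \<Rightarrow> 'o \<Rightarrow> 'o" where
  "und pr A = fst (inv pr A)"

definition erel :: "('o \<times> 'r \<Rightarrow> 'o) \<Rightarrow> 'o \<Rightarrow> 'r" where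
  "erel pr A = snd (inv pr A)"

definition quot_compl ::
  "('o \<times> 'r \<Rightarrow> 'o) \<Rightarrow> ('o, 'a, 'r) rel_doctrine \<Rightarrow> ('o, 'a, 'r) rel_doctrine" where
  "quot_compl pr R = (let u = und pr; e = erel pr in \<lparr>
     Ob = {pr (X, \<rho>) | X \<rho>. X \<in> Ob R \<and> equiv_rel R X \<rho>},
     Hom = (\<lambda>A B. {f \<in> Hom R (u A) (u B).
              Leq R (u A) (u A) (e A) (Rix R (u A) (u B) (u A) (u B) f f (e B))}),
     Idt = (\<lambda>A. Idt R (u A)),
     Cmp = (\<lambda>A B C. Cmp R (u A) (u B) (u C)),
     Rel = (\<lambda>A B. {\<alpha> \<in> Rel R (u A) (u B).
              Leq R (u A) (u B)
                (Rcmp R (u A) (u B) (u B)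
                  (Rcmp R (u A) (u A) (u B) (Conv R (u A) (u A) (e A)) \<alpha>) (e B)) \<alpha>}),
     Leq = (\<lambda>A B. Leq R (u A) (u B)),
     Rix = (\<lambda>A A' B B'. Rix R (u A) (u A') (u B) (u B')),
     Dia = e,
     Rcmp = (\<lambda>A B C. Rcmp R (u A) (u B) (u C)),
     Conv = (\<lambda>A B. Conv R (u A) (u B))\<rparr>)"

definition Tq_map :: "('o \<times> 'r \<Rightarrow> 'o) \<Rightarrow> ('o, 'a, 'r) rd_map \<Rightarrow> ('o, 'a, 'r) rd_map" where
  "Tq_map pr F =
    (let u = und pr; e = erel pr; Q = quot_compl pr (dsrc F) in
     \<lparr>dsrc = Q, dtrg = quot_compl pr (dtrg F),
      fo = (\<lambda>A\<in>Ob Q. pr (fo F (u A), fr F (u A) (u A) (e A))),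
      fa = (\<lambda>A\<in>Ob Q. \<lambda>B\<in>Ob Q. \<lambda>f\<in>Hom Q A B. fa F (u A) (u B) f),
      fr = (\<lambda>A\<in>Ob Q. \<lambda>B\<in>Ob Q. \<lambda>\<alpha>\<in>Rel Q A B. fr F (u A) (u B) \<alpha>)\<rparr>)"

definition Tq_cell :: "('o \<times> 'r \<Rightarrow> 'o) \<Rightarrow> ('o, 'a, 'r) rd_cell \<Rightarrow> ('o, 'a, 'r) rd_cell" where
  "Tq_cell pr \<theta> =
    \<lparr>msrc = Tq_map pr (msrc \<theta>), mtrg = Tq_map pr (mtrg \<theta>),
     cpt = (\<lambda>A\<in>Ob (quot_compl pr (dsrc (msrc \<theta>))). cpt \<theta> (und pr A))\<rparr>"

definition Tq_unit :: "('o \<times> 'r \<Rightarrow> 'o) \<Rightarrow> ('o, 'a, 'r) rel_doctrine \<Rightarrow> ('o, 'a, 'r) rd_map" where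
  "Tq_unit pr R =
    \<lparr>dsrc = R, dtrg = quot_compl pr R,
     fo = (\<lambda>X\<in>Ob R. pr (X, Dia R X)),
     fa = (\<lambda>X\<in>Ob R. \<lambda>Y\<in>Ob R. \<lambda>f\<in>Hom R X Y. f),
     fr = (\<lambda>X\<in>Ob R. \<lambda>Y\<in>Ob R. \<lambda>\<alpha>\<in>Rel R X Y. \<alpha>)\<rparr>"

definition Tq_mult :: "('o \<times> 'r \<Rightarrow> 'o) \<Rightarrow> ('o, 'a, 'r) rel_doctrine \<Rightarrow> ('o, 'a, 'r) rd_map" where
  "Tq_mult pr R =
    (let QQ = quot_compl pr (quot_compl pr R) in
     \<lparr>dsrc = QQ, dtrg = quot_compl pr R,
      fo = (\<lambda>A\<in>Ob QQ. pr (und pr (und pr A), erel pr A)),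
      fa = (\<lambda>A\<in>Ob QQ. \<lambda>B\<in>Ob QQ. \<lambda>f\<in>Hom QQ A B. f),
      fr = (\<lambda>A\<in>Ob QQ. \<lambda>B\<in>Ob QQ. \<lambda>\<alpha>\<in>Rel QQ A B. \<alpha>)\<rparr>)"

definition Tq ::
  "('o \<times> 'r \<Rightarrow> 'o) \<Rightarrow> (('o, 'a, 'r) rel_doctrine, ('o, 'a, 'r) rd_map, ('o, 'a, 'r) rd_cell) two_monad_data"
where
  "Tq pr = \<lparr>on0 = quot_compl pr, on1 = Tq_map pr, on2 = Tq_cell pr,
     unit = Tq_unit pr, mult = Tq_mult pr\<rparr>"

end

theory Submission
  imports Defs
begin

text \<open>
  A pseudoalgebra for the quotient completion is a choice of quotients, and all the rest of its
  structure is forced. In one direction, if every \<open>R\<close>-equivalence relation \<open>\<rho>\<close> on \<open>X\<close> is given an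
  effective descent quotient \<open>p : X \<rightarrow> a (X, \<rho>)\<close>, the universal property makes \<open>a\<close> a functor, and
  \<open>\<alpha> \<mapsto> \<Gamma>\<^sub>p\<^sup>\<bottom> ; \<alpha> ; \<Gamma>\<^bsub>p'\<^esub>\<close>, for \<open>p\<close> and \<open>p'\<close> the quotient arrows of the two sides,
  extends it to relations (\<open>quotient_choice_ex\<close>). A quotient by the
  diagonal is an isomorphism, and a quotient of a quotient is a quotient of the original object;
  the comparisons are the 2-cells \<open>\<iota>\<close> and \<open>\<kappa>\<close>. The coherence laws are equations between arrows out
  of iterated quotients, and quotient arrows are epic, so they can be checked on the original
  object, where both sides are the same quotient arrow (\<open>choice_data.pseudoalgebra\<close>).

  In the other direction, let \<open>(R, a, \<iota>, \<kappa>)\<close> be a pseudoalgebra. The identity of \<open>X\<close> is an arrow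
  \<open>(X, d) \<rightarrow> (X, \<rho>)\<close> of the quotient completion, and \<open>a (id) \<circ> \<iota>\<^sub>X : X \<rightarrow> a (X, \<rho>)\<close> is an effective
  descent quotient arrow of \<open>\<rho>\<close> (\<open>proj_edq\<close>). Effectiveness and descent hold because \<open>a\<close> is a
  1-arrow of doctrines and \<open>\<iota>\<close> is invertible. Factorizations are obtained by applying \<open>a\<close> to an
  arrow \<open>(X, \<rho>) \<rightarrow> (Z, d)\<close>; their uniqueness is where \<open>\<kappa>\<close> and the two unit laws enter
  (\<open>kappa_proj\<close>, \<open>action_proj\<close>). The first of these lemmas also shows that \<open>\<kappa>\<close> is the comparison
  above.

  For a pseudomorphism \<open>(F, \<phi>)\<close>, the unit law and naturality say that \<open>\<phi>\<close> commutes with the chosen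
  quotient arrows (\<open>unit_law_iff_mates\<close>). Hence \<open>\<phi>\<close> is determined by \<open>F\<close>, and an invertible \<open>\<phi>\<close>
  exists exactly when \<open>F\<close> preserves quotient arrows; the other law and the condition on algebra
  2-cells are again equations between arrows out of quotients, and hold automatically
  (\<open>mates_mult_law\<close>, \<open>pseudomorphism_iff\<close>, \<open>algebra_cell_iff\<close>).

  Thus the forgetful 2-functor from pseudoalgebras to doctrines with quotients is bijective on
  parallel 1-cells and 2-cells and surjective on objects. Such a 2-functor is a strict equivalence
  (\<open>hom_bijection.equivalent\<close>), and it also reflects the equational laws of a 2-category, so that
  those of the 2-category of pseudoalgebras follow from those for doctrines.

  The comparisons between quotients are treated uniformly through the notion of a covering of a
  1-arrow: a presentation of all its values as quotients of given objects.
\<close>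

section \<open>Strict 2-categories and hom-bijective 2-functors\<close>

text \<open>Boundary conditions of a 2-category, without the equational laws. When a structure maps
  faithfully to a 2-category, these are all that has to be checked by hand.\<close>

locale two_graph =
  fixes L :: "('p, 'n, 'd) two_cat"
  assumes g_bd1: "f \<in> One L \<Longrightarrow> src1 L f \<in> Obj L" "f \<in> One L \<Longrightarrow> trg1 L f \<in> Obj L"
    and g_bd2: "\<theta> \<in> Two L \<Longrightarrow> src2 L \<theta> \<in> One L" "\<theta> \<in> Two L \<Longrightarrow> trg2 L \<theta> \<in> One L"
    and g_parallel: "\<theta> \<in> Two L \<Longrightarrow> src1 L (trg2 L \<theta>) = src1 L (src2 L \<theta>)"
      "\<theta> \<in> Two L \<Longrightarrow> trg1 L (trg2 L \<theta>) = trg1 L (src2 L \<theta>)"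
    and g_id1: "A \<in> Obj L \<Longrightarrow> id1 L A \<in> one L A A"
    and g_c1: "\<lbrakk>f \<in> One L; g \<in> One L; src1 L g = trg1 L f\<rbrakk> \<Longrightarrow>
      c1 L g f \<in> one L (src1 L f) (trg1 L g)"
    and g_id2: "f \<in> One L \<Longrightarrow> id2 L f \<in> two L f f"
    and g_vc: "\<lbrakk>\<theta> \<in> Two L; \<phi> \<in> Two L; src2 L \<phi> = trg2 L \<theta>\<rbrakk> \<Longrightarrow>
      vc L \<phi> \<theta> \<in> two L (src2 L \<theta>) (trg2 L \<phi>)"
    and g_hc: "\<lbrakk>\<theta> \<in> Two L; \<phi> \<in> Two L; src1 L (src2 L \<phi>) = trg1 L (src2 L \<theta>)\<rbrakk> \<Longrightarrow>
      hc L \<phi> \<theta> \<in> two L (c1 L (src2 L \<phi>) (src2 L \<theta>)) (c1 L (trg2 L \<phi>) (trg2 L \<theta>))"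
begin

lemma bd_simps [simp]:
  "f \<in> One L \<Longrightarrow> src1 L f \<in> Obj L" "f \<in> One L \<Longrightarrow> trg1 L f \<in> Obj L"
  "\<theta> \<in> Two L \<Longrightarrow> src2 L \<theta> \<in> One L" "\<theta> \<in> Two L \<Longrightarrow> trg2 L \<theta> \<in> One L"
  "\<theta> \<in> Two L \<Longrightarrow> src1 L (trg2 L \<theta>) = src1 L (src2 L \<theta>)"
  "\<theta> \<in> Two L \<Longrightarrow> trg1 L (trg2 L \<theta>) = trg1 L (src2 L \<theta>)"
  by (simp_all add: g_bd1 g_bd2 g_parallel)

lemma cell_simps [simp]:
  "A \<in> Obj L \<Longrightarrow> id1 L A \<in> One L" "A \<in> Obj L \<Longrightarrow> src1 L (id1 L A) = A"
  "A \<in> Obj L \<Longrightarrow> trg1 L (id1 L A) = A"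
  "\<lbrakk>f \<in> One L; g \<in> One L; src1 L g = trg1 L f\<rbrakk> \<Longrightarrow> c1 L g f \<in> One L"
  "\<lbrakk>f \<in> One L; g \<in> One L; src1 L g = trg1 L f\<rbrakk> \<Longrightarrow> src1 L (c1 L g f) = src1 L f"
  "\<lbrakk>f \<in> One L; g \<in> One L; src1 L g = trg1 L f\<rbrakk> \<Longrightarrow> trg1 L (c1 L g f) = trg1 L g"
  "f \<in> One L \<Longrightarrow> id2 L f \<in> Two L" "f \<in> One L \<Longrightarrow> src2 L (id2 L f) = f"
  "f \<in> One L \<Longrightarrow> trg2 L (id2 L f) = f"
  "\<lbrakk>\<theta> \<in> Two L; \<phi> \<in> Two L; src2 L \<phi> = trg2 L \<theta>\<rbrakk> \<Longrightarrow> vc L \<phi> \<theta> \<in> Two L"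
  "\<lbrakk>\<theta> \<in> Two L; \<phi> \<in> Two L; src2 L \<phi> = trg2 L \<theta>\<rbrakk> \<Longrightarrow> src2 L (vc L \<phi> \<theta>) = src2 L \<theta>"
  "\<lbrakk>\<theta> \<in> Two L; \<phi> \<in> Two L; src2 L \<phi> = trg2 L \<theta>\<rbrakk> \<Longrightarrow> trg2 L (vc L \<phi> \<theta>) = trg2 L \<phi>"
  "\<lbrakk>\<theta> \<in> Two L; \<phi> \<in> Two L; src1 L (src2 L \<phi>) = trg1 L (src2 L \<theta>)\<rbrakk> \<Longrightarrow> hc L \<phi> \<theta> \<in> Two L"
  "\<lbrakk>\<theta> \<in> Two L; \<phi> \<in> Two L; src1 L (src2 L \<phi>) = trg1 L (src2 L \<theta>)\<rbrakk> \<Longrightarrow>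
    src2 L (hc L \<phi> \<theta>) = c1 L (src2 L \<phi>) (src2 L \<theta>)"
  "\<lbrakk>\<theta> \<in> Two L; \<phi> \<in> Two L; src1 L (src2 L \<phi>) = trg1 L (src2 L \<theta>)\<rbrakk> \<Longrightarrow>
    trg2 L (hc L \<phi> \<theta>) = c1 L (trg2 L \<phi>) (trg2 L \<theta>)"
  using g_id1 g_c1 g_id2 g_vc g_hc by (simp_all add: one_def two_def)

end

sublocale two_category \<subseteq> two_graph K
  by unfold_locales
    (fact bd1 bd2 parallel id1_one c1_one id2_two vc_two hc_two)+

text \<open>A structure-preserving map that is injective on parallel 1-cells and on parallel 2-cells
  reflects every equational law.\<close>

locale faithful_map = K: two_category K + L: two_graph L + G: two_functor L K G
  for K :: "('o, 'm, 'c) two_cat" and L :: "('p, 'n, 'd) two_cat"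
    and G :: "('p, 'n, 'd, 'o, 'm, 'c) two_map" +
  assumes faithful1: "\<lbrakk>f \<in> One L; f' \<in> One L; src1 L f = src1 L f'; trg1 L f = trg1 L f';
      on1 G f = on1 G f'\<rbrakk> \<Longrightarrow> f = f'"
    and faithful2: "\<lbrakk>\<theta> \<in> Two L; \<theta>' \<in> Two L; src2 L \<theta> = src2 L \<theta>'; trg2 L \<theta> = trg2 L \<theta>';
      on2 G \<theta> = on2 G \<theta>'\<rbrakk> \<Longrightarrow> \<theta> = \<theta>'"
begin

lemma image_simps [simp]:
  "A \<in> Obj L \<Longrightarrow> on0 G A \<in> Obj K"
  "f \<in> One L \<Longrightarrow> on1 G f \<in> One K"
  "f \<in> One L \<Longrightarrow> src1 K (on1 G f) = on0 G (src1 L f)"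
  "f \<in> One L \<Longrightarrow> trg1 K (on1 G f) = on0 G (trg1 L f)"
  "\<theta> \<in> Two L \<Longrightarrow> on2 G \<theta> \<in> Two K"
  "\<theta> \<in> Two L \<Longrightarrow> src2 K (on2 G \<theta>) = on1 G (src2 L \<theta>)"
  "\<theta> \<in> Two L \<Longrightarrow> trg2 K (on2 G \<theta>) = on1 G (trg2 L \<theta>)"
  using G.on0_Obj G.on1_one G.on2_two by (simp_all add: one_def two_def)

lemmas preserve [simp] = G.on1_id1 G.on1_c1 G.on2_id2 G.on2_vc G.on2_hc

lemma c1_unit:
  "f \<in> One L \<Longrightarrow> c1 L f (id1 L (src1 L f)) = f" "f \<in> One L \<Longrightarrow> c1 L (id1 L (trg1 L f)) f = f"
  using K.c1_id[of "on1 G f"] by (auto intro!: faithful1)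

lemma c1_assoc':
  "\<lbrakk>f \<in> One L; g \<in> One L; h \<in> One L; src1 L g = trg1 L f; src1 L h = trg1 L g\<rbrakk> \<Longrightarrow>
    c1 L h (c1 L g f) = c1 L (c1 L h g) f"
  by (rule faithful1) (simp_all add: K.c1_assoc)


lemma two_category_L: "two_category L"
proof (rule two_category.intro, goal_cases)
  case (14 \<theta>)
  then show ?case using K.vc_id[of "on2 G \<theta>"] by (auto intro!: faithful2)
next
  case (15 \<theta>)
  then show ?case using K.vc_id[of "on2 G \<theta>"] by (auto intro!: faithful2)
next
  case (16 \<theta> \<phi> \<chi>)
  then show ?case by (auto intro!: faithful2 simp: K.vc_assoc)
next
  case (18 \<theta>)
  then show ?case using K.hc_id[of "on2 G \<theta>"] c1_unit[of "trg2 L \<theta>"]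
    by (auto intro!: faithful2 simp: c1_unit)
next
  case (19 \<theta>)
  then show ?case using K.hc_id[of "on2 G \<theta>"] c1_unit[of "trg2 L \<theta>"]
    by (auto intro!: faithful2 simp: c1_unit)
next
  case (20 \<theta> \<phi> \<chi>)
  then show ?case by (auto intro!: faithful2 simp: K.hc_assoc c1_assoc')
next
  case (22 \<theta> \<theta>' \<phi> \<phi>')
  then show ?case by (auto intro!: faithful2 simp: K.interchange)
qed (auto intro!: faithful2 simp: L.g_id1 L.g_c1 L.g_id2 L.g_vc L.g_hc c1_unit c1_assoc' K.hc_id2)

end

text \<open>A faithful map that is moreover full on 1-cells and on 2-cells, and surjective on objects with a
  chosen section \<open>s\<close>, is an equivalence: \<open>s\<close> extends to a 2-functor in exactly one way that makes it
  a strict section, and the identities of \<open>K\<close> lift to the comparison between \<open>s \<circ> G\<close> and the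
  identity.\<close>

locale hom_bijection = faithful_map K L G
  for K :: "('o, 'm, 'c) two_cat" and L :: "('p, 'n, 'd) two_cat"
    and G :: "('p, 'n, 'd, 'o, 'm, 'c) two_map" +
  fixes s :: "'o \<Rightarrow> 'p"
  assumes section_Obj: "A \<in> Obj K \<Longrightarrow> s A \<in> Obj L"
    and section_retract: "A \<in> Obj K \<Longrightarrow> on0 G (s A) = A"
    and full1: "\<lbrakk>P \<in> Obj L; Q \<in> Obj L; k \<in> one K (on0 G P) (on0 G Q)\<rbrakk> \<Longrightarrow>
      \<exists>f\<in>one L P Q. on1 G f = k"
    and full2: "\<lbrakk>f \<in> One L; g \<in> One L; src1 L f = src1 L g; trg1 L f = trg1 L g;
      \<theta> \<in> two K (on1 G f) (on1 G g)\<rbrakk> \<Longrightarrow> \<exists>\<theta>'\<in>two L f g. on2 G \<theta>' = \<theta>"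
begin

definition lift1 :: "'p \<Rightarrow> 'p \<Rightarrow> 'm \<Rightarrow> 'n" where
  "lift1 A B f = (SOME f'. f' \<in> one L A B \<and> on1 G f' = f)"

definition lift2 :: "'n \<Rightarrow> 'n \<Rightarrow> 'c \<Rightarrow> 'd" where
  "lift2 f g \<theta> = (SOME \<theta>'. \<theta>' \<in> two L f g \<and> on2 G \<theta>' = \<theta>)"

lemma lift1 [simp]:
  assumes "A \<in> Obj L" "B \<in> Obj L" "f \<in> One K" "src1 K f = on0 G A" "trg1 K f = on0 G B"
  shows "lift1 A B f \<in> One L" "src1 L (lift1 A B f) = A" "trg1 L (lift1 A B f) = B"
    "on1 G (lift1 A B f) = f"
proof -
  have "\<exists>f'. f' \<in> one L A B \<and> on1 G f' = f"
    using full1[of A B f] assms by (auto simp: one_def)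
  then have "lift1 A B f \<in> one L A B \<and> on1 G (lift1 A B f) = f"
    unfolding lift1_def by (rule someI_ex)
  then show "lift1 A B f \<in> One L" "src1 L (lift1 A B f) = A" "trg1 L (lift1 A B f) = B"
    "on1 G (lift1 A B f) = f" by (simp_all add: one_def)
qed

lemma lift2 [simp]:
  assumes "f \<in> One L" "g \<in> One L" "src1 L f = src1 L g" "trg1 L f = trg1 L g"
    "\<theta> \<in> Two K" "src2 K \<theta> = on1 G f" "trg2 K \<theta> = on1 G g"
  shows "lift2 f g \<theta> \<in> Two L" "src2 L (lift2 f g \<theta>) = f" "trg2 L (lift2 f g \<theta>) = g"
    "on2 G (lift2 f g \<theta>) = \<theta>"
proof -
  have "\<exists>\<theta>'. \<theta>' \<in> two L f g \<and> on2 G \<theta>' = \<theta>"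
    using full2[of f g \<theta>] assms by (auto simp: two_def)
  then have "lift2 f g \<theta> \<in> two L f g \<and> on2 G (lift2 f g \<theta>) = \<theta>"
    unfolding lift2_def by (rule someI_ex)
  then show "lift2 f g \<theta> \<in> Two L" "src2 L (lift2 f g \<theta>) = f" "trg2 L (lift2 f g \<theta>) = g"
    "on2 G (lift2 f g \<theta>) = \<theta>" by (simp_all add: two_def)
qed

declare section_Obj [simp] section_retract [simp]

abbreviation "F1 f \<equiv> lift1 (s (src1 K f)) (s (trg1 K f)) f"

definition F :: "('o, 'm, 'c, 'p, 'n, 'd) two_map" where
  "F = \<lparr>on0 = s, on1 = F1, on2 = (\<lambda>\<theta>. lift2 (F1 (src2 K \<theta>)) (F1 (trg2 K \<theta>)) \<theta>)\<rparr>"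

lemma F_functor: "two_functor K L F"
  by (rule two_functor.intro)
    (auto simp: F_def one_def two_def intro!: faithful1 faithful2)

lemma GF_isomorphic: "two_isomorphic K K (two_comp G F) two_id"
  unfolding two_isomorphic_def
proof (intro exI conjI ballI)
  show "two_natural K K (two_comp G F) two_id (id1 K)"
  proof (rule two_natural.intro, goal_cases)
    case (1 A) then show ?case by (simp add: two_comp_def two_id_def one_def F_def)
  next
    case (2 f) then show ?case
      using K.c1_id[of f] by (simp add: two_comp_def two_id_def F_def)
  next
    case (3 \<theta>) then show ?case
      using K.hc_id[of \<theta>] by (simp add: two_comp_def two_id_def F_def)
  qed
next
  fix A assume "A \<in> Obj K"
  then show "iso1 K (id1 K A)"
    using K.c1_id[of "id1 K A"] by (auto simp: iso1_def one_def intro!: exI[of _ "id1 K A"])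
qed

lemma FG_isomorphic: "two_isomorphic L L (two_comp F G) two_id"
  unfolding two_isomorphic_def
proof (intro exI conjI ballI)
  let ?t = "\<lambda>A. lift1 (s (on0 G A)) A (id1 K (on0 G A))"
  show "two_natural L L (two_comp F G) two_id ?t"
  proof (rule two_natural.intro, goal_cases)
    case (1 A) then show ?case by (simp add: two_comp_def two_id_def one_def F_def)
  next
    case (2 f) then show ?case
      using K.c1_id[of "on1 G f"]
      by (auto simp add: two_comp_def two_id_def F_def intro!: faithful1)
  next
    case (3 \<theta>)
    interpret two_category L by (rule two_category_L)
    have c1_G: "c1 K (id1 K (on0 G (trg1 L f))) (on1 G f) = c1 K (on1 G f) (id1 K (on0 G (src1 L f)))"
      if "f \<in> One L" for f using K.c1_id[of "on1 G f"] that by simp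
    have c1_L: "c1 L (?t (trg1 L f)) (F1 (on1 G f)) = c1 L f (?t (src1 L f))"
      if "f \<in> One L" for f using that c1_G[OF that] by (auto intro!: faithful1)
    show ?case
      using 3 K.hc_id[of "on2 G \<theta>"] c1_L[of "src2 L \<theta>"] c1_L[of "trg2 L \<theta>"]
      by (auto simp add: two_comp_def two_id_def F_def intro!: faithful2)
  qed
next
  fix A assume "A \<in> Obj L"
  then show "iso1 L (lift1 (s (on0 G A)) A (id1 K (on0 G A)))"
    using K.c1_id[of "id1 K (on0 G A)"]
    by (auto simp: iso1_def one_def intro!: faithful1
        exI[of _ "lift1 A (s (on0 G A)) (id1 K (on0 G A))"])
qed

theorem equivalent: "two_equivalent K L"
  unfolding two_equivalent_def
  using K.two_category_axioms two_category_L F_functor G.two_functor_axioms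
    GF_isomorphic FG_isomorphic by blast

end

section \<open>The 2-category of relational doctrines\<close>

lemmas (in relational_doctrine) doctrine = relational_doctrine_axioms

declare (in relational_doctrine)
  Idt_Hom [simp] Cmp_Hom [simp] Cmp_Idt [simp] Rix_Rel [simp] Rix_Idt [simp] Dia_Rel [simp]
  Rcmp_Rel [simp] Conv_Rel [simp] Rcmp_Dia [simp] Conv_Dia [simp] Conv_Conv [simp]
  Leq_refl [simp]

text \<open>A 1-arrow together with its boundary, so that source and target can be named
  independently of the record fields.\<close>

locale rd_arr = rd_morphism R S "fo F" "fa F" "fr F"
  for R S :: "('o, 'a, 'r) rel_doctrine" and F :: "('o, 'a, 'r) rd_map" +
  assumes dsrc_eq [simp]: "dsrc F = R" and dtrg_eq [simp]: "dtrg F = S"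
begin

lemma fo_Ob [simp]: "X \<in> Ob R \<Longrightarrow> fo F X \<in> Ob S"
  using mo_PiE by auto

lemma fa_Hom [simp]: "\<lbrakk>X \<in> Ob R; Y \<in> Ob R; f \<in> Hom R X Y\<rbrakk> \<Longrightarrow> fa F X Y f \<in> Hom S (fo F X) (fo F Y)"
  using ma_PiE by (fastforce simp: PiE_iff)

lemma fr_Rel [simp]: "\<lbrakk>X \<in> Ob R; Y \<in> Ob R; \<alpha> \<in> Rel R X Y\<rbrakk> \<Longrightarrow> fr F X Y \<alpha> \<in> Rel S (fo F X) (fo F Y)"
  using mr_PiE by (fastforce simp: PiE_iff)

lemmas arr = rd_arr_axioms

declare ma_Idt [simp] ma_Cmp [simp] mr_Rix [simp] mr_Dia [simp] mr_Rcmp [simp] mr_Conv [simp]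

end

lemma rd_arr_iff: "rd_arr R S F \<longleftrightarrow> rd_arrow F \<and> dsrc F = R \<and> dtrg F = S"
  by (auto simp: rd_arr_def rd_arr_axioms_def rd_arrow_def)

lemma one_RD [simp]: "F \<in> one RD R S \<longleftrightarrow> rd_arr R S F"
  by (auto simp: one_def RD_def rd_arr_iff)

lemma rd_arr_eqI:
  assumes "rd_arr R S F" "rd_arr R S G"
    and "\<And>X. X \<in> Ob R \<Longrightarrow> fo F X = fo G X"
    and "\<And>X Y f. \<lbrakk>X \<in> Ob R; Y \<in> Ob R; f \<in> Hom R X Y\<rbrakk> \<Longrightarrow> fa F X Y f = fa G X Y f"
    and "\<And>X Y \<alpha>. \<lbrakk>X \<in> Ob R; Y \<in> Ob R; \<alpha> \<in> Rel R X Y\<rbrakk> \<Longrightarrow> fr F X Y \<alpha> = fr G X Y \<alpha>"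
  shows "F = G"
proof -
  interpret F: rd_arr R S F by fact
  interpret G: rd_arr R S G by fact
  have o: "fo F = fo G"
    by (rule PiE_ext[OF F.mo_PiE G.mo_PiE assms(3)])
  have ext: "h = k" if "h \<in> extensional A" "k \<in> extensional A" "\<And>x. x \<in> A \<Longrightarrow> h x = k x"
    for h k :: "'x \<Rightarrow> 'y" and A using that by (rule extensionalityI)
  have a: "fa F = fa G"
    using F.ma_PiE G.ma_PiE assms(4)
    by (intro ext[of _ "Ob R"]; (intro ext[of _ "Ob R"])?; (intro ext)?)
      (auto simp: PiE_iff intro!: extensionalityI)
  have r: "fr F = fr G"
    using F.mr_PiE G.mr_PiE assms(5)
    by (intro ext[of _ "Ob R"]; (intro ext[of _ "Ob R"])?; (intro ext)?)
      (auto simp: PiE_iff intro!: extensionalityI)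
  show ?thesis
    using o a r F.dsrc_eq F.dtrg_eq G.dsrc_eq G.dtrg_eq by (intro rd_map.equality) simp_all
qed

locale rd_cel = rd_transformation R S F G "cpt \<theta>"
  for R S :: "('o, 'a, 'r) rel_doctrine" and F G and \<theta> :: "('o, 'a, 'r) rd_cell" +
  assumes msrc_eq [simp]: "msrc \<theta> = F" and mtrg_eq [simp]: "mtrg \<theta> = G"
begin

sublocale F: rd_arr R S F using F_arrow F_bd by (simp add: rd_arr_iff)
sublocale G: rd_arr R S G using G_arrow G_bd by (simp add: rd_arr_iff)

lemmas cel = rd_cel_axioms

lemma cpt_Hom [simp]: "X \<in> Ob R \<Longrightarrow> cpt \<theta> X \<in> Hom S (fo F X) (fo G X)"
  using t_PiE by auto

end

lemma rd_cel_iff: "rd_cel R S F G \<theta> \<longleftrightarrow>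
    rd_two_arrow \<theta> \<and> msrc \<theta> = F \<and> mtrg \<theta> = G \<and> dsrc F = R \<and> dtrg F = S"
  by (auto simp: rd_cel_def rd_cel_axioms_def rd_two_arrow_def rd_transformation_def)

lemma rd_celI:
  assumes "rd_arr R S F" "rd_arr R S G" "msrc \<theta> = F" "mtrg \<theta> = G" "cpt \<theta> \<in> extensional (Ob R)"
    and "\<And>X. X \<in> Ob R \<Longrightarrow> cpt \<theta> X \<in> Hom S (fo F X) (fo G X)"
    and "\<And>X Y f. \<lbrakk>X \<in> Ob R; Y \<in> Ob R; f \<in> Hom R X Y\<rbrakk> \<Longrightarrow>
      Cmp S (fo F X) (fo F Y) (fo G Y) (cpt \<theta> Y) (fa F X Y f) =
      Cmp S (fo F X) (fo G X) (fo G Y) (fa G X Y f) (cpt \<theta> X)"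
    and "\<And>X Y \<alpha>. \<lbrakk>X \<in> Ob R; Y \<in> Ob R; \<alpha> \<in> Rel R X Y\<rbrakk> \<Longrightarrow>
      Leq S (fo F X) (fo F Y) (fr F X Y \<alpha>)
        (Rix S (fo F X) (fo G X) (fo F Y) (fo G Y) (cpt \<theta> X) (cpt \<theta> Y) (fr G X Y \<alpha>))"
  shows "rd_cel R S F G \<theta>"
  using assms
  by (auto simp: rd_cel_def rd_cel_axioms_def rd_transformation_def rd_arr_iff PiE_iff)

lemma two_RD [simp]:
  "rd_arr R S F \<Longrightarrow> \<theta> \<in> two RD F G \<longleftrightarrow> rd_cel R S F G \<theta>"
  by (auto simp: two_def RD_def rd_cel_iff rd_arr_iff)

lemma rd_cel_eqI:
  assumes "rd_cel R S F G \<theta>" "rd_cel R S F G \<phi>" "\<And>X. X \<in> Ob R \<Longrightarrow> cpt \<theta> X = cpt \<phi> X"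
  shows "\<theta> = \<phi>"
proof -
  interpret t: rd_cel R S F G \<theta> by fact
  interpret p: rd_cel R S F G \<phi> by fact
  have "cpt \<theta> = cpt \<phi>" by (rule PiE_ext[OF t.t_PiE p.t_PiE assms(3)])
  then show ?thesis
    using t.msrc_eq t.mtrg_eq p.msrc_eq p.mtrg_eq by (intro rd_cell.equality) simp_all
qed

lemma rd_id_arr: "relational_doctrine R \<Longrightarrow> rd_arr R R (rd_id R)"
proof -
  assume "relational_doctrine R"
  then interpret R: relational_doctrine R .
  show ?thesis by unfold_locales (auto simp: rd_id_def)
qed

lemma rd_comp_arr:
  assumes "rd_arr R S F" "rd_arr S T G" shows "rd_arr R T (rd_comp G F)"
proof -
  interpret F: rd_arr R S F by fact
  interpret G: rd_arr S T G by fact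
  show ?thesis
    by unfold_locales (auto simp: rd_comp_def Let_def F.mr_mono G.mr_mono)
qed

lemma rd_comp_bd [simp]: "dsrc (rd_comp G F) = dsrc F" "dtrg (rd_comp G F) = dtrg G"
  by (simp_all add: rd_comp_def Let_def)

lemma rd_comp_simps [simp]:
  "X \<in> Ob (dsrc F) \<Longrightarrow> fo (rd_comp G F) X = fo G (fo F X)"
  "\<lbrakk>X \<in> Ob (dsrc F); Y \<in> Ob (dsrc F); f \<in> Hom (dsrc F) X Y\<rbrakk> \<Longrightarrow>
    fa (rd_comp G F) X Y f = fa G (fo F X) (fo F Y) (fa F X Y f)"
  "\<lbrakk>X \<in> Ob (dsrc F); Y \<in> Ob (dsrc F); \<alpha> \<in> Rel (dsrc F) X Y\<rbrakk> \<Longrightarrow>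
    fr (rd_comp G F) X Y \<alpha> = fr G (fo F X) (fo F Y) (fr F X Y \<alpha>)"
  by (simp_all add: rd_comp_def Let_def)

lemma rd_id_simps [simp]:
  "dsrc (rd_id R) = R" "dtrg (rd_id R) = R"
  "X \<in> Ob R \<Longrightarrow> fo (rd_id R) X = X"
  "\<lbrakk>X \<in> Ob R; Y \<in> Ob R; f \<in> Hom R X Y\<rbrakk> \<Longrightarrow> fa (rd_id R) X Y f = f"
  "\<lbrakk>X \<in> Ob R; Y \<in> Ob R; \<alpha> \<in> Rel R X Y\<rbrakk> \<Longrightarrow> fr (rd_id R) X Y \<alpha> = \<alpha>"
  by (simp_all add: rd_id_def)

lemma rd_id2_cel: "rd_arr R S F \<Longrightarrow> rd_cel R S F F (rd_id2 F)"
proof -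
  assume "rd_arr R S F"
  then interpret F: rd_arr R S F .
  show ?thesis by (rule rd_celI) (auto simp: rd_id2_def F.arr)
qed

lemma rd_id2_simps [simp]:
  "msrc (rd_id2 F) = F" "mtrg (rd_id2 F) = F"
  "X \<in> Ob (dsrc F) \<Longrightarrow> cpt (rd_id2 F) X = Idt (dtrg F) (fo F X)"
  by (simp_all add: rd_id2_def)

lemma rd_vcomp_simps [simp]:
  "msrc (rd_vcomp \<phi> \<theta>) = msrc \<theta>" "mtrg (rd_vcomp \<phi> \<theta>) = mtrg \<phi>"
  "X \<in> Ob (dsrc (msrc \<theta>)) \<Longrightarrow> cpt (rd_vcomp \<phi> \<theta>) X =
    Cmp (dtrg (msrc \<theta>)) (fo (msrc \<theta>) X) (fo (mtrg \<theta>) X) (fo (mtrg \<phi>) X) (cpt \<phi> X) (cpt \<theta> X)"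
  by (simp_all add: rd_vcomp_def Let_def)

lemma rd_hcomp_simps [simp]:
  "msrc (rd_hcomp \<phi> \<theta>) = rd_comp (msrc \<phi>) (msrc \<theta>)"
  "mtrg (rd_hcomp \<phi> \<theta>) = rd_comp (mtrg \<phi>) (mtrg \<theta>)"
  "X \<in> Ob (dsrc (msrc \<theta>)) \<Longrightarrow> cpt (rd_hcomp \<phi> \<theta>) X =
    Cmp (dtrg (msrc \<phi>)) (fo (msrc \<phi>) (fo (msrc \<theta>) X)) (fo (msrc \<phi>) (fo (mtrg \<theta>) X))
      (fo (mtrg \<phi>) (fo (mtrg \<theta>) X)) (cpt \<phi> (fo (mtrg \<theta>) X))
      (fa (msrc \<phi>) (fo (msrc \<theta>) X) (fo (mtrg \<theta>) X) (cpt \<theta> X))"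
  by (simp_all add: rd_hcomp_def Let_def)

lemma rd_vcomp_cel:
  assumes "rd_cel R S F G \<theta>" "rd_cel R S G H \<phi>"
  shows "rd_cel R S F H (rd_vcomp \<phi> \<theta>)"
proof -
  interpret t: rd_cel R S F G \<theta> by fact
  interpret p: rd_cel R S G H \<phi> by fact
  show ?thesis
  proof (rule rd_celI, goal_cases)
    case (5) then show ?case by (simp add: rd_vcomp_def Let_def)
  next
    case (7 X Y f)
    then show ?case
      by (simp add: t.F.S.Cmp_assoc[symmetric] t.t_natural)
        (simp add: t.F.S.Cmp_assoc p.t_natural)
  next
    case (8 X Y \<alpha>)
    have "Leq S (fo F X) (fo F Y) (fr F X Y \<alpha>)
      (Rix S (fo F X) (fo G X) (fo F Y) (fo G Y) (cpt \<theta> X) (cpt \<theta> Y)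
        (Rix S (fo G X) (fo H X) (fo G Y) (fo H Y) (cpt \<phi> X) (cpt \<phi> Y) (fr H X Y \<alpha>)))"
      by (rule t.F.S.Leq_trans[OF _ _ _ _ _ t.t_lax t.F.S.Rix_mono[OF _ _ _ _ _ _ _ _ p.t_lax]])
        (use 8 in simp_all)
    then show ?case using 8 by (simp add: t.F.S.Rix_Cmp)
  qed (simp_all add: t.F.arr p.G.arr)
qed

lemma rd_hcomp_cel:
  assumes "rd_cel R S F G \<theta>" "rd_cel S T H K \<phi>"
  shows "rd_cel R T (rd_comp H F) (rd_comp K G) (rd_hcomp \<phi> \<theta>)"
proof -
  interpret t: rd_cel R S F G \<theta> by fact
  interpret p: rd_cel S T H K \<phi> by fact
  show ?thesis
  proof (rule rd_celI, goal_cases)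
    case (5) then show ?case by (simp add: rd_hcomp_def Let_def)
  next
    case (7 X Y f)
    have "Cmp T (fo H (fo F X)) (fo H (fo F Y)) (fo H (fo G Y))
        (fa H (fo F Y) (fo G Y) (cpt \<theta> Y)) (fa H (fo F X) (fo F Y) (fa F X Y f)) =
      Cmp T (fo H (fo F X)) (fo H (fo G X)) (fo H (fo G Y))
        (fa H (fo G X) (fo G Y) (fa G X Y f)) (fa H (fo F X) (fo G X) (cpt \<theta> X))"
      using 7 by (simp add: p.F.ma_Cmp[symmetric] t.t_natural del: p.F.ma_Cmp)
    with 7 show ?case
      by (simp add: p.F.S.Cmp_assoc[symmetric]) (simp add: p.F.S.Cmp_assoc p.t_natural[of "fo G X" "fo G Y"])
  next
    case (8 X Y \<alpha>)
    have "Leq T (fo H (fo F X)) (fo H (fo F Y)) (fr H (fo F X) (fo F Y) (fr F X Y \<alpha>))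
      (Rix T (fo H (fo F X)) (fo H (fo G X)) (fo H (fo F Y)) (fo H (fo G Y))
        (fa H (fo F X) (fo G X) (cpt \<theta> X)) (fa H (fo F Y) (fo G Y) (cpt \<theta> Y))
        (fr H (fo G X) (fo G Y) (fr G X Y \<alpha>)))"
      using p.F.mr_mono[OF _ _ _ _ t.t_lax] 8 by (simp flip: p.F.mr_Rix)
    then have "Leq T (fo H (fo F X)) (fo H (fo F Y)) (fr H (fo F X) (fo F Y) (fr F X Y \<alpha>))
      (Rix T (fo H (fo F X)) (fo H (fo G X)) (fo H (fo F Y)) (fo H (fo G Y))
        (fa H (fo F X) (fo G X) (cpt \<theta> X)) (fa H (fo F Y) (fo G Y) (cpt \<theta> Y))
        (Rix T (fo H (fo G X)) (fo K (fo G X)) (fo H (fo G Y)) (fo K (fo G Y))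
          (cpt \<phi> (fo G X)) (cpt \<phi> (fo G Y)) (fr K (fo G X) (fo G Y) (fr G X Y \<alpha>))))"
      using 8 by (elim p.F.S.Leq_trans[rotated 5] p.F.S.Rix_mono) (simp_all add: p.t_lax p.F.S.Rix_mono)
    then show ?case using 8 by (simp add: p.F.S.Rix_Cmp)
  qed (simp_all add: rd_comp_arr[OF t.F.arr p.F.arr]
      rd_comp_arr[OF t.G.arr p.G.arr])
qed


lemma rd_comp_id:
  assumes "rd_arr R S F"
  shows "rd_comp F (rd_id R) = F" "rd_comp (rd_id S) F = F"
proof -
  interpret F: rd_arr R S F by fact
  have i: "rd_arr R R (rd_id R)" "rd_arr S S (rd_id S)"
    by (simp_all add: rd_id_arr F.R.doctrine F.S.doctrine)
  show "rd_comp F (rd_id R) = F"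
    by (rule rd_arr_eqI[OF rd_comp_arr[OF i(1) assms] assms]) simp_all
  show "rd_comp (rd_id S) F = F"
    by (rule rd_arr_eqI[OF rd_comp_arr[OF assms i(2)] assms]) simp_all
qed

lemma rd_comp_assoc:
  assumes "rd_arr R S F" "rd_arr S T G" "rd_arr T U H"
  shows "rd_comp H (rd_comp G F) = rd_comp (rd_comp H G) F"
proof -
  interpret F: rd_arr R S F by fact
  interpret G: rd_arr S T G by fact
  interpret H: rd_arr T U H by fact
  show ?thesis
    by (rule rd_arr_eqI[of R U])
      (simp_all add: rd_comp_arr[OF rd_comp_arr[OF assms(1,2)] assms(3)]
        rd_comp_arr[OF assms(1) rd_comp_arr[OF assms(2,3)]])
qed

lemma cpt_whisker_right:
  assumes "rd_cel S T H K \<phi>" "rd_arr R S F" "X \<in> Ob R"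
  shows "cpt (rd_hcomp \<phi> (rd_id2 F)) X = cpt \<phi> (fo F X)"
proof -
  interpret p: rd_cel S T H K \<phi> by fact
  interpret F: rd_arr R S F by fact
  show ?thesis using assms(3) by simp
qed

lemma cpt_whisker_left:
  assumes "rd_arr S T H" "rd_cel R S F G \<theta>" "X \<in> Ob R"
  shows "cpt (rd_hcomp (rd_id2 H) \<theta>) X = fa H (fo F X) (fo G X) (cpt \<theta> X)"
proof -
  interpret H: rd_arr S T H by fact
  interpret t: rd_cel R S F G \<theta> by fact
  show ?thesis using assms(3) by simp
qed

lemma rd_vcomp_id:
  assumes "rd_cel R S F G \<theta>"
  shows "rd_vcomp \<theta> (rd_id2 F) = \<theta>" "rd_vcomp (rd_id2 G) \<theta> = \<theta>"
proof -
  interpret t: rd_cel R S F G \<theta> by fact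
  show "rd_vcomp \<theta> (rd_id2 F) = \<theta>"
    by (rule rd_cel_eqI[OF rd_vcomp_cel[OF rd_id2_cel assms] assms])
      (simp_all add: t.F.arr)
  show "rd_vcomp (rd_id2 G) \<theta> = \<theta>"
    by (rule rd_cel_eqI[OF rd_vcomp_cel[OF assms rd_id2_cel] assms])
      (simp_all add: t.G.arr)
qed

lemma rd_vcomp_assoc:
  assumes "rd_cel R S F G \<theta>" "rd_cel R S G H \<phi>" "rd_cel R S H K \<chi>"
  shows "rd_vcomp \<chi> (rd_vcomp \<phi> \<theta>) = rd_vcomp (rd_vcomp \<chi> \<phi>) \<theta>"
proof -
  interpret t: rd_cel R S F G \<theta> by fact
  interpret p: rd_cel R S G H \<phi> by fact
  interpret c: rd_cel R S H K \<chi> by fact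
  show ?thesis
    by (rule rd_cel_eqI[OF rd_vcomp_cel[OF rd_vcomp_cel[OF assms(1,2)] assms(3)]
          rd_vcomp_cel[OF assms(1) rd_vcomp_cel[OF assms(2,3)]]])
      (simp add: t.F.S.Cmp_assoc)
qed

lemma rd_hcomp_id:
  assumes "rd_cel R S F G \<theta>"
  shows "rd_hcomp \<theta> (rd_id2 (rd_id R)) = \<theta>" "rd_hcomp (rd_id2 (rd_id S)) \<theta> = \<theta>"
proof -
  interpret t: rd_cel R S F G \<theta> by fact
  have i: "rd_arr R R (rd_id R)" "rd_arr S S (rd_id S)"
    by (simp_all add: rd_id_arr t.F.R.doctrine t.F.S.doctrine)
  have c: "rd_cel R S F G (rd_hcomp \<theta> (rd_id2 (rd_id R)))" "rd_cel R S F G (rd_hcomp (rd_id2 (rd_id S)) \<theta>)"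
    using rd_hcomp_cel[OF rd_id2_cel[OF i(1)] assms] rd_hcomp_cel[OF assms rd_id2_cel[OF i(2)]]
    by (simp_all add: rd_comp_id[OF t.F.arr] rd_comp_id[OF t.G.arr])
  show "rd_hcomp \<theta> (rd_id2 (rd_id R)) = \<theta>"
    by (rule rd_cel_eqI[OF c(1) assms]) simp
  show "rd_hcomp (rd_id2 (rd_id S)) \<theta> = \<theta>"
    by (rule rd_cel_eqI[OF c(2) assms]) simp
qed

lemma rd_hcomp_assoc:
  assumes "rd_cel R S F F' \<theta>" "rd_cel S T G G' \<phi>" "rd_cel T U H H' \<chi>"
  shows "rd_hcomp \<chi> (rd_hcomp \<phi> \<theta>) = rd_hcomp (rd_hcomp \<chi> \<phi>) \<theta>"
proof -
  interpret t: rd_cel R S F F' \<theta> by fact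
  interpret p: rd_cel S T G G' \<phi> by fact
  interpret c: rd_cel T U H H' \<chi> by fact
  have eq: "rd_comp H (rd_comp G F) = rd_comp (rd_comp H G) F"
    "rd_comp H' (rd_comp G' F') = rd_comp (rd_comp H' G') F'"
    by (intro rd_comp_assoc[of R S _ T _ U]; fact t.F.arr p.F.arr c.F.arr
        t.G.arr p.G.arr c.G.arr)+
  show ?thesis
    by (rule rd_cel_eqI[OF rd_hcomp_cel[OF rd_hcomp_cel[OF assms(1,2)] assms(3)]
          rd_hcomp_cel[OF assms(1) rd_hcomp_cel[OF assms(2,3)], folded eq]])
      (simp add: c.F.S.Cmp_assoc)
qed

lemma rd_hcomp_id2:
  assumes "rd_arr R S F" "rd_arr S T G"
  shows "rd_hcomp (rd_id2 G) (rd_id2 F) = rd_id2 (rd_comp G F)"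
proof -
  interpret F: rd_arr R S F by fact
  interpret G: rd_arr S T G by fact
  show ?thesis
    by (rule rd_cel_eqI[OF rd_hcomp_cel[OF rd_id2_cel[OF assms(1)] rd_id2_cel[OF assms(2)]]
          rd_id2_cel[OF rd_comp_arr[OF assms]]])
      simp
qed

lemma rd_interchange:
  assumes "rd_cel R S F G \<theta>" "rd_cel R S G H \<theta>'" "rd_cel S T F' G' \<phi>" "rd_cel S T G' H' \<phi>'"
  shows "rd_hcomp (rd_vcomp \<phi>' \<phi>) (rd_vcomp \<theta>' \<theta>) =
    rd_vcomp (rd_hcomp \<phi>' \<theta>') (rd_hcomp \<phi> \<theta>)"
proof -
  interpret t: rd_cel R S F G \<theta> by fact
  interpret t': rd_cel R S G H \<theta>' by fact
  interpret p: rd_cel S T F' G' \<phi> by fact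
  interpret p': rd_cel S T G' H' \<phi>' by fact
  show ?thesis
  proof (rule rd_cel_eqI[OF
        rd_hcomp_cel[OF rd_vcomp_cel[OF assms(1,2)] rd_vcomp_cel[OF assms(3,4)]]
        rd_vcomp_cel[OF rd_hcomp_cel[OF assms(1,3)] rd_hcomp_cel[OF assms(2,4)]]])
    fix X assume X: "X \<in> Ob R"
    \<comment> \<open>naturality of \<open>\<phi>\<close> at the component of \<open>\<theta>'\<close> swaps the two middle factors\<close>
    have "Cmp T (fo F' (fo G X)) (fo F' (fo H X)) (fo G' (fo H X))
        (cpt \<phi> (fo H X)) (fa F' (fo G X) (fo H X) (cpt \<theta>' X)) =
      Cmp T (fo F' (fo G X)) (fo G' (fo G X)) (fo G' (fo H X))
        (fa G' (fo G X) (fo H X) (cpt \<theta>' X)) (cpt \<phi> (fo G X))"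
      using X by (simp add: p.t_natural)
    then show "cpt (rd_hcomp (rd_vcomp \<phi>' \<phi>) (rd_vcomp \<theta>' \<theta>)) X =
      cpt (rd_vcomp (rd_hcomp \<phi>' \<theta>') (rd_hcomp \<phi> \<theta>)) X"
      using X
      by (simp add: p.F.S.Cmp_assoc[of _ "fo F' (fo G X)" "fo F' (fo H X)" "fo G' (fo H X)"]
          p.F.S.Cmp_assoc[of _ "fo F' (fo G X)" "fo G' (fo G X)" "fo G' (fo H X)"]
          p.F.S.Cmp_assoc[of _ _ "fo G' (fo H X)" "fo H' (fo H X)", symmetric])
  qed
qed

lemma RD_simps [simp]:
  "R \<in> Obj RD \<longleftrightarrow> relational_doctrine R" "F \<in> One RD \<longleftrightarrow> rd_arrow F"
  "\<theta> \<in> Two RD \<longleftrightarrow> rd_two_arrow \<theta>"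
  "src1 RD = dsrc" "trg1 RD = dtrg" "src2 RD = msrc" "trg2 RD = mtrg"
  "id1 RD = rd_id" "c1 RD = rd_comp" "id2 RD = rd_id2" "vc RD = rd_vcomp" "hc RD = rd_hcomp"
  by (simp_all add: RD_def)

lemma rd_arrow_arr: "rd_arrow F \<Longrightarrow> rd_arr (dsrc F) (dtrg F) F"
  by (simp add: rd_arr_iff)

lemma rd_two_arrow_cel:
  "rd_two_arrow \<theta> \<Longrightarrow> rd_cel (dsrc (msrc \<theta>)) (dtrg (msrc \<theta>)) (msrc \<theta>) (mtrg \<theta>) \<theta>"
  by (simp add: rd_cel_iff)

lemma rd_two_arrow_bd:
  assumes "rd_two_arrow \<theta>"
  shows "rd_arrow (msrc \<theta>)" "rd_arrow (mtrg \<theta>)" "dsrc (mtrg \<theta>) = dsrc (msrc \<theta>)"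
    "dtrg (mtrg \<theta>) = dtrg (msrc \<theta>)"
  using assms by (simp_all add: rd_two_arrow_def rd_transformation_def)

lemma rd_arr_doctrines: "rd_arr R S F \<Longrightarrow> relational_doctrine R" "rd_arr R S F \<Longrightarrow> relational_doctrine S"
  by (simp_all add: rd_arr_def rd_morphism_def)

lemma in_two_RD: "\<theta> \<in> two RD F G \<longleftrightarrow> rd_two_arrow \<theta> \<and> msrc \<theta> = F \<and> mtrg \<theta> = G"
  by (simp add: two_def)

theorem two_category_RD: "two_category RD"
proof (rule two_category.intro, goal_cases)
  case (1 F) then show ?case using rd_arr_doctrines[OF rd_arrow_arr[of F]] by simp
next
  case (2 F) then show ?case using rd_arr_doctrines[OF rd_arrow_arr[of F]] by simp
next
  case (7 R) then show ?case by (simp add: rd_id_arr)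
next
  case (8 F G)
  then show ?case using rd_comp_arr[of "dsrc F" "dtrg F" F "dtrg G" G] rd_arrow_arr by fastforce
next
  case (9 F) then show ?case by (simp add: rd_comp_id[OF rd_arrow_arr])
next
  case (10 F) then show ?case by (simp add: rd_comp_id[OF rd_arrow_arr])
next
  case (11 F G H)
  then show ?case
    using rd_comp_assoc[of "dsrc F" "dtrg F" F "dtrg G" G "dtrg H" H] by (simp add: rd_arr_iff)
next
  case (12 F)
  then show ?case using rd_id2_cel[of "dsrc F" "dtrg F" F] by (simp add: in_two_RD rd_arr_iff rd_cel_iff)
next
  case (13 \<theta> \<phi>)
  then show ?case
    using rd_vcomp_cel[OF rd_two_arrow_cel, of \<theta> "mtrg \<phi>" \<phi>] rd_two_arrow_bd[of \<theta>]
    by (simp add: in_two_RD rd_cel_iff)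
next
  case (14 \<theta>) then show ?case by (simp add: rd_vcomp_id[OF rd_two_arrow_cel])
next
  case (15 \<theta>) then show ?case by (simp add: rd_vcomp_id[OF rd_two_arrow_cel])
next
  case (16 \<theta> \<phi> \<chi>)
  then show ?case
    using rd_vcomp_assoc[OF rd_two_arrow_cel, of \<theta> "mtrg \<phi>" \<phi> "mtrg \<chi>" \<chi>]
      rd_two_arrow_bd[of \<theta>] rd_two_arrow_bd[of \<phi>] by (simp add: rd_cel_iff)
next
  case (17 \<theta> \<phi>)
  then show ?case
    using rd_hcomp_cel[OF rd_two_arrow_cel, of \<theta> "dtrg (msrc \<phi>)" "msrc \<phi>" "mtrg \<phi>" \<phi>]
    by (simp add: in_two_RD rd_cel_iff)
next
  case (18 \<theta>) then show ?case by (simp add: rd_hcomp_id(1)[OF rd_two_arrow_cel])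
next
  case (19 \<theta>) then show ?case by (simp add: rd_hcomp_id(2)[OF rd_two_arrow_cel])
next
  case (20 \<theta> \<phi> \<chi>)
  then show ?case
    using rd_hcomp_assoc[OF rd_two_arrow_cel, of \<theta> "dtrg (msrc \<phi>)" "msrc \<phi>" "mtrg \<phi>" \<phi>
        "dtrg (msrc \<chi>)" "msrc \<chi>" "mtrg \<chi>" \<chi>] by (simp add: rd_cel_iff)
next
  case (21 F G)
  then show ?case using rd_hcomp_id2[of "dsrc F" "dtrg F" F "dtrg G" G] by (simp add: rd_arr_iff)
next
  case (22 \<theta> \<theta>' \<phi> \<phi>')
  then show ?case
    using rd_interchange[OF rd_two_arrow_cel, of \<theta> "mtrg \<theta>'" \<theta>' "dtrg (msrc \<phi>)" "msrc \<phi>" "mtrg \<phi>" \<phi>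
        "mtrg \<phi>'" \<phi>'] rd_two_arrow_bd[of \<theta>] rd_two_arrow_bd[of \<phi>] by (simp add: rd_cel_iff)
qed (simp_all add: rd_two_arrow_bd)

section \<open>Graphs and effective descent quotient arrows\<close>

context relational_doctrine
begin

lemma Rix_Conv:
  assumes "X \<in> Ob R" "Y \<in> Ob R" "A \<in> Ob R" "B \<in> Ob R" "f \<in> Hom R X A" "g \<in> Hom R Y B" "\<alpha> \<in> Rel R A B"
  shows "Conv R X Y (Rix R X A Y B f g \<alpha>) = Rix R Y B X A g f (Conv R A B \<alpha>)"
proof -
  have "Leq R X Y (Conv R Y X (Rix R Y B X A g f (Conv R A B \<alpha>))) (Rix R X A Y B f g \<alpha>)"
    using Conv_lax[of Y X B A g f "Conv R A B \<alpha>"] assms by simp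
  then have "Leq R Y X (Rix R Y B X A g f (Conv R A B \<alpha>)) (Conv R X Y (Rix R X A Y B f g \<alpha>))"
    using Conv_mono[of X Y "Conv R Y X (Rix R Y B X A g f (Conv R A B \<alpha>))"] assms by simp
  then show ?thesis
    using Conv_lax[OF assms] assms by (intro Leq_antisym[of Y X]) simp_all
qed

lemma graph_Rel [simp]: "\<lbrakk>X \<in> Ob R; Y \<in> Ob R; f \<in> Hom R X Y\<rbrakk> \<Longrightarrow> graph R X Y f \<in> Rel R X Y"
  by (simp add: graph_def)

lemma graph_Idt [simp]: "X \<in> Ob R \<Longrightarrow> graph R X X (Idt R X) = Dia R X"
  by (simp add: graph_def)

lemma Conv_graph:
  "\<lbrakk>X \<in> Ob R; Y \<in> Ob R; f \<in> Hom R X Y\<rbrakk> \<Longrightarrow>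
    Conv R X Y (graph R X Y f) = Rix R Y Y X Y (Idt R Y) f (Dia R Y)"
  by (simp add: graph_def Rix_Conv)

text \<open>Reindexing \<open>\<Gamma>\<^sub>f\<close> and its converse along \<open>f\<close> gives \<open>R\<^bsub>f,f\<^esub> d\<close> twice, which contains the
  diagonal; lax functoriality of composition, with \<open>f\<close> in the middle, bounds the composite of
  these two by \<open>\<Gamma>\<^sub>f ; \<Gamma>\<^sub>f\<^sup>\<bottom>\<close>.\<close>

lemma graph_total:
  assumes "X \<in> Ob R" "Y \<in> Ob R" "f \<in> Hom R X Y"
  shows "Leq R X X (Dia R X) (Rcmp R X Y X (graph R X Y f) (Conv R X Y (graph R X Y f)))"
proof -
  let ?D = "Rix R X Y X Y f f (Dia R Y)"
  have l: "Rix R X X X Y (Idt R X) f (graph R X Y f) = ?D"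
    "Rix R X Y X X f (Idt R X) (Conv R X Y (graph R X Y f)) = ?D"
    using assms Rix_Cmp[of X X Y X Y Y "Idt R X" f f "Idt R Y" "Dia R Y"]
      Rix_Cmp[of X Y Y X X Y f "Idt R Y" "Idt R X" f "Dia R Y"]
    by (simp_all add: Conv_graph) (simp_all add: graph_def)
  have "Leq R X X (Dia R X) (Rcmp R X X X ?D ?D)"
    using Rcmp_mono[of X X X "Dia R X" ?D "Dia R X" ?D] assms by (simp add: Dia_lax)
  moreover have "Leq R X X (Rcmp R X X X ?D ?D)
     (Rcmp R X Y X (graph R X Y f) (Conv R X Y (graph R X Y f)))"
    using Rcmp_lax[of X X X X Y X "Idt R X" f "Idt R X" "graph R X Y f" "Conv R X Y (graph R X Y f)"]
      assms by (simp add: l)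
  ultimately show ?thesis
    by (rule Leq_trans[rotated 5]) (use assms in simp_all)
qed

lemma graph_functional:
  assumes "X \<in> Ob R" "Y \<in> Ob R" "f \<in> Hom R X Y"
  shows "Leq R Y Y (Rcmp R Y X Y (Conv R X Y (graph R X Y f)) (graph R X Y f)) (Dia R Y)"
  using Rcmp_lax[of Y X Y Y Y Y "Idt R Y" f "Idt R Y" "Dia R Y" "Dia R Y"] assms
  by (simp add: Conv_graph) (simp add: graph_def)

lemma Rcmp_mono1:
  "\<lbrakk>X \<in> Ob R; Y \<in> Ob R; Z \<in> Ob R; \<alpha> \<in> Rel R X Y; \<alpha>' \<in> Rel R X Y; \<beta> \<in> Rel R Y Z; Leq R X Y \<alpha> \<alpha>'\<rbrakk>
    \<Longrightarrow> Leq R X Z (Rcmp R X Y Z \<alpha> \<beta>) (Rcmp R X Y Z \<alpha>' \<beta>)"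
  by (rule Rcmp_mono) simp_all

lemma Rcmp_mono2:
  "\<lbrakk>X \<in> Ob R; Y \<in> Ob R; Z \<in> Ob R; \<alpha> \<in> Rel R X Y; \<beta> \<in> Rel R Y Z; \<beta>' \<in> Rel R Y Z; Leq R Y Z \<beta> \<beta>'\<rbrakk>
    \<Longrightarrow> Leq R X Z (Rcmp R X Y Z \<alpha> \<beta>) (Rcmp R X Y Z \<alpha> \<beta>')"
  by (rule Rcmp_mono) simp_all

text \<open>The inequality from right to left is lax functoriality of composition. For the other one,
  \<open>R\<^bsub>f,g\<^esub> \<alpha>\<close> is first enlarged to \<open>\<Gamma>\<^sub>f ; \<Gamma>\<^sub>f\<^sup>\<bottom> ; R\<^bsub>f,g\<^esub> \<alpha> ; \<Gamma>\<^sub>g ; \<Gamma>\<^sub>g\<^sup>\<bottom>\<close>, whose middle part lies below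
  \<open>\<alpha>\<close>, again by lax functoriality.\<close>

lemma Rix_graph:
  assumes "X \<in> Ob R" "Y \<in> Ob R" "A \<in> Ob R" "B \<in> Ob R" "f \<in> Hom R X A" "g \<in> Hom R Y B" "\<alpha> \<in> Rel R A B"
  shows "Rix R X A Y B f g \<alpha> = Rcmp R X B Y (Rcmp R X A B (graph R X A f) \<alpha>) (Conv R Y B (graph R Y B g))"
    (is "?l = ?r")
proof (rule Leq_antisym[of X Y])
  show "X \<in> Ob R" "Y \<in> Ob R" "?l \<in> Rel R X Y" "?r \<in> Rel R X Y" using assms by simp_all
  have 1: "Leq R X B (Rcmp R X A B (graph R X A f) \<alpha>) (Rix R X A B B f (Idt R B) \<alpha>)"
    using Rcmp_lax[of X A B A A B f "Idt R A" "Idt R B" "Dia R A" \<alpha>] assms by (simp add: graph_def)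
  have "Leq R X Y ?r (Rcmp R X B Y (Rix R X A B B f (Idt R B) \<alpha>) (Conv R Y B (graph R Y B g)))"
    by (rule Rcmp_mono1[OF _ _ _ _ _ _ 1]) (use assms in simp_all)
  moreover have "Leq R X Y (Rcmp R X B Y (Rix R X A B B f (Idt R B) \<alpha>) (Conv R Y B (graph R Y B g))) ?l"
    using Rcmp_lax[of X B Y A B B f "Idt R B" g \<alpha> "Dia R B"] assms by (simp add: Conv_graph)
  ultimately show "Leq R X Y ?r ?l"
    by (rule Leq_trans[of X Y, rotated 5]) (use assms in simp_all)
  let ?F = "graph R X A f" and ?G = "graph R Y B g"
  have "Leq R A Y (Rcmp R A X Y (Conv R X A ?F) ?l) (Rix R A A Y B (Idt R A) g \<alpha>)"
    using Rcmp_lax[of A X Y A A B "Idt R A" f g "Dia R A" \<alpha>] assms by (simp add: Conv_graph)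
  then have "Leq R A B (Rcmp R A Y B (Rcmp R A X Y (Conv R X A ?F) ?l) ?G)
      (Rcmp R A Y B (Rix R A A Y B (Idt R A) g \<alpha>) ?G)"
    by (intro Rcmp_mono1) (use assms in simp_all)
  moreover have "Leq R A B (Rcmp R A Y B (Rix R A A Y B (Idt R A) g \<alpha>) ?G) \<alpha>"
    using Rcmp_lax[of A Y B A B B "Idt R A" g "Idt R B" \<alpha> "Dia R B"] assms by (simp add: graph_def)
  ultimately have "Leq R A B (Rcmp R A Y B (Rcmp R A X Y (Conv R X A ?F) ?l) ?G) \<alpha>"
    by (rule Leq_trans[of A B, rotated 5]) (use assms in simp_all)
  then have "Leq R X Y
      (Rcmp R X B Y (Rcmp R X A B ?F (Rcmp R A Y B (Rcmp R A X Y (Conv R X A ?F) ?l) ?G)) (Conv R Y B ?G)) ?r"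
    by (intro Rcmp_mono1 Rcmp_mono2) (use assms in simp_all)
  moreover have "Rcmp R X B Y (Rcmp R X A B ?F (Rcmp R A Y B (Rcmp R A X Y (Conv R X A ?F) ?l) ?G)) (Conv R Y B ?G) =
     Rcmp R X Y Y (Rcmp R X X Y (Rcmp R X A X ?F (Conv R X A ?F)) ?l) (Rcmp R Y B Y ?G (Conv R Y B ?G))"
    using assms by (simp add: Rcmp_assoc)
  ultimately have r: "Leq R X Y (Rcmp R X Y Y (Rcmp R X X Y (Rcmp R X A X ?F (Conv R X A ?F)) ?l)
      (Rcmp R Y B Y ?G (Conv R Y B ?G))) ?r"
    by simp
  have "Leq R X Y (Rcmp R X Y Y (Rcmp R X X Y (Dia R X) ?l) (Dia R Y))
     (Rcmp R X Y Y (Rcmp R X X Y (Rcmp R X A X ?F (Conv R X A ?F)) ?l) (Rcmp R Y B Y ?G (Conv R Y B ?G)))"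
    by (intro Rcmp_mono Leq_refl) (use assms graph_total in simp_all)
  then have "Leq R X Y ?l
     (Rcmp R X Y Y (Rcmp R X X Y (Rcmp R X A X ?F (Conv R X A ?F)) ?l) (Rcmp R Y B Y ?G (Conv R Y B ?G)))"
    using assms by simp
  from this r show "Leq R X Y ?l ?r"
    by (rule Leq_trans[rotated 5]) (use assms in simp_all)
qed

lemma graph_Cmp:
  assumes "X \<in> Ob R" "Y \<in> Ob R" "Z \<in> Ob R" "f \<in> Hom R X Y" "g \<in> Hom R Y Z"
  shows "graph R X Z (Cmp R X Y Z g f) = Rcmp R X Y Z (graph R X Y f) (graph R Y Z g)"
proof -
  have "graph R X Z (Cmp R X Y Z g f) = Rix R X Y Z Z f (Idt R Z) (graph R Y Z g)"
    using Rix_Cmp[of X Y Z Z Z Z f g "Idt R Z" "Idt R Z" "Dia R Z"] assms by (simp add: graph_def)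
  also have "\<dots> = Rcmp R X Y Z (graph R X Y f) (graph R Y Z g)"
    using assms by (simp add: Rix_graph)
  finally show ?thesis .
qed

lemma kernel_Rix:
  "\<lbrakk>X \<in> Ob R; Y \<in> Ob R; f \<in> Hom R X Y\<rbrakk> \<Longrightarrow> kernel R X Y f = Rix R X Y X Y f f (Dia R Y)"
  by (simp add: kernel_def Rix_graph)

lemma iso_Rix_inverse:
  assumes "W \<in> Ob R" "W' \<in> Ob R" "V \<in> Ob R" "V' \<in> Ob R" "h \<in> Hom R W V" "k \<in> Hom R V W"
    "h' \<in> Hom R W' V'" "k' \<in> Hom R V' W'"
    "Cmp R V W V h k = Idt R V" "Cmp R V' W' V' h' k' = Idt R V'" "\<alpha> \<in> Rel R V V'"
  shows "Rix R V W V' W' k k' (Rix R W V W' V' h h' \<alpha>) = \<alpha>"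
  using assms by (simp flip: Rix_Cmp)

text \<open>If \<open>h \<circ> k = id\<close>, then \<open>\<Gamma>\<^sub>k \<le> \<Gamma>\<^sub>k ; \<Gamma>\<^sub>h ; \<Gamma>\<^sub>h\<^sup>\<bottom> = \<Gamma>\<^sub>h\<^sup>\<bottom>\<close>, which turns
  \<open>\<Gamma>\<^sub>k ; \<Gamma>\<^sub>h = d\<close> into the missing inequality.\<close>

lemma iso_functional:
  assumes "W \<in> Ob R" "V \<in> Ob R" "h \<in> Hom R W V" "k \<in> Hom R V W"
    "Cmp R V W V h k = Idt R V"
  shows "Rcmp R V W V (Conv R W V (graph R W V h)) (graph R W V h) = Dia R V"
proof (rule Leq_antisym[of V V])
  let ?H = "graph R W V h" and ?K = "graph R V W k"
  have HK: "Rcmp R V W V ?K ?H = Dia R V"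
    using assms graph_Cmp[of V W V k h] by simp
  have "Leq R V W (Rcmp R V W W ?K (Dia R W)) (Rcmp R V W W ?K (Rcmp R W V W ?H (Conv R W V ?H)))"
    by (intro Rcmp_mono2 graph_total) (use assms in simp_all)
  then have "Leq R V W ?K (Conv R W V ?H)"
    using assms by (simp add: Rcmp_assoc HK)
  then have "Leq R V V (Rcmp R V W V ?K ?H) (Rcmp R V W V (Conv R W V ?H) ?H)"
    by (intro Rcmp_mono1) (use assms in simp_all)
  then show "Leq R V V (Dia R V) (Rcmp R V W V (Conv R W V ?H) ?H)"
    by (simp add: HK)
qed (use assms graph_functional in simp_all)

end

text \<open>The quotient arrows that a doctrine with quotients is required to have.\<close>

definition edq :: "('o, 'a, 'r) rel_doctrine \<Rightarrow> 'o \<Rightarrow> 'r \<Rightarrow> 'o \<Rightarrow> 'a \<Rightarrow> bool" where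
  "edq R X \<rho> W q \<longleftrightarrow> quotient_arrow R X \<rho> W q \<and> effective R X \<rho> W q \<and> descent R X W q"

context relational_doctrine
begin

lemma edqD:
  assumes "X \<in> Ob R" "edq R X \<rho> W q"
  shows edq_Ob: "W \<in> Ob R" and edq_Hom: "q \<in> Hom R X W"
    and edq_kernel: "Rix R X W X W q q (Dia R W) = \<rho>"
    and edq_descent: "Rcmp R W X W (Conv R X W (graph R X W q)) (graph R X W q) = Dia R W"
proof -
  show W: "W \<in> Ob R" "q \<in> Hom R X W"
    using assms by (simp_all add: edq_def quotient_arrow_def)
  show "Rix R X W X W q q (Dia R W) = \<rho>"
    using assms W by (simp add: edq_def effective_def kernel_Rix)
  show "Rcmp R W X W (Conv R X W (graph R X W q)) (graph R X W q) = Dia R W"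
    using assms W by (intro Leq_antisym[of W W]) (simp_all add: edq_def descent_def graph_functional)
qed

lemma edq_Rel: "\<lbrakk>X \<in> Ob R; edq R X \<rho> W q\<rbrakk> \<Longrightarrow> \<rho> \<in> Rel R X X"
  using Rix_Rel[of X X W W q q "Dia R W"] edqD[of X \<rho> W q] by simp

lemma edq_factor:
  assumes "X \<in> Ob R" "edq R X \<rho> W q" "Z \<in> Ob R" "f \<in> Hom R X Z"
    "Leq R X X \<rho> (Rix R X Z X Z f f (Dia R Z))"
  obtains h where "h \<in> Hom R W Z" "Cmp R X W Z h q = f"
proof -
  have "\<exists>!h. h \<in> Hom R W Z \<and> f = Cmp R X W Z h q"
    using assms by (simp add: edq_def quotient_arrow_def kernel_Rix)
  then show thesis using that by blast
qed

lemma edqI: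
  assumes "X \<in> Ob R" "W \<in> Ob R" "q \<in> Hom R X W" "Rix R X W X W q q (Dia R W) = \<rho>"
    "Rcmp R W X W (Conv R X W (graph R X W q)) (graph R X W q) = Dia R W"
    and "\<And>Z f. \<lbrakk>Z \<in> Ob R; f \<in> Hom R X Z; Leq R X X \<rho> (Rix R X Z X Z f f (Dia R Z))\<rbrakk> \<Longrightarrow>
      \<exists>h\<in>Hom R W Z. Cmp R X W Z h q = f"
    and "\<And>Z h k. \<lbrakk>Z \<in> Ob R; h \<in> Hom R W Z; k \<in> Hom R W Z; Cmp R X W Z h q = Cmp R X W Z k q\<rbrakk> \<Longrightarrow> h = k"
  shows "edq R X \<rho> W q"
proof -
  have "\<rho> \<in> Rel R X X" using assms(1-4) by auto
  then show ?thesis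
    using assms(1-5) unfolding edq_def quotient_arrow_def effective_def descent_def
  proof (intro conjI ballI impI)
    fix Z f assume Z: "Z \<in> Ob R" "f \<in> Hom R X Z" "Leq R X X \<rho> (kernel R X Z f)"
    then obtain h where "h \<in> Hom R W Z" "Cmp R X W Z h q = f"
      using assms(1) assms(6)[of Z f] by (auto simp: kernel_Rix)
    then show "\<exists>!h. h \<in> Hom R W Z \<and> f = Cmp R X W Z h q"
      using assms(7)[OF Z(1)] by (intro ex1I[of _ h]) auto
  qed (simp_all add: kernel_Rix)
qed

text \<open>The relation \<open>\<rho>\<close> is contained in the kernel of \<open>h \<circ> q\<close>, because \<open>d \<le> R\<^bsub>h,h\<^esub> d\<close>; uniqueness of the
  factorization of \<open>h \<circ> q\<close> through \<open>q\<close> is the claim.\<close>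

lemma edq_epi:
  assumes "X \<in> Ob R" "edq R X \<rho> W q" "Z \<in> Ob R" "h \<in> Hom R W Z" "k \<in> Hom R W Z"
    "Cmp R X W Z h q = Cmp R X W Z k q"
  shows "h = k"
proof -
  note q = edqD[OF assms(1,2)]
  have "Leq R X X (Rix R X W X W q q (Dia R W)) (Rix R X W X W q q (Rix R W Z W Z h h (Dia R Z)))"
    by (rule Rix_mono[OF _ _ _ _ _ _ _ _ Dia_lax]) (use assms q in simp_all)
  then have "Leq R X X \<rho> (kernel R X Z (Cmp R X W Z h q))"
    using assms(1-5) q by (simp add: kernel_Rix Rix_Cmp)
  then have "\<exists>!l. l \<in> Hom R W Z \<and> Cmp R X W Z h q = Cmp R X W Z l q"
    using assms(1-5) q by (simp add: edq_def quotient_arrow_def)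
  then show ?thesis using assms by metis
qed

text \<open>Descent makes reindexing along quotient arrows injective, with this retraction.\<close>

lemma edq_retract:
  assumes "X \<in> Ob R" "edq R X \<rho> W q" "X' \<in> Ob R" "edq R X' \<rho>' W' q'" "\<alpha> \<in> Rel R W W'"
  shows "Rcmp R W X' W' (Rcmp R W X X' (Conv R X W (graph R X W q)) (Rix R X W X' W' q q' \<alpha>))
    (graph R X' W' q') = \<alpha>"
proof -
  note q = edqD[OF assms(1,2)] and q' = edqD[OF assms(3,4)]
  have "Rcmp R W X' W' (Rcmp R W X X' (Conv R X W (graph R X W q)) (Rix R X W X' W' q q' \<alpha>))
      (graph R X' W' q') =
    Rcmp R W W' W' (Rcmp R W W W' (Rcmp R W X W (Conv R X W (graph R X W q)) (graph R X W q)) \<alpha>)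
      (Rcmp R W' X' W' (Conv R X' W' (graph R X' W' q')) (graph R X' W' q'))"
    using assms q(1,2) q'(1,2) by (simp add: Rix_graph Rcmp_assoc)
  then show ?thesis using assms q q' by simp
qed

lemma edq_Rix_inj:
  assumes "X \<in> Ob R" "edq R X \<rho> W q" "X' \<in> Ob R" "edq R X' \<rho>' W' q'" "\<alpha> \<in> Rel R W W'" "\<beta> \<in> Rel R W W'"
    "Rix R X W X' W' q q' \<alpha> = Rix R X W X' W' q q' \<beta>"
  shows "\<alpha> = \<beta>"
  by (rule trans[OF edq_retract[OF assms(1-5), unfolded assms(7), symmetric] edq_retract[OF assms(1-4,6)]])

lemma edq_Idt: "X \<in> Ob R \<Longrightarrow> edq R X (Dia R X) X (Idt R X)"
  by (rule edqI) auto

text \<open>An arrow whose kernel contains \<open>R\<^bsub>q,q\<^esub> \<sigma>\<close> factors through \<open>q\<close>, since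
  \<open>\<rho> = R\<^bsub>q,q\<^esub> d \<le> R\<^bsub>q,q\<^esub> \<sigma>\<close>. Descent along \<open>q\<close> brings the inequality down to \<open>\<sigma>\<close>, so the factor
  factors again through \<open>r\<close>.\<close>

lemma edq_Cmp:
  assumes "X \<in> Ob R" "edq R X \<rho> W q" "edq R W \<sigma> V r"
  shows "edq R X (Rix R X W X W q q \<sigma>) V (Cmp R X W V r q)"
proof -
  note q = edqD[OF assms(1,2)]
  note r = edqD[OF q(1) assms(3)]
  have \<sigma>: "\<sigma> \<in> Rel R W W" using edq_Rel[OF q(1) assms(3)] .
  have eq: "Rcmp R V X V (Rcmp R V W X (Conv R W V (graph R W V r)) (Conv R X W (graph R X W q)))
     (Rcmp R X W V (graph R X W q) (graph R W V r)) =
    Rcmp R V W V (Rcmp R V W W (Conv R W V (graph R W V r))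
      (Rcmp R W X W (Conv R X W (graph R X W q)) (graph R X W q))) (graph R W V r)"
    using assms(1) q(1,2) r(1,2) by (simp add: Rcmp_assoc)
  show ?thesis
  proof (rule edqI)
    show "Rix R X V X V (Cmp R X W V r q) (Cmp R X W V r q) (Dia R V) = Rix R X W X W q q \<sigma>"
      using assms(1) q r by (simp add: Rix_Cmp)
    show "Rcmp R V X V (Conv R X V (graph R X V (Cmp R X W V r q))) (graph R X V (Cmp R X W V r q)) = Dia R V"
      using assms(1) q r by (simp add: graph_Cmp Conv_Rcmp eq)
  next
    fix Z f assume Z: "Z \<in> Ob R" "f \<in> Hom R X Z"
      and le: "Leq R X X (Rix R X W X W q q \<sigma>) (Rix R X Z X Z f f (Dia R Z))"
    have "Leq R X X (Rix R X W X W q q (Dia R W)) (Rix R X W X W q q (Rix R W V W V r r (Dia R V)))"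
      by (rule Rix_mono[OF _ _ _ _ _ _ _ _ Dia_lax]) (use assms q r edq_Rel[OF q(1) assms(3)] in simp_all)
    then have "Leq R X X \<rho> (Rix R X W X W q q \<sigma>)" using q r by simp
    from this le have "Leq R X X \<rho> (Rix R X Z X Z f f (Dia R Z))"
      by (rule Leq_trans[rotated 5]) (use assms(1) q(1,2) edq_Rel[OF assms(1,2)] \<sigma> Z in simp_all)
    then obtain h where h: "h \<in> Hom R W Z" "Cmp R X W Z h q = f"
      using edq_factor[OF assms(1,2)] Z by blast
    have "Leq R W W
      (Rcmp R W X W (Rcmp R W X X (Conv R X W (graph R X W q)) (Rix R X W X W q q \<sigma>)) (graph R X W q))
      (Rcmp R W X W (Rcmp R W X X (Conv R X W (graph R X W q)) (Rix R X Z X Z f f (Dia R Z))) (graph R X W q))"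
      by (intro Rcmp_mono1 Rcmp_mono2 le) (use assms(1) q r \<sigma> Z in simp_all)
    moreover have "Rix R X Z X Z f f (Dia R Z) = Rix R X W X W q q (Rix R W Z W Z h h (Dia R Z))"
      using assms(1) q Z h by (simp flip: Rix_Cmp)
    ultimately have "Leq R W W \<sigma> (Rix R W Z W Z h h (Dia R Z))"
      using edq_retract[OF assms(1,2,1,2)] q Z h \<sigma> by simp
    then obtain k where "k \<in> Hom R V Z" "Cmp R W V Z k r = h"
      using edq_factor[OF q(1) assms(3)] Z h by blast
    then show "\<exists>k\<in>Hom R V Z. Cmp R X V Z k (Cmp R X W V r q) = f"
      using assms(1) q r Z h by (intro bexI[of _ k]) (simp_all add: Cmp_assoc)
  next
    fix Z h k assume Z: "Z \<in> Ob R" "h \<in> Hom R V Z" "k \<in> Hom R V Z"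
      "Cmp R X V Z h (Cmp R X W V r q) = Cmp R X V Z k (Cmp R X W V r q)"
    then have "Cmp R X W Z (Cmp R W V Z h r) q = Cmp R X W Z (Cmp R W V Z k r) q"
      using assms(1) q r by (simp add: Cmp_assoc)
    then have "Cmp R W V Z h r = Cmp R W V Z k r"
      using edq_epi[OF assms(1,2)] Z q r by simp
    then show "h = k" using edq_epi[OF q(1) assms(3)] Z by simp
  qed (use assms(1) q r in simp_all)
qed

text \<open>An isomorphism is an effective descent quotient arrow of the diagonal, so this is an instance of
  composition.\<close>

lemma edq_iso:
  assumes "X \<in> Ob R" "edq R X \<rho> W q" "W \<in> Ob R" "V \<in> Ob R" "h \<in> Hom R W V" "k \<in> Hom R V W"
    "Cmp R V W V h k = Idt R V" "Cmp R W V W k h = Idt R W"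
  shows "edq R X \<rho> V (Cmp R X W V h q)"
proof -
  note q = edqD[OF assms(1,2)]
  have "edq R W (Dia R W) V h"
  proof (rule edqI)
    have "Rix R W V W V h h (Rix R V W V W k k (Dia R W)) = Dia R W"
      by (rule iso_Rix_inverse) (use assms in simp_all)
    moreover have "Rix R V W V W k k (Dia R W) = Dia R V"
    proof (rule Leq_antisym[of V V])
      have "Leq R V V (Rix R V W V W k k (Dia R W)) (Rix R V W V W k k (Rix R W V W V h h (Dia R V)))"
        by (rule Rix_mono[OF _ _ _ _ _ _ _ _ Dia_lax]) (use assms in simp_all)
      then show "Leq R V V (Rix R V W V W k k (Dia R W)) (Dia R V)"
        using assms iso_Rix_inverse[of W W V V h k h k "Dia R V"] by simp
    qed (use assms Dia_lax in simp_all)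
    ultimately show "Rix R W V W V h h (Dia R V) = Dia R W" by simp
  next
    fix Z f assume Z: "Z \<in> Ob R" "f \<in> Hom R W Z"
    then show "\<exists>h'\<in>Hom R V Z. Cmp R W V Z h' h = f"
      using assms by (intro bexI[of _ "Cmp R V W Z f k"]) (simp_all flip: Cmp_assoc)
  next
    fix Z f g assume Z: "Z \<in> Ob R" "f \<in> Hom R V Z" "g \<in> Hom R V Z" "Cmp R W V Z f h = Cmp R W V Z g h"
    have "Cmp R V W Z (Cmp R W V Z f' h) k = f'" if "f' \<in> Hom R V Z" for f'
      using Cmp_assoc[of V W V Z k h f'] Z(1) that assms(3-7) by simp
    from this[OF Z(2)] this[OF Z(3)] Z(4) show "f = g" by metis
  qed (use assms iso_functional in simp_all)
  from edq_Cmp[OF assms(1,2) this] show ?thesis using q by simp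
qed

lemma edq_quotient_arrow:
  assumes "X \<in> Ob R" "edq R X \<rho> W q" "quotient_arrow R X \<rho> V r"
  obtains h k where "h \<in> Hom R W V" "k \<in> Hom R V W" "Cmp R X W V h q = r" "Cmp R X V W k r = q"
    "Cmp R V W V h k = Idt R V" "Cmp R W V W k h = Idt R W"
proof -
  note q = edqD[OF assms(1,2)]
  have \<rho>: "\<rho> \<in> Rel R X X" using edq_Rel[OF assms(1,2)] .
  have V: "V \<in> Ob R" "r \<in> Hom R X V" "Leq R X X \<rho> (kernel R X V r)"
    using assms(3) by (simp_all add: quotient_arrow_def)
  obtain h where h: "h \<in> Hom R W V" "Cmp R X W V h q = r"
    using edq_factor[OF assms(1,2) V(1,2)] V(3) assms(1) V by (auto simp: kernel_Rix)
  have "Leq R X X \<rho> (kernel R X W q)" using assms(1) q \<rho> by (simp add: kernel_Rix)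
  then obtain k where k: "k \<in> Hom R V W" "Cmp R X V W k r = q"
    using assms(3) q(1,2) unfolding quotient_arrow_def by metis
  have "Cmp R X W W (Cmp R W V W k h) q = Cmp R X W W (Idt R W) q"
    using assms(1) q(1,2) V(1,2) h k by (simp flip: Cmp_assoc)
  then have kh: "Cmp R W V W k h = Idt R W"
    using edq_epi[OF assms(1,2)] q V h k by simp
  have r: "Cmp R X V V (Cmp R V W V h k) r = r"
  proof -
    have "Cmp R X V V (Cmp R V W V h k) r = Cmp R X W V h (Cmp R X V W k r)"
      using assms(1) q(1) V h(1) k(1) by (simp add: Cmp_assoc)
    then show ?thesis using h(2) k(2) by simp
  qed
  have "\<exists>!l. l \<in> Hom R V V \<and> r = Cmp R X V V l r"
    using assms(3) V unfolding quotient_arrow_def by blast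
  then obtain l where l: "\<And>m. \<lbrakk>m \<in> Hom R V V; r = Cmp R X V V m r\<rbrakk> \<Longrightarrow> m = l" by blast
  have hk: "Cmp R V W V h k = Idt R V"
    by (rule trans[OF l l[symmetric]])
      (use V q(1) h(1) k(1) assms(1) r in simp_all)
  show ?thesis using that[of h k] h k kh hk by simp
qed

lemma edq_equiv_rel:
  assumes "X \<in> Ob R" "edq R X \<rho> W q"
  shows "equiv_rel R X \<rho>"
proof -
  note q = edqD[OF assms]
  let ?Q = "graph R X W q"
  have \<rho>: "\<rho> = Rcmp R X W X ?Q (Conv R X W ?Q)"
    using assms(1) q Rix_graph[of X X W W q q "Dia R W"] by simp
  have "Rcmp R X X X \<rho> \<rho> = Rcmp R X W X (Rcmp R X W W ?Q (Rcmp R W X W (Conv R X W ?Q) ?Q)) (Conv R X W ?Q)"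
    using assms(1) q(1,2) by (simp add: \<rho> Rcmp_assoc)
  then have "Rcmp R X X X \<rho> \<rho> = \<rho>" using assms(1) q by (simp add: \<rho>)
  then show ?thesis
    unfolding equiv_rel_def using assms(1) q(1,2) graph_total[of X W q]
    by (auto simp: \<rho> Conv_Rcmp)
qed

end

section \<open>Preservation of quotients by 1-arrows\<close>

context rd_arr
begin

lemma fr_graph [simp]:
  "\<lbrakk>X \<in> Ob R; Y \<in> Ob R; f \<in> Hom R X Y\<rbrakk> \<Longrightarrow>
    fr F X Y (graph R X Y f) = graph S (fo F X) (fo F Y) (fa F X Y f)"
  by (simp add: graph_def)

lemma fr_equiv_rel:
  assumes "X \<in> Ob R" "equiv_rel R X \<rho>"
  shows "equiv_rel S (fo F X) (fr F X X \<rho>)"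
proof -
  have "\<rho> \<in> Rel R X X" using assms by (simp add: equiv_rel_def)
  then show ?thesis
    using assms mr_mono[of X X "Dia R X" \<rho>] mr_mono[of X X "Conv R X X \<rho>" \<rho>]
      mr_mono[of X X "Rcmp R X X X \<rho> \<rho>" \<rho>]
    by (simp add: equiv_rel_def)
qed

text \<open>Effectiveness and descent are equations between graphs, hence preserved by every 1-arrow.\<close>

lemma preserves_edq:
  assumes "preserves_quotient_arrows F" "X \<in> Ob R" "edq R X \<rho> W q"
  shows "edq S (fo F X) (fr F X X \<rho>) (fo F W) (fa F X W q)"
proof -
  note q = R.edqD[OF assms(2,3)]
  have "quotient_arrow S (fo F X) (fr F X X \<rho>) (fo F W) (fa F X W q)"
    using assms R.edq_equiv_rel[OF assms(2,3)]
    by (simp add: preserves_quotient_arrows_def edq_def)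
  moreover have "kernel S (fo F X) (fo F W) (fa F X W q) = fr F X X \<rho>"
    using assms(2) q(1,2) by (simp add: S.kernel_Rix flip: q(3))
  moreover have "fr F W W (Rcmp R W X W (Conv R X W (graph R X W q)) (graph R X W q)) = fr F W W (Dia R W)"
    using q(4) by simp
  then have "descent S (fo F X) (fo F W) (fa F X W q)"
    using assms(2) q(1,2) by (simp add: descent_def)
  ultimately show ?thesis by (simp add: edq_def effective_def)
qed

text \<open>All quotient arrows of a relation are isomorphic, so it suffices to test one of them.\<close>

lemma preserves_quotient_arrowsI:
  assumes "\<And>X \<rho>. \<lbrakk>X \<in> Ob R; equiv_rel R X \<rho>\<rbrakk> \<Longrightarrow>
    \<exists>W q. edq R X \<rho> W q \<and> edq S (fo F X) (fr F X X \<rho>) (fo F W) (fa F X W q)"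
  shows "preserves_quotient_arrows F"
  unfolding preserves_quotient_arrows_def dsrc_eq dtrg_eq
proof (intro ballI allI impI)
  fix X \<rho> V r assume X: "X \<in> Ob R" "equiv_rel R X \<rho>" and r: "quotient_arrow R X \<rho> V r"
  obtain W q where q: "edq R X \<rho> W q"
    and Fq: "edq S (fo F X) (fr F X X \<rho>) (fo F W) (fa F X W q)"
    using assms[OF X] by blast
  note q' = R.edqD[OF X(1) q]
  have V: "V \<in> Ob R" using r by (simp add: quotient_arrow_def)
  obtain h k where hk: "h \<in> Hom R W V" "k \<in> Hom R V W" "Cmp R X W V h q = r"
    "Cmp R V W V h k = Idt R V" "Cmp R W V W k h = Idt R W"
    using R.edq_quotient_arrow[OF X(1) q r] .
  have "edq S (fo F X) (fr F X X \<rho>) (fo F V)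
      (Cmp S (fo F X) (fo F W) (fo F V) (fa F W V h) (fa F X W q))"
  proof (rule S.edq_iso[OF _ Fq])
    show "Cmp S (fo F V) (fo F W) (fo F V) (fa F W V h) (fa F V W k) = Idt S (fo F V)"
      "Cmp S (fo F W) (fo F V) (fo F W) (fa F V W k) (fa F W V h) = Idt S (fo F W)"
      using V hk q' by (simp_all flip: ma_Cmp ma_Idt)
  qed (use X V hk q' in simp_all)
  then show "quotient_arrow S (fo F X) (fr F X X \<rho>) (fo F V) (fa F X V r)"
    using X(1) V hk(1,2) q'(1,2) by (simp add: edq_def flip: hk(3))
qed

end


section \<open>The intensional quotient completion\<close>

context relational_doctrine
begin

lemma equiv_relD:
  assumes "X \<in> Ob R" "equiv_rel R X \<rho>"
  shows equiv_rel_Rel: "\<rho> \<in> Rel R X X" and equiv_rel_refl: "Leq R X X (Dia R X) \<rho>"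
    and equiv_rel_sym: "Conv R X X \<rho> = \<rho>" and equiv_rel_trans: "Rcmp R X X X \<rho> \<rho> = \<rho>"
proof -
  show \<rho>: "\<rho> \<in> Rel R X X" "Leq R X X (Dia R X) \<rho>" using assms by (simp_all add: equiv_rel_def)
  show "Conv R X X \<rho> = \<rho>"
    using assms \<rho> Conv_mono[of X X "Conv R X X \<rho>" \<rho>]
    by (intro Leq_antisym[of X X]) (simp_all add: equiv_rel_def)
  show "Rcmp R X X X \<rho> \<rho> = \<rho>"
    using assms \<rho> Rcmp_mono1[of X X X "Dia R X" \<rho> \<rho>]
    by (intro Leq_antisym[of X X]) (simp_all add: equiv_rel_def)
qed

text \<open>Both equivalence relations contain the diagonal, so compatibility forces \<open>\<rho> ; \<alpha> ; \<sigma> = \<alpha>\<close>, and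
  their idempotence gives the two separate equations.\<close>

lemma absorb_iff:
  assumes "X \<in> Ob R" "Y \<in> Ob R" "equiv_rel R X \<rho>" "equiv_rel R Y \<sigma>" "\<alpha> \<in> Rel R X Y"
  shows "Leq R X Y (Rcmp R X Y Y (Rcmp R X X Y (Conv R X X \<rho>) \<alpha>) \<sigma>) \<alpha> \<longleftrightarrow>
    Rcmp R X X Y \<rho> \<alpha> = \<alpha> \<and> Rcmp R X Y Y \<alpha> \<sigma> = \<alpha>" (is "?L \<longleftrightarrow> ?R")
proof
  note r = equiv_relD[OF assms(1,3)] and s = equiv_relD[OF assms(2,4)]
  assume ?L
  moreover have "Leq R X Y (Rcmp R X Y Y (Rcmp R X X Y (Dia R X) \<alpha>) (Dia R Y))
      (Rcmp R X Y Y (Rcmp R X X Y \<rho> \<alpha>) \<sigma>)"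
    by (intro Rcmp_mono Leq_refl) (use assms r s in simp_all)
  ultimately have eq: "Rcmp R X Y Y (Rcmp R X X Y \<rho> \<alpha>) \<sigma> = \<alpha>"
    using assms r s by (intro Leq_antisym[of X Y]) simp_all
  have "Rcmp R X X Y \<rho> (Rcmp R X Y Y (Rcmp R X X Y \<rho> \<alpha>) \<sigma>) = Rcmp R X Y Y (Rcmp R X X Y \<rho> \<alpha>) \<sigma>"
    using assms r s by (simp add: Rcmp_assoc)
  moreover have "Rcmp R X Y Y (Rcmp R X Y Y (Rcmp R X X Y \<rho> \<alpha>) \<sigma>) \<sigma> = Rcmp R X Y Y (Rcmp R X X Y \<rho> \<alpha>) \<sigma>"
    using assms r s by (simp flip: Rcmp_assoc)
  ultimately show ?R unfolding eq by simp
next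
  assume ?R
  then show ?L using assms equiv_relD[OF assms(1,3)] by simp
qed

end

locale pairing =
  fixes pr :: "'o \<times> 'r \<Rightarrow> 'o"
  assumes inj_pr: "inj pr"
begin

lemma und_pr [simp]: "und pr (pr (X, \<rho>)) = X" and erel_pr [simp]: "erel pr (pr (X, \<rho>)) = \<rho>"
  by (simp_all add: und_def erel_def inj_pr)

end

locale quot_doctrine = relational_doctrine R + pairing pr
  for R :: "('o, 'a, 'r) rel_doctrine" and pr :: "'o \<times> 'r \<Rightarrow> 'o"
begin

abbreviation "Q \<equiv> quot_compl pr R"
abbreviation "u \<equiv> und pr"
abbreviation "e \<equiv> erel pr"

lemma pr_Ob_Q [simp]: "pr (X, \<rho>) \<in> Ob Q \<longleftrightarrow> X \<in> Ob R \<and> equiv_rel R X \<rho>"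
  using inj_pr by (auto simp: quot_compl_def Let_def inj_eq)

lemma Ob_QD [simp]:
  assumes "A \<in> Ob Q"
  shows "u A \<in> Ob R" "equiv_rel R (u A) (e A)" "pr (u A, e A) = A"
  using assms by (auto simp: quot_compl_def Let_def)

lemma e_simps [simp]:
  assumes "A \<in> Ob Q"
  shows "e A \<in> Rel R (u A) (u A)" "Leq R (u A) (u A) (Dia R (u A)) (e A)"
    "Conv R (u A) (u A) (e A) = e A" "Rcmp R (u A) (u A) (u A) (e A) (e A) = e A"
  using equiv_relD[of "u A" "e A"] assms by simp_all

lemma Q_simps [simp]:
  "Idt Q A = Idt R (u A)" "Cmp Q A B C = Cmp R (u A) (u B) (u C)"
  "Leq Q A B = Leq R (u A) (u B)" "Rix Q A A' B B' = Rix R (u A) (u A') (u B) (u B')"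
  "Dia Q A = e A" "Rcmp Q A B C = Rcmp R (u A) (u B) (u C)" "Conv Q A B = Conv R (u A) (u B)"
  by (simp_all add: quot_compl_def Let_def)

lemma Hom_Q_iff:
  "f \<in> Hom Q A B \<longleftrightarrow> f \<in> Hom R (u A) (u B) \<and>
    Leq R (u A) (u A) (e A) (Rix R (u A) (u B) (u A) (u B) f f (e B))"
  by (simp add: quot_compl_def Let_def)

lemma Rel_Q_iff:
  "\<alpha> \<in> Rel Q A B \<longleftrightarrow> \<alpha> \<in> Rel R (u A) (u B) \<and> Leq R (u A) (u B)
      (Rcmp R (u A) (u B) (u B) (Rcmp R (u A) (u A) (u B) (Conv R (u A) (u A) (e A)) \<alpha>) (e B)) \<alpha>"
  by (simp add: quot_compl_def Let_def)

lemma Rel_Q_absorb: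
  "\<lbrakk>A \<in> Ob Q; B \<in> Ob Q\<rbrakk> \<Longrightarrow> \<alpha> \<in> Rel Q A B \<longleftrightarrow> \<alpha> \<in> Rel R (u A) (u B) \<and>
    Rcmp R (u A) (u A) (u B) (e A) \<alpha> = \<alpha> \<and> Rcmp R (u A) (u B) (u B) \<alpha> (e B) = \<alpha>"
  using absorb_iff[of "u A" "u B" "e A" "e B" \<alpha>] by (auto simp: Rel_Q_iff)

lemma Hom_QI:
  "\<lbrakk>f \<in> Hom R (u A) (u B); Leq R (u A) (u A) (e A) (Rix R (u A) (u B) (u A) (u B) f f (e B))\<rbrakk>
    \<Longrightarrow> f \<in> Hom Q A B"
  by (simp add: Hom_Q_iff)

lemma Hom_QD [simp]:
  assumes "f \<in> Hom Q A B"
  shows "f \<in> Hom R (u A) (u B)"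
    "Leq R (u A) (u A) (e A) (Rix R (u A) (u B) (u A) (u B) f f (e B))"
  using assms by (auto simp: Hom_Q_iff)

lemma Rel_QI:
  "\<lbrakk>A \<in> Ob Q; B \<in> Ob Q; \<alpha> \<in> Rel R (u A) (u B); Rcmp R (u A) (u A) (u B) (e A) \<alpha> = \<alpha>;
    Rcmp R (u A) (u B) (u B) \<alpha> (e B) = \<alpha>\<rbrakk> \<Longrightarrow> \<alpha> \<in> Rel Q A B"
  by (simp add: Rel_Q_absorb)

lemma Rel_QD [simp]:
  assumes "\<alpha> \<in> Rel Q A B" "A \<in> Ob Q" "B \<in> Ob Q"
  shows "\<alpha> \<in> Rel R (u A) (u B)" "Rcmp R (u A) (u A) (u B) (e A) \<alpha> = \<alpha>"
    "Rcmp R (u A) (u B) (u B) \<alpha> (e B) = \<alpha>"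
  using assms Rel_Q_absorb by metis+

lemma Cmp_Hom_Q:
  assumes "A \<in> Ob Q" "B \<in> Ob Q" "C \<in> Ob Q" "f \<in> Hom Q A B" "g \<in> Hom Q B C"
  shows "Cmp R (u A) (u B) (u C) g f \<in> Hom Q A C"
proof -
  have "Leq R (u A) (u A) (Rix R (u A) (u B) (u A) (u B) f f (e B))
    (Rix R (u A) (u B) (u A) (u B) f f (Rix R (u B) (u C) (u B) (u C) g g (e C)))"
    by (rule Rix_mono) (use assms in simp_all)
  moreover have "Leq R (u A) (u A) (e A) (Rix R (u A) (u B) (u A) (u B) f f (e B))"
    using assms by simp
  ultimately have "Leq R (u A) (u A) (e A)
    (Rix R (u A) (u B) (u A) (u B) f f (Rix R (u B) (u C) (u B) (u C) g g (e C)))"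
    by (elim Leq_trans[rotated 5]) (use assms in simp_all)
  then show ?thesis using assms by (intro Hom_QI) (simp_all add: Rix_Cmp)
qed

lemma Rix_Rel_Q:
  assumes "A \<in> Ob Q" "B \<in> Ob Q" "A' \<in> Ob Q" "B' \<in> Ob Q" "f \<in> Hom Q A A'" "g \<in> Hom Q B B'"
    "\<alpha> \<in> Rel Q A' B'"
  shows "Rix R (u A) (u A') (u B) (u B') f g \<alpha> \<in> Rel Q A B"
proof -
  let ?\<alpha> = "Rix R (u A) (u A') (u B) (u B') f g \<alpha>"
  let ?\<rho> = "Rix R (u A) (u A') (u A) (u A') f f (e A')"
  let ?\<sigma> = "Rix R (u B) (u B') (u B) (u B') g g (e B')"
  have "Leq R (u A) (u B) (Rcmp R (u A) (u B) (u B) (Rcmp R (u A) (u A) (u B) (e A) ?\<alpha>) (e B))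
    (Rcmp R (u A) (u B) (u B) (Rcmp R (u A) (u A) (u B) ?\<rho> ?\<alpha>) ?\<sigma>)"
    by (intro Rcmp_mono Leq_refl) (use assms in simp_all)
  moreover have "Leq R (u A) (u B) (Rcmp R (u A) (u A) (u B) ?\<rho> ?\<alpha>) ?\<alpha>"
    using Rcmp_lax[of "u A" "u A" "u B" "u A'" "u A'" "u B'" f f g "e A'" \<alpha>] assms by simp
  then have "Leq R (u A) (u B) (Rcmp R (u A) (u B) (u B) (Rcmp R (u A) (u A) (u B) ?\<rho> ?\<alpha>) ?\<sigma>)
    (Rcmp R (u A) (u B) (u B) ?\<alpha> ?\<sigma>)"
    by (intro Rcmp_mono1) (use assms in simp_all)
  moreover have "Leq R (u A) (u B) (Rcmp R (u A) (u B) (u B) ?\<alpha> ?\<sigma>) ?\<alpha>"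
    using Rcmp_lax[of "u A" "u B" "u B" "u A'" "u B'" "u B'" f g g \<alpha> "e B'"] assms by simp
  ultimately have "Leq R (u A) (u B)
      (Rcmp R (u A) (u B) (u B) (Rcmp R (u A) (u A) (u B) (e A) ?\<alpha>) (e B)) ?\<alpha>"
    by (elim Leq_trans[rotated 5]) (use assms in \<open>simp_all\<close>)
  then show ?thesis using assms by (subst Rel_Q_iff) simp
qed

lemma quot_compl_doctrine: "relational_doctrine Q"
proof (unfold_locales, goal_cases)
  case (1 A) then show ?case by (intro Hom_QI) simp_all
next
  case (2 A B C f g) then show ?case using Cmp_Hom_Q by simp
next
  case (5 A B C D f g h) then show ?case by (simp add: Cmp_assoc)
next
  case (7 A B \<alpha> \<beta>) then show ?case by (intro Leq_antisym[of "u A" "u B"]) simp_all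
next
  case (8 A B \<alpha> \<beta> \<gamma>) then show ?case using Leq_trans[of "u A" "u B" \<alpha> \<beta> \<gamma>] by simp
next
  case (9 A B A' B' f g \<alpha>) then show ?case using Rix_Rel_Q by simp
next
  case (10 A B A' B' f g \<alpha> \<beta>) then show ?case by (simp add: Rix_mono)
next
  case (12 A A' A'' B B' B'' f f' g g' \<alpha>) then show ?case by (simp add: Rix_Cmp)
next
  case (13 A) then show ?case by (intro Rel_QI) simp_all
next
  case (14 A B f) then show ?case by simp
next
  case (15 A B C \<alpha> \<beta>)
  then show ?case
    using Rcmp_assoc[of "u A" "u A" "u B" "u C" "e A" \<alpha> \<beta>] Rcmp_assoc[of "u A" "u B" "u C" "u C" \<alpha> \<beta> "e C"]
    by (intro Rel_QI) simp_all
next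
  case (16 A B C \<alpha> \<alpha>' \<beta> \<beta>') then show ?case by (simp add: Rcmp_mono)
next
  case (17 A B C A' B' C' f g h \<alpha> \<beta>) then show ?case by (simp add: Rcmp_lax)
next
  case (18 A B \<alpha>)
  then show ?case
    using Conv_Rcmp[of "u A" "u A" "u B" "e A" \<alpha>] Conv_Rcmp[of "u A" "u B" "u B" \<alpha> "e B"]
    by (intro Rel_QI) simp_all
next
  case (19 A B \<alpha> \<beta>) then show ?case by (simp add: Conv_mono)
next
  case (20 A B A' B' f g \<alpha>) then show ?case by (simp add: Conv_lax)
next
  case (21 A B C D \<alpha> \<beta> \<gamma>) then show ?case by (simp add: Rcmp_assoc)
next
  case (24 A B C \<alpha> \<beta>) then show ?case by (simp add: Conv_Rcmp)
qed simp_all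

sublocale Q: relational_doctrine Q by (rule quot_compl_doctrine)

text \<open>The graph of an arrow of the quotient completion is its graph followed by the
  equivalence relation of the target.\<close>

lemma graph_Q: "graph Q A B f = Rix R (u A) (u B) (u B) (u B) f (Idt R (u B)) (e B)"
  by (simp add: graph_def)


lemma equiv_rel_Dia [simp]: "X \<in> Ob R \<Longrightarrow> equiv_rel R X (Dia R X)"
  by (simp add: equiv_rel_def)

text \<open>Compatibility of \<open>\<sigma>\<close> with \<open>\<rho> \<le> \<sigma>\<close> comes for free: \<open>\<rho> ; \<sigma> ; \<rho> \<le> \<sigma> ; \<sigma> ; \<sigma> \<le> \<sigma>\<close>.\<close>

lemma equiv_rel_Q_iff:
  assumes "A \<in> Ob Q"
  shows "equiv_rel Q A \<sigma> \<longleftrightarrow> equiv_rel R (u A) \<sigma> \<and> Leq R (u A) (u A) (e A) \<sigma>"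
proof
  assume L: "equiv_rel Q A \<sigma>"
  then have "\<sigma> \<in> Rel Q A A" by (simp add: equiv_rel_def)
  then have \<sigma>: "\<sigma> \<in> Rel R (u A) (u A)" using assms by simp
  have "Leq R (u A) (u A) (Dia R (u A)) \<sigma>"
    by (rule Leq_trans[of _ _ _ "e A"]) (use L assms \<sigma> in \<open>simp_all add: equiv_rel_def\<close>)
  then show "equiv_rel R (u A) \<sigma> \<and> Leq R (u A) (u A) (e A) \<sigma>"
    using L \<sigma> by (simp add: equiv_rel_def)
next
  assume r: "equiv_rel R (u A) \<sigma> \<and> Leq R (u A) (u A) (e A) \<sigma>"
  note s = equiv_relD[OF Ob_QD(1)[OF assms] conjunct1[OF r]]
  have "Leq R (u A) (u A) (Rcmp R (u A) (u A) (u A) (Rcmp R (u A) (u A) (u A) (e A) \<sigma>) (e A))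
    (Rcmp R (u A) (u A) (u A) (Rcmp R (u A) (u A) (u A) \<sigma> \<sigma>) \<sigma>)"
    by (intro Rcmp_mono Leq_refl) (use assms r s in simp_all)
  then have "\<sigma> \<in> Rel Q A A"
    using assms s by (subst Rel_Q_iff) simp
  then show "equiv_rel Q A \<sigma>"
    using r by (simp add: equiv_rel_def)
qed

end

section \<open>The monad structure of the quotient completion\<close>

lemma Tq_map_simps [simp]:
  "dsrc (Tq_map pr F) = quot_compl pr (dsrc F)" "dtrg (Tq_map pr F) = quot_compl pr (dtrg F)"
  "A \<in> Ob (quot_compl pr (dsrc F)) \<Longrightarrow>
    fo (Tq_map pr F) A = pr (fo F (und pr A), fr F (und pr A) (und pr A) (erel pr A))"
  "\<lbrakk>A \<in> Ob (quot_compl pr (dsrc F)); B \<in> Ob (quot_compl pr (dsrc F)); f \<in> Hom (quot_compl pr (dsrc F)) A B\<rbrakk> \<Longrightarrow>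
    fa (Tq_map pr F) A B f = fa F (und pr A) (und pr B) f"
  "\<lbrakk>A \<in> Ob (quot_compl pr (dsrc F)); B \<in> Ob (quot_compl pr (dsrc F)); \<alpha> \<in> Rel (quot_compl pr (dsrc F)) A B\<rbrakk> \<Longrightarrow>
    fr (Tq_map pr F) A B \<alpha> = fr F (und pr A) (und pr B) \<alpha>"
  by (simp_all add: Tq_map_def Let_def)

lemma Tq_unit_simps [simp]:
  "dsrc (Tq_unit pr R) = R" "dtrg (Tq_unit pr R) = quot_compl pr R"
  "X \<in> Ob R \<Longrightarrow> fo (Tq_unit pr R) X = pr (X, Dia R X)"
  "\<lbrakk>X \<in> Ob R; Y \<in> Ob R; f \<in> Hom R X Y\<rbrakk> \<Longrightarrow> fa (Tq_unit pr R) X Y f = f"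
  "\<lbrakk>X \<in> Ob R; Y \<in> Ob R; \<alpha> \<in> Rel R X Y\<rbrakk> \<Longrightarrow> fr (Tq_unit pr R) X Y \<alpha> = \<alpha>"
  by (simp_all add: Tq_unit_def)

lemma Tq_mult_simps [simp]:
  "dsrc (Tq_mult pr R) = quot_compl pr (quot_compl pr R)" "dtrg (Tq_mult pr R) = quot_compl pr R"
  "A \<in> Ob (quot_compl pr (quot_compl pr R)) \<Longrightarrow>
    fo (Tq_mult pr R) A = pr (und pr (und pr A), erel pr A)"
  "\<lbrakk>A \<in> Ob (quot_compl pr (quot_compl pr R)); B \<in> Ob (quot_compl pr (quot_compl pr R));
    f \<in> Hom (quot_compl pr (quot_compl pr R)) A B\<rbrakk> \<Longrightarrow> fa (Tq_mult pr R) A B f = f"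
  "\<lbrakk>A \<in> Ob (quot_compl pr (quot_compl pr R)); B \<in> Ob (quot_compl pr (quot_compl pr R));
    \<alpha> \<in> Rel (quot_compl pr (quot_compl pr R)) A B\<rbrakk> \<Longrightarrow> fr (Tq_mult pr R) A B \<alpha> = \<alpha>"
  by (simp_all add: Tq_mult_def Let_def)

lemma Tq_cell_simps [simp]:
  "msrc (Tq_cell pr \<theta>) = Tq_map pr (msrc \<theta>)" "mtrg (Tq_cell pr \<theta>) = Tq_map pr (mtrg \<theta>)"
  "A \<in> Ob (quot_compl pr (dsrc (msrc \<theta>))) \<Longrightarrow> cpt (Tq_cell pr \<theta>) A = cpt \<theta> (und pr A)"
  by (simp_all add: Tq_cell_def)

context pairing
begin

abbreviation "T \<equiv> Tq_map pr"
abbreviation "E \<equiv> Tq_unit pr"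
abbreviation "M \<equiv> Tq_mult pr"

lemma quot_doctrineI: "relational_doctrine R \<Longrightarrow> quot_doctrine R pr"
  by (simp add: quot_doctrine_def pairing_axioms)

lemma Tq_map_arr:
  assumes "rd_arr R S F"
  shows "rd_arr (quot_compl pr R) (quot_compl pr S) (T F)"
proof -
  interpret F: rd_arr R S F by fact
  interpret R: quot_doctrine R pr by (rule quot_doctrineI[OF F.R.doctrine])
  interpret S: quot_doctrine S pr by (rule quot_doctrineI[OF F.S.doctrine])
  have o: "fo (T F) A \<in> Ob S.Q" if "A \<in> Ob R.Q" for A
    using that by (simp add: F.fr_equiv_rel)
  have a: "fa F (und pr A) (und pr B) f \<in> Hom S.Q (fo (T F) A) (fo (T F) B)"
    if "A \<in> Ob R.Q" "B \<in> Ob R.Q" "f \<in> Hom R.Q A B" for A B f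
    using that F.mr_mono[OF _ _ _ _ R.Hom_QD(2)[OF that(3)]]
    by (intro S.Hom_QI) simp_all
  have r: "fr F (und pr A) (und pr B) \<alpha> \<in> Rel S.Q (fo (T F) A) (fo (T F) B)"
    if "A \<in> Ob R.Q" "B \<in> Ob R.Q" "\<alpha> \<in> Rel R.Q A B" for A B \<alpha>
    using that o by (intro S.Rel_QI) (simp_all flip: F.mr_Rcmp)
  show ?thesis
  proof (unfold_locales, goal_cases)
    case 1 then show ?case using o by (auto simp: Tq_map_def Let_def)
  next
    case 2 then show ?case using a by (auto simp: Tq_map_def Let_def)
  next
    case 3 then show ?case using r by (auto simp: Tq_map_def Let_def)
  next
    case (6 A B \<alpha> \<beta>) then show ?case by (simp add: F.mr_mono)
  next
    case (4 A) then show ?case using R.Q.Idt_Hom[of A] by simp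
  next
    case (5 A B C f g) then show ?case using R.Q.Cmp_Hom[of A B C f g] by simp
  next
    case (7 A B A' B' f g \<alpha>) then show ?case using R.Q.Rix_Rel[of A B A' B' f g \<alpha>] by simp
  next
    case (8 A) then show ?case using R.Q.Dia_Rel[of A] by simp
  next
    case (9 A B C \<alpha> \<beta>) then show ?case using R.Q.Rcmp_Rel[of A B C \<alpha> \<beta>] by simp
  next
    case (10 A B \<alpha>) then show ?case using R.Q.Conv_Rel[of A B \<alpha>] by simp
  qed simp_all
qed

lemma Tq_unit_arr:
  assumes "relational_doctrine R"
  shows "rd_arr R (quot_compl pr R) (E R)"
proof -
  interpret R: quot_doctrine R pr using assms by (rule quot_doctrineI)
  have a: "f \<in> Hom R.Q (pr (X, Dia R X)) (pr (Y, Dia R Y))"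
    if "X \<in> Ob R" "Y \<in> Ob R" "f \<in> Hom R X Y" for X Y f
    using that by (intro R.Hom_QI) (simp_all add: R.Dia_lax)
  have r: "\<alpha> \<in> Rel R.Q (pr (X, Dia R X)) (pr (Y, Dia R Y))"
    if "X \<in> Ob R" "Y \<in> Ob R" "\<alpha> \<in> Rel R X Y" for X Y \<alpha>
    using that by (intro R.Rel_QI) simp_all
  show ?thesis
    by unfold_locales (auto simp: Tq_unit_def a r)
qed

lemma Tq_mult_arr:
  assumes "relational_doctrine R"
  shows "rd_arr (quot_compl pr (quot_compl pr R)) (quot_compl pr R) (M R)"
proof -
  interpret R: quot_doctrine R pr using assms by (rule quot_doctrineI)
  interpret Q: quot_doctrine R.Q pr using R.Q.doctrine by (rule quot_doctrineI)
  let ?m = "\<lambda>A. pr (und pr (und pr A), erel pr A)"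
  have o: "?m A \<in> Ob R.Q" if "A \<in> Ob Q.Q" for A
    using that R.equiv_rel_Q_iff[of "und pr A" "erel pr A"] by simp
  have a: "f \<in> Hom R.Q (?m A) (?m B)"
    if "A \<in> Ob Q.Q" "B \<in> Ob Q.Q" "f \<in> Hom Q.Q A B" for A B f
    using that Q.Hom_QD[OF that(3)] by (intro R.Hom_QI) simp_all
  have r: "\<alpha> \<in> Rel R.Q (?m A) (?m B)"
    if "A \<in> Ob Q.Q" "B \<in> Ob Q.Q" "\<alpha> \<in> Rel Q.Q A B" for A B \<alpha>
    using that Q.Rel_QD[OF that(3,1,2)] o by (intro R.Rel_QI) simp_all
  show ?thesis
  proof (unfold_locales, goal_cases)
    case 1 then show ?case using o by (auto simp: Tq_mult_def Let_def)
  next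
    case 2 then show ?case using a by (auto simp: Tq_mult_def Let_def)
  next
    case 3 then show ?case using r by (auto simp: Tq_mult_def Let_def)
  next
    case (4 A) then show ?case using Q.Q.Idt_Hom[of A] by simp
  next
    case (5 A B C f g) then show ?case using Q.Q.Cmp_Hom[of A B C f g] by simp
  next
    case (7 A B A' B' f g \<alpha>) then show ?case using Q.Q.Rix_Rel[of A B A' B' f g \<alpha>] by simp
  next
    case (8 A) then show ?case using Q.Q.Dia_Rel[of A] by simp
  next
    case (9 A B C \<alpha> \<beta>) then show ?case using Q.Q.Rcmp_Rel[of A B C \<alpha> \<beta>] by simp
  next
    case (10 A B \<alpha>) then show ?case using Q.Q.Conv_Rel[of A B \<alpha>] by simp
  qed simp_all
qed

lemma Tq_map_id:
  assumes "relational_doctrine R"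
  shows "T (rd_id R) = rd_id (quot_compl pr R)"
proof -
  interpret R: quot_doctrine R pr using assms by (rule quot_doctrineI)
  show ?thesis
    by (rule rd_arr_eqI[OF Tq_map_arr[OF rd_id_arr[OF assms]] rd_id_arr[OF R.Q.doctrine]])
      simp_all
qed

lemma Tq_map_comp:
  assumes "rd_arr R S F" "rd_arr S U G"
  shows "T (rd_comp G F) = rd_comp (T G) (T F)"
proof -
  interpret F: rd_arr R S F by fact
  interpret G: rd_arr S U G by fact
  interpret R: quot_doctrine R pr by (rule quot_doctrineI[OF F.R.doctrine])
  interpret S: quot_doctrine S pr by (rule quot_doctrineI[OF F.S.doctrine])
  interpret QF: rd_arr R.Q S.Q "T F" using assms(1) by (rule Tq_map_arr)
  show ?thesis
  proof (rule rd_arr_eqI[OF Tq_map_arr[OF rd_comp_arr[OF assms]]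
        rd_comp_arr[OF Tq_map_arr[OF assms(1)] Tq_map_arr[OF assms(2)]]], goal_cases)
    case (1 A) then show ?case using QF.fo_Ob[of A] by simp
  next
    case (2 A B f) then show ?case using QF.fo_Ob[of A] QF.fo_Ob[of B] QF.fa_Hom[of A B f] by simp
  next
    case (3 A B \<alpha>) then show ?case using QF.fo_Ob[of A] QF.fo_Ob[of B] QF.fr_Rel[of A B \<alpha>] by simp
  qed
qed

lemma Tq_unit_natural:
  assumes "rd_arr R S F"
  shows "rd_comp (T F) (E R) = rd_comp (E S) F"
proof -
  interpret F: rd_arr R S F by fact
  interpret R: quot_doctrine R pr by (rule quot_doctrineI[OF F.R.doctrine])
  interpret S: quot_doctrine S pr by (rule quot_doctrineI[OF F.S.doctrine])
  interpret U: rd_arr R R.Q "E R" by (rule Tq_unit_arr[OF F.R.doctrine])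
  show ?thesis
  proof (rule rd_arr_eqI[OF rd_comp_arr[OF U.arr Tq_map_arr[OF assms]]
        rd_comp_arr[OF assms Tq_unit_arr[OF F.S.doctrine]]], goal_cases)
    case (1 X) then show ?case by simp
  next
    case (2 X Y f) then show ?case using U.fa_Hom[of X Y f] by simp
  next
    case (3 X Y \<alpha>) then show ?case using U.fr_Rel[of X Y \<alpha>] by simp
  qed
qed

lemma Tq_mult_natural:
  assumes "rd_arr R S F"
  shows "rd_comp (T F) (M R) = rd_comp (M S) (T (T F))"
proof -
  interpret F: rd_arr R S F by fact
  interpret R: quot_doctrine R pr by (rule quot_doctrineI[OF F.R.doctrine])
  interpret S: quot_doctrine S pr by (rule quot_doctrineI[OF F.S.doctrine])
  interpret QR: quot_doctrine R.Q pr using R.Q.doctrine by (rule quot_doctrineI)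
  interpret QS: quot_doctrine S.Q pr using S.Q.doctrine by (rule quot_doctrineI)
  interpret M: rd_arr QR.Q R.Q "M R" by (rule Tq_mult_arr[OF F.R.doctrine])
  interpret QF: rd_arr R.Q S.Q "T F" by (rule Tq_map_arr[OF assms])
  interpret QQF: rd_arr QR.Q QS.Q "T (T F)" by (rule Tq_map_arr[OF QF.arr])
  show ?thesis
  proof (rule rd_arr_eqI[OF rd_comp_arr[OF M.arr QF.arr]
        rd_comp_arr[OF QQF.arr Tq_mult_arr[OF F.S.doctrine]]], goal_cases)
    case (1 A) then show ?case using M.fo_Ob[of A] QQF.fo_Ob[of A] by simp
  next
    case (2 A B f)
    then show ?case using M.fo_Ob[of A] M.fo_Ob[of B] M.fa_Hom[of A B f]
      QQF.fo_Ob[of A] QQF.fo_Ob[of B] QQF.fa_Hom[of A B f] by simp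
  next
    case (3 A B \<alpha>)
    then show ?case using M.fo_Ob[of A] M.fo_Ob[of B] M.fr_Rel[of A B \<alpha>]
      QQF.fo_Ob[of A] QQF.fo_Ob[of B] QQF.fr_Rel[of A B \<alpha>] by simp
  qed
qed

lemma Tq_cell_cel:
  assumes "rd_cel R S F G \<theta>"
  shows "rd_cel (quot_compl pr R) (quot_compl pr S) (T F) (T G) (Tq_cell pr \<theta>)"
proof -
  interpret t: rd_cel R S F G \<theta> by fact
  interpret R: quot_doctrine R pr by (rule quot_doctrineI[OF t.F.R.doctrine])
  interpret S: quot_doctrine S pr by (rule quot_doctrineI[OF t.F.S.doctrine])
  show ?thesis
  proof (rule rd_celI, goal_cases)
    case 1 then show ?case by (rule Tq_map_arr[OF t.F.arr])
  next
    case 2 then show ?case by (rule Tq_map_arr[OF t.G.arr])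
  next
    case 5 then show ?case by (simp add: Tq_cell_def)
  next
    case (6 A) then show ?case by (intro S.Hom_QI) (simp_all add: t.t_lax)
  next
    case (7 A B f) then show ?case by (simp add: t.t_natural)
  next
    case (8 A B \<alpha>) then show ?case by (simp add: t.t_lax)
  qed simp_all
qed

end

context quot_doctrine
begin

lemma QQ: "quot_doctrine Q pr"
  using Q.doctrine by (rule quot_doctrineI)

end

section \<open>Invertible 2-arrows and coverings\<close>

lemma iso2_RD:
  assumes "rd_cel R S F G \<theta>"
  shows "iso2 RD \<theta> \<longleftrightarrow>
    (\<exists>\<phi>. rd_cel R S G F \<phi> \<and> rd_vcomp \<phi> \<theta> = rd_id2 F \<and> rd_vcomp \<theta> \<phi> = rd_id2 G)"
proof -
  interpret t: rd_cel R S F G \<theta> by fact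
  show ?thesis
    using assms t.G.arr
    by (auto simp: iso2_def in_two_RD rd_cel_iff rd_arr_iff)
qed

text \<open>Reindexing the lax naturality of the inverse along \<open>\<theta>\<close> gives the converse of the lax
  naturality of \<open>\<theta>\<close>, so that the latter is an equality.\<close>

lemma iso2_RDE:
  assumes "rd_cel R S F G \<theta>" "iso2 RD \<theta>"
  obtains \<phi> where "rd_cel R S G F \<phi>"
    "\<And>X. X \<in> Ob R \<Longrightarrow> Cmp S (fo F X) (fo G X) (fo F X) (cpt \<phi> X) (cpt \<theta> X) = Idt S (fo F X)"
    "\<And>X. X \<in> Ob R \<Longrightarrow> Cmp S (fo G X) (fo F X) (fo G X) (cpt \<theta> X) (cpt \<phi> X) = Idt S (fo G X)"
    "\<And>X Y \<alpha>. \<lbrakk>X \<in> Ob R; Y \<in> Ob R; \<alpha> \<in> Rel R X Y\<rbrakk> \<Longrightarrow>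
      Rix S (fo F X) (fo G X) (fo F Y) (fo G Y) (cpt \<theta> X) (cpt \<theta> Y) (fr G X Y \<alpha>) = fr F X Y \<alpha>"
proof -
  interpret t: rd_cel R S F G \<theta> by fact
  obtain \<phi> where \<phi>: "rd_cel R S G F \<phi>" "rd_vcomp \<phi> \<theta> = rd_id2 F" "rd_vcomp \<theta> \<phi> = rd_id2 G"
    using assms iso2_RD by blast
  interpret p: rd_cel R S G F \<phi> by fact
  have inv: "Cmp S (fo F X) (fo G X) (fo F X) (cpt \<phi> X) (cpt \<theta> X) = Idt S (fo F X)"
    "Cmp S (fo G X) (fo F X) (fo G X) (cpt \<theta> X) (cpt \<phi> X) = Idt S (fo G X)" if "X \<in> Ob R" for X
    using arg_cong[OF \<phi>(2), of "\<lambda>\<psi>. cpt \<psi> X"] arg_cong[OF \<phi>(3), of "\<lambda>\<psi>. cpt \<psi> X"] that by simp_all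
  have rel: "Rix S (fo F X) (fo G X) (fo F Y) (fo G Y) (cpt \<theta> X) (cpt \<theta> Y) (fr G X Y \<alpha>) = fr F X Y \<alpha>"
    if "X \<in> Ob R" "Y \<in> Ob R" "\<alpha> \<in> Rel R X Y" for X Y \<alpha>
  proof (rule t.F.S.Leq_antisym[of "fo F X" "fo F Y"])
    have "Leq S (fo F X) (fo F Y)
       (Rix S (fo F X) (fo G X) (fo F Y) (fo G Y) (cpt \<theta> X) (cpt \<theta> Y) (fr G X Y \<alpha>))
       (Rix S (fo F X) (fo G X) (fo F Y) (fo G Y) (cpt \<theta> X) (cpt \<theta> Y)
         (Rix S (fo G X) (fo F X) (fo G Y) (fo F Y) (cpt \<phi> X) (cpt \<phi> Y) (fr F X Y \<alpha>)))"
      by (rule t.F.S.Rix_mono[OF _ _ _ _ _ _ _ _ p.t_lax]) (use that in simp_all)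
    then show "Leq S (fo F X) (fo F Y)
       (Rix S (fo F X) (fo G X) (fo F Y) (fo G Y) (cpt \<theta> X) (cpt \<theta> Y) (fr G X Y \<alpha>)) (fr F X Y \<alpha>)"
      using that inv by (simp add: t.F.S.iso_Rix_inverse)
  qed (use that t.t_lax in simp_all)
  show thesis using that[OF \<phi>(1)] inv rel by blast
qed


text \<open>
  A 1-arrow \<open>G : D \<rightarrow> S\<close> is covered by data \<open>(uo, ua, ur)\<close> on objects, arrows and relations of
  \<open>D\<close> when each \<open>G A\<close> is the quotient, along \<open>u A\<close>, of \<open>uo A\<close> by the relation that \<open>ur\<close> assigns
  to the diagonal of \<open>A\<close>, compatibly with arrows and relations. The covering data determine \<open>G\<close>
  up to a unique invertible 2-arrow, so that 2-arrows out of \<open>G\<close> can be compared on \<open>uo\<close>. The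
  data need not form a 1-arrow: for the quotient completion, \<open>uo\<close> forgets the equivalence
  relation, which does not preserve diagonals.
\<close>

locale covering = G: rd_arr D S G
  for D S :: "('o, 'a, 'r) rel_doctrine" and G +
  fixes uo :: "'o \<Rightarrow> 'o" and ua :: "'o \<Rightarrow> 'o \<Rightarrow> 'a \<Rightarrow> 'a" and ur :: "'o \<Rightarrow> 'o \<Rightarrow> 'r \<Rightarrow> 'r"
    and u :: "'o \<Rightarrow> 'a"
  assumes uo_Ob [simp]: "A \<in> Ob D \<Longrightarrow> uo A \<in> Ob S"
    and ua_Hom [simp]: "\<lbrakk>A \<in> Ob D; B \<in> Ob D; f \<in> Hom D A B\<rbrakk> \<Longrightarrow> ua A B f \<in> Hom S (uo A) (uo B)"
    and u_edq: "A \<in> Ob D \<Longrightarrow> edq S (uo A) (ur A A (Dia D A)) (fo G A) (u A)"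
    and u_natural: "\<lbrakk>A \<in> Ob D; B \<in> Ob D; f \<in> Hom D A B\<rbrakk> \<Longrightarrow>
      Cmp S (uo A) (fo G A) (fo G B) (fa G A B f) (u A) = Cmp S (uo A) (uo B) (fo G B) (u B) (ua A B f)"
    and u_Rix: "\<lbrakk>A \<in> Ob D; B \<in> Ob D; \<alpha> \<in> Rel D A B\<rbrakk> \<Longrightarrow>
      Rix S (uo A) (fo G A) (uo B) (fo G B) (u A) (u B) (fr G A B \<alpha>) = ur A B \<alpha>"
begin

lemma u_Hom [simp]: "A \<in> Ob D \<Longrightarrow> u A \<in> Hom S (uo A) (fo G A)"
  using G.S.edq_Hom[OF _ u_edq] by simp

lemma ur_Rel [simp]: "\<lbrakk>A \<in> Ob D; B \<in> Ob D; \<alpha> \<in> Rel D A B\<rbrakk> \<Longrightarrow> ur A B \<alpha> \<in> Rel S (uo A) (uo B)"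
  using G.S.Rix_Rel[of "uo A" "uo B" "fo G A" "fo G B" "u A" "u B" "fr G A B \<alpha>"]
  by (simp add: u_Rix)

lemma u_epi:
  "\<lbrakk>A \<in> Ob D; Z \<in> Ob S; h \<in> Hom S (fo G A) Z; k \<in> Hom S (fo G A) Z;
    Cmp S (uo A) (fo G A) Z h (u A) = Cmp S (uo A) (fo G A) Z k (u A)\<rbrakk> \<Longrightarrow> h = k"
  using G.S.edq_epi[OF _ u_edq] by simp

lemma cel_eqI:
  assumes "rd_cel D S G H \<theta>" "rd_cel D S G H \<phi>"
    and "\<And>A. A \<in> Ob D \<Longrightarrow>
      Cmp S (uo A) (fo G A) (fo H A) (cpt \<theta> A) (u A) = Cmp S (uo A) (fo G A) (fo H A) (cpt \<phi> A) (u A)"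
  shows "\<theta> = \<phi>"
proof -
  interpret t: rd_cel D S G H \<theta> by fact
  interpret p: rd_cel D S G H \<phi> by fact
  show ?thesis
  proof (rule rd_cel_eqI[OF assms(1,2)])
    fix A assume "A \<in> Ob D"
    then show "cpt \<theta> A = cpt \<phi> A" by (intro u_epi[OF _ _ _ _ assms(3)]) simp_all
  qed
qed

end

text \<open>The comparison exists componentwise by uniqueness of quotients. It is natural because \<open>u\<close> is
  epic, and compatible with relations because reindexing along \<open>u\<close> is injective.\<close>

lemma covering_comparison:
  assumes "covering D S G uo ua ur u" "covering D S H uo ua ur v"
  obtains \<theta> where "rd_cel D S G H \<theta>"
    "\<And>A. A \<in> Ob D \<Longrightarrow> Cmp S (uo A) (fo G A) (fo H A) (cpt \<theta> A) (u A) = v A"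
proof -
  interpret G: covering D S G uo ua ur u by fact
  interpret H: covering D S H uo ua ur v by fact
  have "\<exists>h. h \<in> Hom S (fo G A) (fo H A) \<and> Cmp S (uo A) (fo G A) (fo H A) h (u A) = v A"
    if A: "A \<in> Ob D" for A
  proof -
    have "quotient_arrow S (uo A) (ur A A (Dia D A)) (fo H A) (v A)"
      using H.u_edq[OF A] by (simp add: edq_def)
    then show ?thesis
      by (rule G.G.S.edq_quotient_arrow[OF G.uo_Ob[OF A] G.u_edq[OF A]]) blast
  qed
  then obtain t where t: "\<And>A. A \<in> Ob D \<Longrightarrow> t A \<in> Hom S (fo G A) (fo H A)"
    "\<And>A. A \<in> Ob D \<Longrightarrow> Cmp S (uo A) (fo G A) (fo H A) (t A) (u A) = v A" by metis
  let ?\<theta> = "\<lparr>msrc = G, mtrg = H, cpt = restrict t (Ob D)\<rparr>"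
  have "rd_cel D S G H ?\<theta>"
  proof (rule rd_celI[OF G.G.arr H.G.arr], goal_cases)
    case (5 A B f)
    have "Cmp S (uo A) (fo G A) (fo H B) (Cmp S (fo G A) (fo G B) (fo H B) (t B) (fa G A B f)) (u A) =
      Cmp S (uo A) (uo B) (fo H B) (Cmp S (uo B) (fo G B) (fo H B) (t B) (u B)) (ua A B f)"
      using 5 t(1) by (simp add: G.u_natural flip: G.G.S.Cmp_assoc)
    also have "\<dots> = Cmp S (uo A) (fo G A) (fo H B)
      (Cmp S (fo G A) (fo H A) (fo H B) (fa H A B f) (t A)) (u A)"
      using 5 t(1) by (simp add: t(2) flip: G.G.S.Cmp_assoc) (simp add: H.u_natural)
    finally have "Cmp S (fo G A) (fo G B) (fo H B) (t B) (fa G A B f) =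
      Cmp S (fo G A) (fo H A) (fo H B) (fa H A B f) (t A)"
      by (rule G.u_epi[rotated 4]) (use 5 t(1) in simp_all)
    then show ?case using 5 by simp
  next
    case (6 A B \<alpha>)
    have "fr G A B \<alpha> = Rix S (fo G A) (fo H A) (fo G B) (fo H B) (t A) (t B) (fr H A B \<alpha>)"
    proof (rule G.G.S.edq_Rix_inj[OF _ G.u_edq _ G.u_edq])
      show "Rix S (uo A) (fo G A) (uo B) (fo G B) (u A) (u B) (fr G A B \<alpha>) =
        Rix S (uo A) (fo G A) (uo B) (fo G B) (u A) (u B)
          (Rix S (fo G A) (fo H A) (fo G B) (fo H B) (t A) (t B) (fr H A B \<alpha>))"
        using 6 t(1) by (simp add: G.u_Rix H.u_Rix t(2) flip: G.G.S.Rix_Cmp)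
    qed (use 6 t(1) in simp_all)
    then show ?case using 6 by simp (metis G.G.S.Leq_refl G.G.fo_Ob G.G.fr_Rel)
  qed (simp_all add: t)
  then show thesis using that t(2) by auto
qed

lemma covering_comparison_iso:
  assumes "covering D S G uo ua ur u" "covering D S H uo ua ur v" "rd_cel D S G H \<theta>"
    and "\<And>A. A \<in> Ob D \<Longrightarrow> Cmp S (uo A) (fo G A) (fo H A) (cpt \<theta> A) (u A) = v A"
  shows "iso2 RD \<theta>"
proof -
  interpret G: covering D S G uo ua ur u by fact
  interpret H: covering D S H uo ua ur v by fact
  interpret t: rd_cel D S G H \<theta> by fact
  obtain \<phi> where \<phi>: "rd_cel D S H G \<phi>"
    "\<And>A. A \<in> Ob D \<Longrightarrow> Cmp S (uo A) (fo H A) (fo G A) (cpt \<phi> A) (v A) = u A"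
    using covering_comparison[OF assms(2,1)] by metis
  interpret p: rd_cel D S H G \<phi> by fact
  have "rd_vcomp \<phi> \<theta> = rd_id2 G"
    by (rule G.cel_eqI[OF rd_vcomp_cel[OF assms(3) \<phi>(1)] rd_id2_cel[OF G.G.arr]])
      (simp add: assms(4) \<phi>(2) flip: G.G.S.Cmp_assoc)
  moreover have "rd_vcomp \<theta> \<phi> = rd_id2 H"
    by (rule H.cel_eqI[OF rd_vcomp_cel[OF \<phi>(1) assms(3)] rd_id2_cel[OF H.G.arr]])
      (simp add: assms(4) \<phi>(2) flip: G.G.S.Cmp_assoc)
  ultimately show ?thesis using iso2_RD[OF assms(3)] \<phi>(1) by blast
qed

lemma covering_id:
  assumes "relational_doctrine R"
  shows "covering R R (rd_id R) (\<lambda>X. X) (\<lambda>X Y f. f) (\<lambda>X Y \<alpha>. \<alpha>) (Idt R)"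
proof -
  interpret I: rd_arr R R "rd_id R" using assms by (rule rd_id_arr)
  show ?thesis by unfold_locales (simp_all add: I.R.edq_Idt)
qed

lemma covering_restrict:
  assumes "covering D S G uo ua ur u" "rd_arr E D J"
  shows "covering E S (rd_comp G J) (\<lambda>A. uo (fo J A)) (\<lambda>A B f. ua (fo J A) (fo J B) (fa J A B f))
    (\<lambda>A B \<alpha>. ur (fo J A) (fo J B) (fr J A B \<alpha>)) (\<lambda>A. u (fo J A))"
proof -
  interpret G: covering D S G uo ua ur u by fact
  interpret J: rd_arr E D J by fact
  interpret GJ: rd_arr E S "rd_comp G J"
    by (rule rd_comp_arr[OF J.arr G.G.arr])
  show ?thesis by unfold_locales (simp_all add: G.u_edq G.u_natural G.u_Rix)
qed

lemma covering_compose: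
  assumes "covering D S G uo ua ur u" "rd_arr S T F" "preserves_quotient_arrows F"
  shows "covering D T (rd_comp F G) (\<lambda>A. fo F (uo A)) (\<lambda>A B f. fa F (uo A) (uo B) (ua A B f))
    (\<lambda>A B \<alpha>. fr F (uo A) (uo B) (ur A B \<alpha>)) (\<lambda>A. fa F (uo A) (fo G A) (u A))"
proof -
  interpret G: covering D S G uo ua ur u by fact
  interpret F: rd_arr S T F by fact
  interpret FG: rd_arr D T "rd_comp F G"
    by (rule rd_comp_arr[OF G.G.arr F.arr])
  show ?thesis
  proof (unfold_locales, goal_cases)
    case (3 A) then show ?case using F.preserves_edq[OF assms(3) _ G.u_edq] by simp
  next
    case (4 A B f) then show ?case by (simp add: G.u_natural flip: F.ma_Cmp)
  next
    case (5 A B \<alpha>) then show ?case by (simp add: G.u_Rix flip: F.mr_Rix)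
  qed simp_all
qed

text \<open>A covering can be refined by covering its covering objects in turn.\<close>

lemma covering_stack:
  assumes "covering D S G vo va vr v"
    and "\<And>A. A \<in> Ob D \<Longrightarrow> uo A \<in> Ob S"
    and "\<And>A B f. \<lbrakk>A \<in> Ob D; B \<in> Ob D; f \<in> Hom D A B\<rbrakk> \<Longrightarrow> ua A B f \<in> Hom S (uo A) (uo B)"
    and "\<And>A. A \<in> Ob D \<Longrightarrow> edq S (uo A) (\<tau> A) (vo A) (w A)"
    and "\<And>A B f. \<lbrakk>A \<in> Ob D; B \<in> Ob D; f \<in> Hom D A B\<rbrakk> \<Longrightarrow>
      Cmp S (uo A) (vo A) (vo B) (va A B f) (w A) = Cmp S (uo A) (uo B) (vo B) (w B) (ua A B f)"
    and "\<And>A B \<alpha>. \<lbrakk>A \<in> Ob D; B \<in> Ob D; \<alpha> \<in> Rel D A B\<rbrakk> \<Longrightarrow>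
      Rix S (uo A) (vo A) (uo B) (vo B) (w A) (w B) (vr A B \<alpha>) = ur A B \<alpha>"
  shows "covering D S G uo ua ur (\<lambda>A. Cmp S (uo A) (vo A) (fo G A) (v A) (w A))"
proof -
  interpret G: covering D S G vo va vr v by fact
  have w [simp]: "w A \<in> Hom S (uo A) (vo A)" if "A \<in> Ob D" for A
    using G.G.S.edq_Hom[OF assms(2,4)[OF that]] .
  show ?thesis
  proof (unfold_locales, goal_cases)
    case (3 A)
    then show ?case
      using G.G.S.edq_Cmp[OF assms(2,4) G.u_edq] by (simp add: assms(6))
  next
    case (4 A B f)
    then show ?case
      by (simp add: G.G.S.Cmp_assoc G.u_natural assms(2,3))
        (simp add: assms(2,3,5) flip: G.G.S.Cmp_assoc)
  next
    case (5 A B \<alpha>)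
    then show ?case by (simp add: assms(2,6) G.u_Rix G.G.S.Rix_Cmp)
  qed (simp_all add: assms(2,3))
qed

lemma covering_cong:
  assumes "covering D S G uo ua ur u"
    and "\<And>A. A \<in> Ob D \<Longrightarrow> uo' A = uo A" "\<And>A. A \<in> Ob D \<Longrightarrow> u' A = u A"
    and "\<And>A B f. \<lbrakk>A \<in> Ob D; B \<in> Ob D; f \<in> Hom D A B\<rbrakk> \<Longrightarrow> ua' A B f = ua A B f"
    and "\<And>A B \<alpha>. \<lbrakk>A \<in> Ob D; B \<in> Ob D; \<alpha> \<in> Rel D A B\<rbrakk> \<Longrightarrow> ur' A B \<alpha> = ur A B \<alpha>"
  shows "covering D S G uo' ua' ur' u'"
proof -
  interpret G: covering D S G uo ua ur u by fact
  show ?thesis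
    by unfold_locales (simp_all add: assms(2-5) G.u_edq G.u_natural G.u_Rix)
qed

section \<open>Choices of quotients\<close>

text \<open>A candidate action \<open>a : R\<^sup>q \<rightarrow> R\<close>, with the 1-arrows out of which the pseudoalgebra laws are
  built.\<close>

locale q_action = quot_doctrine R pr + a: rd_arr "quot_compl pr R" R a
  for R :: "('o, 'a, 'r) rel_doctrine" and pr a
begin

sublocale QQ: quot_doctrine "quot_compl pr R" pr by (rule QQ)
sublocale QQQ: quot_doctrine "quot_compl pr (quot_compl pr R)" pr by (rule QQ.QQ)
sublocale Ta: rd_arr QQ.Q Q "T a"
  by (rule Tq_map_arr[OF a.arr])
sublocale TTa: rd_arr QQQ.Q QQ.Q "T (T a)"
  by (rule Tq_map_arr[OF Ta.arr])
sublocale M: rd_arr QQ.Q Q "M R"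
  by (rule Tq_mult_arr[OF doctrine])
sublocale E: rd_arr R Q "E R"
  by (rule Tq_unit_arr[OF doctrine])
sublocale MQ: rd_arr QQQ.Q QQ.Q "M Q"
  by (rule Tq_mult_arr[OF Q.doctrine])
sublocale EQ: rd_arr Q QQ.Q "E Q"
  by (rule Tq_unit_arr[OF Q.doctrine])
sublocale TM: rd_arr QQQ.Q QQ.Q "T (M R)"
  by (rule Tq_map_arr[OF M.arr])
sublocale TE: rd_arr Q QQ.Q "T (E R)"
  by (rule Tq_map_arr[OF E.arr])

end

text \<open>A functorial choice of effective descent quotients: \<open>a (X, \<rho>)\<close> is a quotient of \<open>X\<close> by
  \<open>\<rho>\<close> along \<open>p (X, \<rho>)\<close>.\<close>

locale quotient_choice = q_action R pr a +
  cov: covering "quot_compl pr R" R a "und pr" "\<lambda>A B f. f" "\<lambda>A B \<alpha>. \<alpha>" p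
  for R :: "('o, 'a, 'r) rel_doctrine" and pr a p

context quot_doctrine
begin

text \<open>On arrows, \<open>a\<close> is given by the universal property. On relations it is
  \<open>\<alpha> \<mapsto> \<Gamma>\<^sub>p\<^sup>\<bottom> ; \<alpha> ; \<Gamma>\<^bsub>p'\<^esub>\<close>, which is inverse to reindexing along the quotient arrows; since that
  reindexing is injective, most laws of a 1-arrow can be checked after applying it.\<close>

lemma quotient_choice_ex:
  assumes "has_quotients R"
  shows "\<exists>a p. quotient_choice R pr a p"
proof -
  have "\<forall>A\<in>Ob Q. \<exists>W p. edq R (u A) (e A) W p"
    using assms by (auto simp: has_quotients_def edq_def)
  then obtain W p where p: "\<And>A. A \<in> Ob Q \<Longrightarrow> edq R (u A) (e A) (W A) (p A)" by metis
  have W [simp]: "W A \<in> Ob R" and pH [simp]: "p A \<in> Hom R (u A) (W A)"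
    and pk: "Rix R (u A) (W A) (u A) (W A) (p A) (p A) (Dia R (W A)) = e A" if "A \<in> Ob Q" for A
    using edqD[OF _ p[OF that]] that by simp_all
  have "\<exists>h. h \<in> Hom R (W A) (W B) \<and>
      Cmp R (u A) (W A) (W B) h (p A) = Cmp R (u A) (u B) (W B) (p B) f"
    if "A \<in> Ob Q" "B \<in> Ob Q" "f \<in> Hom Q A B" for A B f
  proof -
    have "Leq R (u A) (u A) (e A) (Rix R (u A) (W B) (u A) (W B) (Cmp R (u A) (u B) (W B) (p B) f)
      (Cmp R (u A) (u B) (W B) (p B) f) (Dia R (W B)))"
      using that by (simp add: Rix_Cmp pk)
    then show ?thesis
      by (rule edq_factor[OF _ p[OF that(1)], rotated -2]) (use that in auto)
  qed
  then obtain h where h [simp]: "\<And>A B f. \<lbrakk>A \<in> Ob Q; B \<in> Ob Q; f \<in> Hom Q A B\<rbrakk> \<Longrightarrow> h A B f \<in> Hom R (W A) (W B)"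
    and hp: "\<And>A B f. \<lbrakk>A \<in> Ob Q; B \<in> Ob Q; f \<in> Hom Q A B\<rbrakk> \<Longrightarrow>
      Cmp R (u A) (W A) (W B) (h A B f) (p A) = Cmp R (u A) (u B) (W B) (p B) f"
    by metis
  have h_eqI: "h A B f = k" if "A \<in> Ob Q" "B \<in> Ob Q" "f \<in> Hom Q A B" "k \<in> Hom R (W A) (W B)"
    "Cmp R (u A) (W A) (W B) k (p A) = Cmp R (u A) (u B) (W B) (p B) f" for A B f k
    by (rule edq_epi[OF _ p[OF that(1)], where Z = "W B"]) (use that hp in simp_all)
  define l where "l A B \<alpha> = Rcmp R (W A) (u B) (W B) (Rcmp R (W A) (u A) (u B)
    (Conv R (u A) (W A) (graph R (u A) (W A) (p A))) \<alpha>) (graph R (u B) (W B) (p B))" for A B \<alpha>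
  have l [simp]: "l A B \<alpha> \<in> Rel R (W A) (W B)" if "A \<in> Ob Q" "B \<in> Ob Q" "\<alpha> \<in> Rel Q A B" for A B \<alpha>
    using that by (simp add: l_def)
  have pk': "Rcmp R (u A) (W A) (u A) (graph R (u A) (W A) (p A)) (Conv R (u A) (W A) (graph R (u A) (W A) (p A))) = e A"
    if "A \<in> Ob Q" for A using pk[OF that] that by (simp add: Rix_graph)
  have lp: "Rix R (u A) (W A) (u B) (W B) (p A) (p B) (l A B \<alpha>) = \<alpha>"
    if "A \<in> Ob Q" "B \<in> Ob Q" "\<alpha> \<in> Rel Q A B" for A B \<alpha>
  proof -
    have "Rix R (u A) (W A) (u B) (W B) (p A) (p B) (l A B \<alpha>) =
      Rcmp R (u A) (u B) (u B) (Rcmp R (u A) (u A) (u B)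
        (Rcmp R (u A) (W A) (u A) (graph R (u A) (W A) (p A)) (Conv R (u A) (W A) (graph R (u A) (W A) (p A)))) \<alpha>)
        (Rcmp R (u B) (W B) (u B) (graph R (u B) (W B) (p B)) (Conv R (u B) (W B) (graph R (u B) (W B) (p B))))"
      using that by (simp add: l_def Rix_graph Rcmp_assoc)
    then show ?thesis using that by (simp add: pk')
  qed
  have l_eqI: "l A B \<alpha> = \<beta>" if "A \<in> Ob Q" "B \<in> Ob Q" "\<alpha> \<in> Rel Q A B" "\<beta> \<in> Rel R (W A) (W B)"
    "Rix R (u A) (W A) (u B) (W B) (p A) (p B) \<beta> = \<alpha>" for A B \<alpha> \<beta>
    by (rule edq_Rix_inj[OF _ p[OF that(1)] _ p[OF that(2)]]) (use that lp in simp_all)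
  let ?a = "\<lparr>dsrc = Q, dtrg = R, fo = (\<lambda>A\<in>Ob Q. W A), fa = (\<lambda>A\<in>Ob Q. \<lambda>B\<in>Ob Q. \<lambda>f\<in>Hom Q A B. h A B f),
    fr = (\<lambda>A\<in>Ob Q. \<lambda>B\<in>Ob Q. \<lambda>\<alpha>\<in>Rel Q A B. l A B \<alpha>)\<rparr>"
  interpret a: rd_arr Q R ?a
  proof (unfold_locales, goal_cases)
    case (4 A)
    then show ?case using Q.Idt_Hom[of A] by (simp add: h_eqI)
  next
    case (5 A B C f g)
    then have "h A C (Cmp R (u A) (u B) (u C) g f) = Cmp R (W A) (W B) (W C) (h B C g) (h A B f)"
      using Q.Cmp_Hom[of A B C f g]
      by (intro h_eqI) (simp_all add: hp flip: Cmp_assoc, simp add: hp Cmp_assoc)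
    then show ?case using 5 Q.Cmp_Hom[of A B C f g] by simp
  next
    case (6 A B \<alpha> \<beta>)
    then show ?case unfolding l_def by (simp add: l_def Rcmp_mono1 Rcmp_mono2)
  next
    case (7 A B A' B' f g \<alpha>)
    then have "l A B (Rix R (u A) (u A') (u B) (u B') f g \<alpha>) =
        Rix R (W A) (W A') (W B) (W B') (h A A' f) (h B B' g) (l A' B' \<alpha>)"
      using Q.Rix_Rel[of A B A' B' f g \<alpha>]
      by (intro l_eqI) (simp_all add: hp flip: Rix_Cmp, simp add: Rix_Cmp lp)
    then show ?case using 7 Q.Rix_Rel[of A B A' B' f g \<alpha>] by simp
  next
    case (8 A)
    then show ?case using Q.Dia_Rel[of A] by (simp add: l_eqI pk)
  next
    case (9 A B C \<alpha> \<beta>)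
    let ?P = "graph R (u B) (W B) (p B)"
    have "Rcmp R (W A) (W B) (W C) (l A B \<alpha>) (l B C \<beta>) =
      Rcmp R (W A) (u C) (W C) (Rcmp R (W A) (u A) (u C) (Conv R (u A) (W A) (graph R (u A) (W A) (p A)))
        (Rcmp R (u A) (u B) (u C) (Rcmp R (u A) (u B) (u B) \<alpha> (Rcmp R (u B) (W B) (u B) ?P (Conv R (u B) (W B) ?P))) \<beta>))
        (graph R (u C) (W C) (p C))"
      using 9 by (simp add: l_def Rcmp_assoc)
    also have "\<dots> = l A C (Rcmp R (u A) (u B) (u C) \<alpha> \<beta>)"
      using 9 by (simp add: pk' l_def)
    finally show ?case using 9 Q.Rcmp_Rel[of A B C \<alpha> \<beta>] by simp
  next
    case (10 A B \<alpha>)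
    then show ?case using Q.Conv_Rel[of A B \<alpha>] by (simp add: l_eqI lp flip: Rix_Conv)
  qed simp_all
  have "quotient_choice R pr ?a p"
    by unfold_locales (simp_all add: p hp lp)
  then show ?thesis by blast
qed

end

context quotient_choice
begin

lemma has_quotients: "has_quotients R"
  unfolding has_quotients_def
proof (intro ballI allI impI)
  fix X \<rho> assume "X \<in> Ob R" "equiv_rel R X \<rho>"
  then show "\<exists>W q. quotient_arrow R X \<rho> W q \<and> effective R X \<rho> W q \<and> descent R X W q"
    using cov.u_edq[of "pr (X, \<rho>)"] by (auto simp: edq_def)
qed

text \<open>Besides the identity, the 1-arrows between which the structure of a pseudoalgebra runs are
  \<open>a \<circ> E\<close>, \<open>a \<circ> M\<close> and \<open>a \<circ> T a\<close>. All three send an object to a quotient of its underlying object. For \<open>a \<circ> T a\<close> the quotient is taken in two steps.\<close>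

lemma unit_covering:
  "covering R R (rd_comp a (E R)) (\<lambda>X. X) (\<lambda>X Y f. f) (\<lambda>X Y \<alpha>. \<alpha>) (\<lambda>X. p (pr (X, Dia R X)))"
  by (rule covering_cong[OF covering_restrict[OF cov.covering_axioms E.arr]]) simp_all

lemma mult_covering:
  "covering (quot_compl pr (quot_compl pr R)) R (rd_comp a (M R)) (\<lambda>A. und pr (und pr A))
    (\<lambda>A B f. f) (\<lambda>A B \<alpha>. \<alpha>) (\<lambda>A. p (fo (M R) A))"
  by (rule covering_cong[OF covering_restrict[OF cov.covering_axioms M.arr]]) simp_all

abbreviation "pp A \<equiv> Cmp R (und pr (und pr A)) (fo a (und pr A)) (fo a (fo (T a) A))
  (p (fo (T a) A)) (p (und pr A))"

lemma act_covering:
  "covering (quot_compl pr (quot_compl pr R)) R (rd_comp a (T a)) (\<lambda>A. und pr (und pr A))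
    (\<lambda>A B f. f) (\<lambda>A B \<alpha>. \<alpha>) pp"
proof -
  have 1: "covering QQ.Q R (rd_comp a (T a)) (\<lambda>A. fo a (und pr A))
      (\<lambda>A B f. fa a (und pr A) (und pr B) f) (\<lambda>A B \<alpha>. fr a (und pr A) (und pr B) \<alpha>)
      (\<lambda>A. p (fo (T a) A))"
    by (rule covering_cong[OF covering_restrict[OF cov.covering_axioms Ta.arr]]) simp_all
  show ?thesis
    by (rule covering_cong[OF covering_stack[OF 1, where \<tau> = "\<lambda>A. erel pr (und pr A)"
          and uo = "\<lambda>A. und pr (und pr A)" and ua = "\<lambda>A B f. f" and ur = "\<lambda>A B \<alpha>. \<alpha>" and w = "\<lambda>A. p (und pr A)"]])
     (use cov.u_edq in \<open>simp_all add: cov.u_natural cov.u_Rix\<close>)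
qed

end

section \<open>Pseudoalgebras\<close>

context q_action
begin

text \<open>The equations between composite 1-arrows that make the pseudoalgebra laws well-typed.\<close>

lemma unit_laws:
  "rd_comp (M R) (T (E R)) = rd_id (quot_compl pr R)"
  "rd_comp (M R) (E (quot_compl pr R)) = rd_id (quot_compl pr R)"
proof -
  show "rd_comp (M R) (T (E R)) = rd_id Q"
  proof (rule rd_arr_eqI[OF rd_comp_arr[OF TE.arr M.arr]
        rd_id_arr[OF Q.doctrine]], goal_cases)
    case (1 A) then show ?case using TE.fo_Ob[of A] by simp
  next
    case (2 A B f) then show ?case using TE.fo_Ob[of A] TE.fo_Ob[of B] TE.fa_Hom[of A B f] by simp
  next
    case (3 A B \<alpha>) then show ?case using TE.fo_Ob[of A] TE.fo_Ob[of B] TE.fr_Rel[of A B \<alpha>] by simp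
  qed
  show "rd_comp (M R) (E Q) = rd_id Q"
  proof (rule rd_arr_eqI[OF rd_comp_arr[OF EQ.arr M.arr]
        rd_id_arr[OF Q.doctrine]], goal_cases)
    case (1 A) then show ?case using EQ.fo_Ob[of A] by simp
  next
    case (2 A B f) then show ?case using EQ.fo_Ob[of A] EQ.fo_Ob[of B] EQ.fa_Hom[of A B f] by simp
  next
    case (3 A B \<alpha>) then show ?case using EQ.fo_Ob[of A] EQ.fo_Ob[of B] EQ.fr_Rel[of A B \<alpha>] by simp
  qed
qed

lemma mult_law:
  "rd_comp (M R) (T (M R)) = rd_comp (M R) (M (quot_compl pr R))"
proof (rule rd_arr_eqI[OF rd_comp_arr[OF TM.arr M.arr]
      rd_comp_arr[OF MQ.arr M.arr]], goal_cases)
  case (1 A) then show ?case using TM.fo_Ob[of A] MQ.fo_Ob[of A] by simp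
next
  case (2 A B f)
  then show ?case using TM.fo_Ob[of A] TM.fo_Ob[of B] TM.fa_Hom[of A B f]
    MQ.fo_Ob[of A] MQ.fo_Ob[of B] MQ.fa_Hom[of A B f] by simp
next
  case (3 A B \<alpha>)
  then show ?case using TM.fo_Ob[of A] TM.fo_Ob[of B] TM.fr_Rel[of A B \<alpha>]
    MQ.fo_Ob[of A] MQ.fo_Ob[of B] MQ.fr_Rel[of A B \<alpha>] by simp
qed

lemma boundary_eqs:
  "rd_comp a (T (rd_id R)) = a" "rd_comp (rd_id R) a = a"
  "rd_comp (rd_comp a (T a)) (T (E R)) = rd_comp a (T (rd_comp a (E R)))"
  "rd_comp (rd_comp a (M R)) (T (E R)) = a"
  "rd_comp (rd_comp a (T a)) (E Q) = rd_comp (rd_comp a (E R)) a"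
  "rd_comp (rd_comp a (M R)) (E Q) = a"
  "rd_comp (rd_comp a (M R)) (T (T a)) = rd_comp (rd_comp a (T a)) (M Q)"
  "rd_comp a (T (rd_comp a (T a))) = rd_comp (rd_comp a (T a)) (T (T a))"
  "rd_comp a (T (rd_comp a (M R))) = rd_comp (rd_comp a (T a)) (T (M R))"
  "rd_comp (rd_comp a (M R)) (T (M R)) = rd_comp (rd_comp a (M R)) (M Q)"
  using Tq_map_id[OF doctrine] rd_comp_id[OF a.arr] unit_laws mult_law
    Tq_map_comp[OF E.arr a.arr] Tq_map_comp[OF Ta.arr a.arr]
    Tq_map_comp[OF M.arr a.arr]
    Tq_unit_natural[OF a.arr] Tq_mult_natural[OF a.arr]
    rd_comp_assoc[OF TE.arr Ta.arr a.arr]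
    rd_comp_assoc[OF TE.arr M.arr a.arr]
    rd_comp_assoc[OF EQ.arr Ta.arr a.arr]
    rd_comp_assoc[OF EQ.arr M.arr a.arr]
    rd_comp_assoc[OF a.arr E.arr a.arr]
    rd_comp_assoc[OF TTa.arr M.arr a.arr]
    rd_comp_assoc[OF TTa.arr Ta.arr a.arr]
    rd_comp_assoc[OF MQ.arr Ta.arr a.arr]
    rd_comp_assoc[OF MQ.arr M.arr a.arr]
    rd_comp_assoc[OF TM.arr Ta.arr a.arr]
    rd_comp_assoc[OF TM.arr M.arr a.arr]
  by simp_all

end

text \<open>The data of a pseudoalgebra, without invertibility and the coherence laws.\<close>

locale ps_data = q_action R pr a +
  \<iota>: rd_cel R R "rd_id R" "rd_comp a (Tq_unit pr R)" \<iota> +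
  \<kappa>: rd_cel "quot_compl pr (quot_compl pr R)" R "rd_comp a (Tq_map pr a)" "rd_comp a (Tq_mult pr R)" \<kappa>
  for R :: "('o, 'a, 'r) rel_doctrine" and pr a \<iota> \<kappa>
begin

sublocale T\<iota>: rd_cel "quot_compl pr R" "quot_compl pr R" "T (rd_id R)"
    "T (rd_comp a (E R))" "Tq_cell pr \<iota>"
  by (rule Tq_cell_cel[OF \<iota>.cel])
sublocale T\<kappa>: rd_cel "quot_compl pr (quot_compl pr (quot_compl pr R))" "quot_compl pr R"
    "T (rd_comp a (T a))" "T (rd_comp a (M R))" "Tq_cell pr \<kappa>"
  by (rule Tq_cell_cel[OF \<kappa>.cel])

abbreviation "unit1 \<equiv> rd_vcomp (rd_hcomp \<kappa> (rd_id2 (T (E R)))) (rd_hcomp (rd_id2 a) (Tq_cell pr \<iota>))"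
abbreviation "unit2 \<equiv> rd_vcomp (rd_hcomp \<kappa> (rd_id2 (E Q))) (rd_hcomp \<iota> (rd_id2 a))"
abbreviation "assoc1 \<equiv> rd_vcomp (rd_hcomp \<kappa> (rd_id2 (M Q))) (rd_hcomp \<kappa> (rd_id2 (T (T a))))"
abbreviation "assoc2 \<equiv> rd_vcomp (rd_hcomp \<kappa> (rd_id2 (T (M R)))) (rd_hcomp (rd_id2 a) (Tq_cell pr \<kappa>))"

lemma law_cells:
  "rd_cel Q R a a unit1" "rd_cel Q R a a unit2"
  "rd_cel QQQ.Q R (rd_comp (rd_comp a (T a)) (T (T a)))
     (rd_comp (rd_comp a (M R)) (M Q)) assoc1"
  "rd_cel QQQ.Q R (rd_comp (rd_comp a (T a)) (T (T a)))
     (rd_comp (rd_comp a (M R)) (M Q)) assoc2"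
proof -
  note k = \<kappa>.cel
  show "rd_cel Q R a a unit1"
    by (rule rd_vcomp_cel[OF rd_hcomp_cel[OF T\<iota>.cel rd_id2_cel[OF a.arr], unfolded boundary_eqs(1)]
          rd_hcomp_cel[OF rd_id2_cel[OF TE.arr] k, unfolded boundary_eqs(3,4)]])
  show "rd_cel Q R a a unit2"
    by (rule rd_vcomp_cel[OF rd_hcomp_cel[OF rd_id2_cel[OF a.arr] \<iota>.cel, unfolded boundary_eqs]
          rd_hcomp_cel[OF rd_id2_cel[OF EQ.arr] k, unfolded boundary_eqs]])
  show "rd_cel QQQ.Q R (rd_comp (rd_comp a (T a)) (T (T a)))
     (rd_comp (rd_comp a (M R)) (M Q)) assoc1"
    by (rule rd_vcomp_cel[OF rd_hcomp_cel[OF rd_id2_cel[OF TTa.arr] k, unfolded boundary_eqs]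
          rd_hcomp_cel[OF rd_id2_cel[OF MQ.arr] k]])
  show "rd_cel QQQ.Q R (rd_comp (rd_comp a (T a)) (T (T a)))
     (rd_comp (rd_comp a (M R)) (M Q)) assoc2"
    by (rule rd_vcomp_cel[OF rd_hcomp_cel[OF T\<kappa>.cel rd_id2_cel[OF a.arr], unfolded boundary_eqs]
          rd_hcomp_cel[OF rd_id2_cel[OF TM.arr] k, unfolded boundary_eqs]])
qed

lemma unit_objects:
  assumes "A \<in> Ob Q"
  shows "fo (M R) (fo (T (E R)) A) = A" "fo (M R) (fo (E Q) A) = A"
    "fo (T a) (fo (E Q) A) = fo (E R) (fo a A)"
  using arg_cong[OF unit_laws(1), of "\<lambda>F. fo F A"] arg_cong[OF unit_laws(2), of "\<lambda>F. fo F A"]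
    arg_cong[OF Tq_unit_natural[OF a.arr], of "\<lambda>F. fo F A"] assms
  by (simp_all del: Tq_map_simps(3-) Tq_mult_simps(3-) Tq_unit_simps(3-))

lemma mult_object:
  "A \<in> Ob QQQ.Q \<Longrightarrow> fo (M R) (fo (T (M R)) A) = fo (M R) (fo (M Q) A)"
  using arg_cong[OF mult_law, of "\<lambda>F. fo F A"] by (simp del: Tq_map_simps(3-) Tq_mult_simps(3-))

lemma unit_components:
  assumes "A \<in> Ob Q"
  shows "cpt unit1 A = Cmp R (fo a A) (fo a (fo (T a) (fo (T (E R)) A))) (fo a A)
      (cpt \<kappa> (fo (T (E R)) A)) (fa a A (fo (T a) (fo (T (E R)) A)) (cpt \<iota> (und pr A)))"
    and "cpt unit2 A = Cmp R (fo a A) (fo a (fo (E R) (fo a A))) (fo a A)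
      (cpt \<kappa> (fo (E Q) A)) (cpt \<iota> (fo a A))"
  using assms cpt_whisker_right[OF \<kappa>.cel TE.arr assms] cpt_whisker_left[OF a.arr T\<iota>.cel assms]
    cpt_whisker_right[OF \<kappa>.cel EQ.arr assms] cpt_whisker_right[OF \<iota>.cel a.arr assms]
  by (simp_all add: unit_objects Tq_map_id[OF doctrine] Tq_map_comp[OF E.arr a.arr]
      del: Tq_map_simps(3-) Tq_mult_simps(3-) Tq_unit_simps(3-) rd_hcomp_simps(3))

lemma assoc_components:
  assumes "A \<in> Ob QQQ.Q"
  shows "cpt assoc1 A = Cmp R (fo a (fo (T a) (fo (T (T a)) A)))
      (fo a (fo (M R) (fo (T (T a)) A))) (fo a (fo (M R) (fo (M Q) A)))
      (cpt \<kappa> (fo (M Q) A)) (cpt \<kappa> (fo (T (T a)) A))"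
    and "cpt assoc2 A = Cmp R (fo a (fo (T a) (fo (T (T a)) A)))
      (fo a (fo (T a) (fo (T (M R)) A))) (fo a (fo (M R) (fo (M Q) A))) (cpt \<kappa> (fo (T (M R)) A))
      (fa a (fo (T a) (fo (T (T a)) A)) (fo (T a) (fo (T (M R)) A)) (cpt \<kappa> (und pr A)))"
  using assms cpt_whisker_right[OF \<kappa>.cel TTa.arr assms] cpt_whisker_right[OF \<kappa>.cel MQ.arr assms]
    cpt_whisker_right[OF \<kappa>.cel TM.arr assms] cpt_whisker_left[OF a.arr T\<kappa>.cel assms]
  by (simp_all add: mult_object Tq_map_comp[OF Ta.arr a.arr] Tq_map_comp[OF M.arr a.arr]
      del: Tq_map_simps(3-) Tq_mult_simps(3-) Tq_unit_simps(3-) rd_hcomp_simps(3))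

end

section \<open>Choices of quotients are pseudoalgebras\<close>

lemma (in pairing) pseudoalgebra_iff:
  "pseudoalgebra RD (Tq pr) \<A> \<longleftrightarrow>
    ps_data (carr \<A>) pr (act \<A>) (iota \<A>) (kappa \<A>) \<and> iso2 RD (iota \<A>) \<and> iso2 RD (kappa \<A>) \<and>
    rd_vcomp (rd_hcomp (kappa \<A>) (rd_id2 (M (quot_compl pr (carr \<A>)))))
        (rd_hcomp (kappa \<A>) (rd_id2 (T (T (act \<A>))))) =
      rd_vcomp (rd_hcomp (kappa \<A>) (rd_id2 (T (M (carr \<A>)))))
        (rd_hcomp (rd_id2 (act \<A>)) (Tq_cell pr (kappa \<A>))) \<and>
    rd_vcomp (rd_hcomp (kappa \<A>) (rd_id2 (T (E (carr \<A>)))))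
        (rd_hcomp (rd_id2 (act \<A>)) (Tq_cell pr (iota \<A>))) = rd_id2 (act \<A>) \<and>
    rd_vcomp (rd_hcomp (kappa \<A>) (rd_id2 (E (quot_compl pr (carr \<A>)))))
        (rd_hcomp (iota \<A>) (rd_id2 (act \<A>))) = rd_id2 (act \<A>)"
proof -
  have "ps_data R pr a \<iota> \<kappa> \<longleftrightarrow> relational_doctrine R \<and> rd_arr (quot_compl pr R) R a \<and>
    \<iota> \<in> two RD (rd_id R) (rd_comp a (E R)) \<and>
    \<kappa> \<in> two RD (rd_comp a (T a)) (rd_comp a (M R))" for R a \<iota> \<kappa>
    using two_RD[OF rd_id_arr] two_RD[OF rd_comp_arr[OF Tq_map_arr, of _ R a R a]]
    by (auto simp: ps_data_def q_action_def quot_doctrine_def pairing_axioms)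
  then show ?thesis
    by (auto simp: pseudoalgebra_def Let_def Tq_def)
qed

text \<open>A choice of quotients together with the comparisons that it determines.\<close>

locale choice_data = quotient_choice R pr a p + ps_data R pr a \<iota> \<kappa>
  for R :: "('o, 'a, 'r) rel_doctrine" and pr a p \<iota> \<kappa> +
  assumes iota_p: "X \<in> Ob R \<Longrightarrow> cpt \<iota> X = p (fo (E R) X)"
    and kappa_pp: "A \<in> Ob (quot_compl pr (quot_compl pr R)) \<Longrightarrow>
      Cmp R (und pr (und pr A)) (fo a (fo (T a) A)) (fo a (fo (M R) A))
        (cpt \<kappa> A) (pp A) = p (fo (M R) A)"

lemma (in quotient_choice) choice_data_ex: "\<exists>\<iota> \<kappa>. choice_data R pr a p \<iota> \<kappa>"
proof -
  obtain \<iota> where \<iota>: "rd_cel R R (rd_id R) (rd_comp a (E R)) \<iota>"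
    "\<And>X. X \<in> Ob R \<Longrightarrow> Cmp R X (fo (rd_id R) X) (fo (rd_comp a (E R)) X) (cpt \<iota> X) (Idt R X) =
       p (pr (X, Dia R X))"
    using covering_comparison[OF covering_id[OF doctrine] unit_covering] by metis
  obtain \<kappa> where \<kappa>: "rd_cel QQ.Q R (rd_comp a (T a)) (rd_comp a (M R)) \<kappa>"
    "\<And>A. A \<in> Ob QQ.Q \<Longrightarrow> Cmp R (und pr (und pr A)) (fo (rd_comp a (T a)) A)
       (fo (rd_comp a (M R)) A) (cpt \<kappa> A) (pp A) = p (fo (M R) A)"
    using covering_comparison[OF act_covering mult_covering] by metis
  interpret \<iota>: rd_cel R R "rd_id R" "rd_comp a (E R)" \<iota> by fact
  interpret \<kappa>: rd_cel QQ.Q R "rd_comp a (T a)" "rd_comp a (M R)" \<kappa> by fact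
  have "choice_data R pr a p \<iota> \<kappa>"
  proof (unfold_locales, goal_cases)
    case (1 X) then show ?case using \<iota>(2)[of X] \<iota>.cpt_Hom[of X] by simp
  next
    case (2 A) then show ?case using \<kappa>(2)[of A] by simp
  qed
  then show ?thesis by blast
qed

context choice_data
begin

lemma iota_iso: "iso2 RD \<iota>"
  by (rule covering_comparison_iso[OF covering_id[OF doctrine] unit_covering \<iota>.cel])
    (use \<iota>.cpt_Hom in \<open>simp add: iota_p\<close>)

lemma kappa_iso: "iso2 RD \<kappa>"
  by (rule covering_comparison_iso[OF act_covering mult_covering \<kappa>.cel])
    (use kappa_pp in simp)

lemma p_natural:
  "\<lbrakk>A \<in> Ob Q; B \<in> Ob Q; f \<in> Hom Q A B\<rbrakk> \<Longrightarrow>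
    Cmp R (u A) (fo a A) (fo a B) (fa a A B f) (p A) = Cmp R (u A) (u B) (fo a B) (p B) f"
  by (rule cov.u_natural)

text \<open>All pseudoalgebra laws compare 2-arrows out of covered 1-arrows, so they may be checked after
  composing with the coverings, where they say that iterated quotients are quotients.\<close>

lemma unit1: "unit1 = rd_id2 a"
proof (rule cov.cel_eqI[OF law_cells(1) rd_id2_cel[OF a.arr]])
  fix A assume A: "A \<in> Ob Q"
  let ?A = "fo (T (E R)) A"
  let ?B = "fo (T a) ?A"
  have B: "?A \<in> Ob QQ.Q" "?B \<in> Ob Q" using A by (simp_all del: Tq_map_simps(3-))
  have i: "cpt \<iota> (u A) \<in> Hom Q A ?B" and uA: "und pr ?A = fo (E R) (u A)" "und pr ?B = fo a (und pr ?A)"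
    and M: "fo (M R) ?A = A"
    using T\<iota>.cpt_Hom[OF A] A B E.fr_Rel[of "u A" "u A" "e A"] by simp_all
  have uuA: "und pr (fo (E R) (u A)) = u A" using A by simp
  note [simp del] = Tq_map_simps(3-) Tq_mult_simps(3-) Tq_unit_simps(3-)
  have k: "cpt \<kappa> ?A \<in> Hom R (fo a ?B) (fo a A)" using \<kappa>.cpt_Hom[OF B(1)] B by (simp add: M)
  have "Cmp R (u A) (fo a A) (fo a A) (cpt unit1 A) (p A) =
    Cmp R (u A) (fo a ?B) (fo a A) (cpt \<kappa> ?A) (Cmp R (u A) (fo a A) (fo a ?B) (fa a A ?B (cpt \<iota> (u A))) (p A))"
    unfolding unit_components(1)[OF A] using A B i k by (simp add: Cmp_assoc)
  also have "\<dots> = Cmp R (u A) (fo a ?B) (fo a A) (cpt \<kappa> ?A) (Cmp R (u A) (u ?B) (fo a ?B) (p ?B) (cpt \<iota> (u A)))"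
    using p_natural[OF A B(2) i] by simp
  also have "\<dots> = p A"
    using kappa_pp[OF B(1)] A by (simp add: M uuA uA iota_p)
  finally show "Cmp R (u A) (fo a A) (fo a A) (cpt unit1 A) (p A) =
     Cmp R (u A) (fo a A) (fo a A) (cpt (rd_id2 a) A) (p A)" using A by simp
qed

lemma unit2: "unit2 = rd_id2 a"
proof (rule cov.cel_eqI[OF law_cells(2) rd_id2_cel[OF a.arr]])
  fix A assume A: "A \<in> Ob Q"
  let ?A = "fo (E Q) A"
  let ?B = "fo (T a) ?A"
  have B: "?A \<in> Ob QQ.Q" "?B \<in> Ob Q" using A by (simp_all del: Tq_map_simps(3-) Tq_unit_simps(3-))
  have uA: "und pr ?A = A" "?B = fo (E R) (fo a A)" "fo (M R) ?A = A"
    using A B a.mr_Dia[OF A] by simp_all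
  note [simp del] = Tq_map_simps(3-) Tq_mult_simps(3-) Tq_unit_simps(3-)
  have k: "cpt \<kappa> ?A \<in> Hom R (fo a ?B) (fo a A)" using \<kappa>.cpt_Hom[OF B(1)] B by (simp add: uA)
  have i: "cpt \<iota> (fo a A) \<in> Hom R (fo a A) (fo a ?B)" using \<iota>.cpt_Hom[of "fo a A"] A by (simp add: uA)
  have "Cmp R (u A) (fo a A) (fo a A) (cpt unit2 A) (p A) =
    Cmp R (u A) (fo a ?B) (fo a A) (cpt \<kappa> ?A) (Cmp R (u A) (fo a A) (fo a ?B) (cpt \<iota> (fo a A)) (p A))"
    unfolding unit_components(2)[OF A] using A B i k by (simp add: uA Cmp_assoc)
  also have "\<dots> = p A"
    using kappa_pp[OF B(1)] A by (simp add: uA iota_p)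
  finally show "Cmp R (u A) (fo a A) (fo a A) (cpt unit2 A) (p A) =
     Cmp R (u A) (fo a A) (fo a A) (cpt (rd_id2 a) A) (p A)" using A by simp
qed

lemma triple_covering:
  "covering QQQ.Q R (rd_comp (rd_comp a (T a)) (T (T a)))
    (\<lambda>A. u (u (u A))) (\<lambda>A B f. f) (\<lambda>A B \<alpha>. \<alpha>)
    (\<lambda>A. Cmp R (u (u (u A))) (fo a (u (u A))) (fo (rd_comp (rd_comp a (T a)) (T (T a))) A)
       (pp (fo (T (T a)) A)) (p (u (u A))))"
proof -
  have 1: "covering QQQ.Q R (rd_comp (rd_comp a (T a)) (T (T a)))
    (\<lambda>A. fo a (u (u A))) (\<lambda>A B f. fa a (u (u A)) (u (u B)) f) (\<lambda>A B \<alpha>. fr a (u (u A)) (u (u B)) \<alpha>)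
    (\<lambda>A. pp (fo (T (T a)) A))"
    by (rule covering_cong[OF covering_restrict[OF act_covering TTa.arr]]) simp_all
  show ?thesis
    by (rule covering_stack[OF 1, where \<tau> = "\<lambda>A. e (u (u A))"])
     (use cov.u_edq in \<open>simp_all add: cov.u_natural cov.u_Rix\<close>)
qed

lemma assoc: "assoc1 = assoc2"
proof (rule covering.cel_eqI[OF triple_covering law_cells(3,4)], goal_cases)
  case A: (1 A)
  let ?X = "u (u (u A))" and ?A1 = "u (u A)" and ?W1 = "fo a (u (u A))"
  let ?T = "fo (T (T a)) A" and ?M = "fo (M Q) A" and ?N = "fo (T (M R)) A"
  let ?MM = "fo (M R) ?M"
  let ?W3 = "fo a (fo (T a) ?T)"
  have B: "?T \<in> Ob QQ.Q" "?M \<in> Ob QQ.Q" "?N \<in> Ob QQ.Q"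
    using A by (simp_all del: Tq_map_simps(3-) Tq_mult_simps(3-))
  have B': "u A \<in> Ob QQ.Q" "fo (M R) (u A) \<in> Ob Q" "fo (T a) (u A) \<in> Ob Q"
    using A by (simp_all del: Tq_map_simps(3-) Tq_mult_simps(3-))
  have e1: "und pr ?T = fo (T a) (u A)" "und pr (fo (T a) (u A)) = ?W1"
    "und pr ?M = ?A1" "fo (T a) ?M = fo (M R) ?T" "fo (M R) ?N = ?MM"
    "und pr ?N = fo (M R) (u A)" "und pr (fo (M R) (u A)) = ?X"
    "und pr (fo (T a) ?T) = fo a (fo (T a) (u A))"
    "und pr (fo (T a) ?N) = fo a (fo (M R) (u A))"
    using A B B' by simp_all
  have kH: "cpt \<kappa> (u A) \<in> Hom Q (fo (T a) ?T) (fo (T a) ?N)"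
    using T\<kappa>.cpt_Hom[OF A] A B B' by simp
  note [simp del] = Tq_map_simps(3-) Tq_mult_simps(3-) Tq_unit_simps(3-)
  let ?W2 = "fo a (fo (T a) (u A))" and ?V = "fo a (fo (M R) (u A))"
  let ?TM = "fo a (fo (M R) ?T)" and ?TN = "fo a (fo (T a) ?N)"
  have H [simp]: "p ?A1 \<in> Hom R ?X ?W1" "p (fo (T a) (u A)) \<in> Hom R ?W1 ?W2"
    "p (fo (T a) ?T) \<in> Hom R ?W2 ?W3" "p (fo (T a) ?N) \<in> Hom R ?V ?TN"
    "cpt \<kappa> ?T \<in> Hom R ?W3 ?TM" "cpt \<kappa> ?M \<in> Hom R ?TM (fo a ?MM)"
    "cpt \<kappa> ?N \<in> Hom R ?TN (fo a ?MM)" "cpt \<kappa> (u A) \<in> Hom R ?W2 ?V"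
    "fa a (fo (T a) ?T) (fo (T a) ?N) (cpt \<kappa> (u A)) \<in> Hom R ?W3 ?TN"
    using A B B' kH cov.u_Hom[of ?A1] cov.u_Hom[of "fo (T a) (u A)"]
      cov.u_Hom[of "fo (T a) ?T"] cov.u_Hom[of "fo (T a) ?N"]
      \<kappa>.cpt_Hom[OF B(1)] \<kappa>.cpt_Hom[OF B(2)] \<kappa>.cpt_Hom[OF B(3)] \<kappa>.cpt_Hom[OF B'(1)]
    by (simp_all add: e1)
  have Ob [simp]: "?X \<in> Ob R" "?W1 \<in> Ob R" "?W2 \<in> Ob R" "?W3 \<in> Ob R" "?V \<in> Ob R" "?TM \<in> Ob R"
    "?TN \<in> Ob R" "fo a ?MM \<in> Ob R"
    using A B B' by simp_all
  define p1 p2 p3 where pdefs: "p1 = p ?A1" "p2 = p (fo (T a) (u A))" "p3 = p (fo (T a) ?T)"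
  have [simp]: "p1 \<in> Hom R ?X ?W1" "p2 \<in> Hom R ?W1 ?W2" "p3 \<in> Hom R ?W2 ?W3"
    by (simp_all add: pdefs)
  have kT: "Cmp R ?W1 ?W3 ?TM (cpt \<kappa> ?T) (Cmp R ?W1 ?W2 ?W3 p3 p2) = p (fo (M R) ?T)"
    using kappa_pp[OF B(1)] by (simp add: e1 pdefs)
  have kM: "Cmp R ?X ?TM (fo a ?MM) (cpt \<kappa> ?M) (Cmp R ?X ?W1 ?TM (p (fo (M R) ?T)) p1) = p ?MM"
    using kappa_pp[OF B(2)] by (simp add: e1 pdefs)
  have kN: "Cmp R ?X ?TN (fo a ?MM) (cpt \<kappa> ?N)
      (Cmp R ?X ?V ?TN (p (fo (T a) ?N)) (p (fo (M R) (u A)))) = p ?MM"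
    using kappa_pp[OF B(3)] by (simp add: e1)
  have kA: "Cmp R ?X ?W2 ?V (cpt \<kappa> (u A)) (Cmp R ?X ?W1 ?W2 p2 p1) = p (fo (M R) (u A))"
    using kappa_pp[OF B'(1)] by (simp add: e1 pdefs)
  have nat: "Cmp R ?W2 ?W3 ?TN (fa a (fo (T a) ?T) (fo (T a) ?N) (cpt \<kappa> (u A))) p3 =
      Cmp R ?W2 ?V ?TN (p (fo (T a) ?N)) (cpt \<kappa> (u A))"
    using p_natural[OF _ _ kH] B by (simp add: e1 pdefs)
  have "Cmp R ?X ?W3 (fo a ?MM) (cpt assoc1 A) (Cmp R ?X ?W1 ?W3 (Cmp R ?W1 ?W2 ?W3 p3 p2) p1) =
    Cmp R ?X ?TM (fo a ?MM) (cpt \<kappa> ?M) (Cmp R ?X ?W1 ?TM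
      (Cmp R ?W1 ?W3 ?TM (cpt \<kappa> ?T) (Cmp R ?W1 ?W2 ?W3 p3 p2)) p1)"
    unfolding assoc_components(1)[OF A] by (simp add: Cmp_assoc)
  also have "\<dots> = p ?MM" unfolding kT kM ..
  also have "\<dots> = Cmp R ?X ?TN (fo a ?MM) (cpt \<kappa> ?N) (Cmp R ?X ?V ?TN (p (fo (T a) ?N))
      (Cmp R ?X ?W2 ?V (cpt \<kappa> (u A)) (Cmp R ?X ?W1 ?W2 p2 p1)))"
    unfolding kA kN ..
  also have "\<dots> = Cmp R ?X ?TN (fo a ?MM) (cpt \<kappa> ?N) (Cmp R ?X ?W2 ?TN
      (Cmp R ?W2 ?W3 ?TN (fa a (fo (T a) ?T) (fo (T a) ?N) (cpt \<kappa> (u A))) p3)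
      (Cmp R ?X ?W1 ?W2 p2 p1))"
    unfolding nat by (simp add: Cmp_assoc)
  also have "\<dots> = Cmp R ?X ?W3 (fo a ?MM) (cpt assoc2 A) (Cmp R ?X ?W1 ?W3 (Cmp R ?W1 ?W2 ?W3 p3 p2) p1)"
    unfolding assoc_components(2)[OF A] by (simp add: Cmp_assoc)
  finally show ?case
    using A B by (simp add: e1 pdefs)
qed

lemma pseudoalgebra: "pseudoalgebra RD (Tq pr) \<lparr>carr = R, act = a, iota = \<iota>, kappa = \<kappa>\<rparr>"
  using ps_data_axioms iota_iso kappa_iso unit1 unit2 assoc by (simp add: pseudoalgebra_iff)

end

section \<open>Pseudoalgebras are choices of quotients\<close>

locale ps_algebra = ps_data R pr a \<iota> \<kappa>
  for R :: "('o, 'a, 'r) rel_doctrine" and pr a \<iota> \<kappa> +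
  assumes iso_iota: "iso2 RD \<iota>" and iso_kappa: "iso2 RD \<kappa>"
    and unit1: "rd_vcomp (rd_hcomp \<kappa> (rd_id2 (T (E R)))) (rd_hcomp (rd_id2 a) (Tq_cell pr \<iota>)) = rd_id2 a"
    and unit2: "rd_vcomp (rd_hcomp \<kappa> (rd_id2 (E (quot_compl pr R)))) (rd_hcomp \<iota> (rd_id2 a)) = rd_id2 a"
begin

abbreviation "dis A \<equiv> fo (E R) (u A)"

text \<open>The identity of \<open>X\<close> is an arrow \<open>(X, d) \<rightarrow> (X, \<rho>)\<close> of the quotient completion; its image,
  after the isomorphism of \<open>X\<close> with \<open>a (X, d)\<close>, is the quotient arrow of \<open>\<rho>\<close>.\<close>

definition proj :: "'o \<Rightarrow> 'a" where
  "proj A = Cmp R (u A) (fo a (dis A)) (fo a A) (fa a (dis A) A (Idt R (u A))) (cpt \<iota> (u A))"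

lemma dis [simp]:
  assumes "A \<in> Ob Q"
  shows "dis A \<in> Ob Q" "u (dis A) = u A" "e (dis A) = Dia R (u A)" "dis (dis A) = dis A"
  using E.fo_Ob[of "u A"] assms by simp_all

declare Tq_unit_simps(3) [simp del]

lemma iota_Hom [simp]: "X \<in> Ob R \<Longrightarrow> cpt \<iota> X \<in> Hom R X (fo a (fo (E R) X))"
  using \<iota>.cpt_Hom[of X] by simp

lemma from_discrete:
  assumes "A \<in> Ob Q" "B \<in> Ob Q" "f \<in> Hom R (u A) (u B)"
  shows "f \<in> Hom Q (dis A) B"
proof (rule Hom_QI)
  have "Leq R (u A) (u A) (Rix R (u A) (u B) (u A) (u B) f f (Dia R (u B))) (Rix R (u A) (u B) (u A) (u B) f f (e B))"
    by (rule Rix_mono) (use assms in simp_all)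
  with Dia_lax[of "u A" "u B" f]
  have "Leq R (u A) (u A) (Dia R (u A)) (Rix R (u A) (u B) (u A) (u B) f f (e B))"
    by (rule Leq_trans[rotated 5]) (use assms in simp_all)
  then show "Leq R (u (dis A)) (u (dis A)) (e (dis A)) (Rix R (u (dis A)) (u B) (u (dis A)) (u B) f f (e B))"
    using assms by simp
qed (use assms in simp)

lemma Idt_discrete [simp]: "A \<in> Ob Q \<Longrightarrow> Idt R (u A) \<in> Hom Q (dis A) A"
  by (rule from_discrete) simp_all

lemma proj_Hom [simp]: "A \<in> Ob Q \<Longrightarrow> proj A \<in> Hom R (u A) (fo a A)"
  by (simp add: proj_def)

lemma proj_discrete: "X \<in> Ob R \<Longrightarrow> proj (fo (E R) X) = cpt \<iota> X"
proof -
  assume X: "X \<in> Ob R"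
  then have E: "fo (E R) X \<in> Ob Q" "u (fo (E R) X) = X" by (simp_all add: Tq_unit_simps(3))
  have "fa a (fo (E R) X) (fo (E R) X) (Idt R X) = Idt R (fo a (fo (E R) X))"
    using a.ma_Idt[OF E(1)] E(2) by simp
  then show ?thesis using X E by (simp add: proj_def)
qed

lemma proj_natural:
  assumes "A \<in> Ob Q" "B \<in> Ob Q" "f \<in> Hom Q A B"
  shows "Cmp R (u A) (fo a A) (fo a B) (fa a A B f) (proj A) = Cmp R (u A) (u B) (fo a B) (proj B) f"
proof -
  have f: "f \<in> Hom Q (dis A) (dis B)" "f \<in> Hom Q (dis A) B"
    using assms from_discrete[of A B f] E.fa_Hom[of "u A" "u B" f] by simp_all
  have c: "Cmp R (fo a (dis A)) (fo a A) (fo a B) (fa a A B f) (fa a (dis A) A (Idt R (u A))) = fa a (dis A) B f"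
    "Cmp R (fo a (dis A)) (fo a (dis B)) (fo a B) (fa a (dis B) B (Idt R (u B))) (fa a (dis A) (dis B) f) = fa a (dis A) B f"
    using a.ma_Cmp[of "dis A" A B "Idt R (u A)" f] a.ma_Cmp[of "dis A" "dis B" B f "Idt R (u B)"] assms f
    by simp_all
  have i: "Cmp R (u A) (u B) (fo a (dis B)) (cpt \<iota> (u B)) f =
      Cmp R (u A) (fo a (dis A)) (fo a (dis B)) (fa a (dis A) (dis B) f) (cpt \<iota> (u A))"
    using \<iota>.t_natural[of "u A" "u B" f] assms by simp
  have "Cmp R (u A) (fo a A) (fo a B) (fa a A B f) (proj A) =
    Cmp R (u A) (fo a (dis A)) (fo a B) (fa a (dis A) B f) (cpt \<iota> (u A))"
    unfolding proj_def using assms by (simp add: Cmp_assoc c)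
  also have "\<dots> = Cmp R (u A) (u B) (fo a B) (proj B) f"
    unfolding proj_def using assms f by (simp add: i flip: Cmp_assoc) (simp add: Cmp_assoc c)
  finally show ?thesis .
qed

text \<open>Reindexing along \<open>a (id)\<close> only changes the boundary of a relation, and reindexing along \<open>\<iota>\<close>
  inverts \<open>a\<close>, because \<open>\<iota>\<close> is invertible.\<close>

lemma proj_Rix:
  assumes "A \<in> Ob Q" "B \<in> Ob Q" "\<alpha> \<in> Rel Q A B"
  shows "Rix R (u A) (fo a A) (u B) (fo a B) (proj A) (proj B) (fr a A B \<alpha>) = \<alpha>"
proof -
  obtain \<phi> where "\<And>X Y \<alpha>. \<lbrakk>X \<in> Ob R; Y \<in> Ob R; \<alpha> \<in> Rel R X Y\<rbrakk> \<Longrightarrow>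
      Rix R (fo (rd_id R) X) (fo (rd_comp a (E R)) X) (fo (rd_id R) Y) (fo (rd_comp a (E R)) Y)
        (cpt \<iota> X) (cpt \<iota> Y) (fr (rd_comp a (E R)) X Y \<alpha>) = fr (rd_id R) X Y \<alpha>"
    using iso2_RDE[OF \<iota>.cel iso_iota] by metis
  from this[of "u A" "u B" \<alpha>] have
    i: "Rix R (u A) (fo a (dis A)) (u B) (fo a (dis B)) (cpt \<iota> (u A)) (cpt \<iota> (u B)) (fr a (dis A) (dis B) \<alpha>) = \<alpha>"
    using assms by simp
  have "Rix R (fo a (dis A)) (fo a A) (fo a (dis B)) (fo a B) (fa a (dis A) A (Idt R (u A)))
      (fa a (dis B) B (Idt R (u B))) (fr a A B \<alpha>) = fr a (dis A) (dis B) \<alpha>"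
    using a.mr_Rix[of "dis A" "dis B" A B "Idt R (u A)" "Idt R (u B)" \<alpha>] assms by simp
  then show ?thesis
    unfolding proj_def using assms i by (simp add: Rix_Cmp)
qed

lemma iota_inverse:
  assumes "X \<in> Ob R"
  obtains j where "j \<in> Hom R (fo a (fo (E R) X)) X"
    "Cmp R X (fo a (fo (E R) X)) X j (cpt \<iota> X) = Idt R X"
    "Cmp R (fo a (fo (E R) X)) X (fo a (fo (E R) X)) (cpt \<iota> X) j = Idt R (fo a (fo (E R) X))"
proof -
  obtain \<phi> where \<phi>: "rd_cel R R (rd_comp a (E R)) (rd_id R) \<phi>"
    "\<And>X. X \<in> Ob R \<Longrightarrow> Cmp R (fo (rd_id R) X) (fo (rd_comp a (E R)) X) (fo (rd_id R) X) (cpt \<phi> X) (cpt \<iota> X) =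
       Idt R (fo (rd_id R) X)"
    "\<And>X. X \<in> Ob R \<Longrightarrow> Cmp R (fo (rd_comp a (E R)) X) (fo (rd_id R) X) (fo (rd_comp a (E R)) X)
       (cpt \<iota> X) (cpt \<phi> X) = Idt R (fo (rd_comp a (E R)) X)"
    using iso2_RDE[OF \<iota>.cel iso_iota] by metis
  interpret p: rd_cel R R "rd_comp a (E R)" "rd_id R" \<phi> by fact
  show thesis using that[of "cpt \<phi> X"] p.cpt_Hom[OF assms] \<phi>(2,3)[OF assms] assms by simp
qed

text \<open>Descent: the graph of \<open>(X, d) \<rightarrow> (X, \<rho>)\<close> in the quotient completion is \<open>\<rho>\<close> itself, and \<open>a\<close>
  preserves the equation \<open>\<rho>\<^sup>\<bottom> ; \<rho> = d\<close> that holds there.\<close>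

lemma proj_descent:
  assumes A: "A \<in> Ob Q"
  shows "Rcmp R (fo a A) (u A) (fo a A) (Conv R (u A) (fo a A) (graph R (u A) (fo a A) (proj A)))
    (graph R (u A) (fo a A) (proj A)) = Dia R (fo a A)"
proof -
  let ?W = "fo a (dis A)"
  let ?f = "fa a (dis A) A (Idt R (u A))"
  obtain j where j: "j \<in> Hom R ?W (u A)" "Cmp R (u A) ?W (u A) j (cpt \<iota> (u A)) = Idt R (u A)"
    "Cmp R ?W (u A) ?W (cpt \<iota> (u A)) j = Idt R ?W"
    using iota_inverse[of "u A"] A by auto
  have i: "Rcmp R ?W (u A) ?W (Conv R (u A) ?W (graph R (u A) ?W (cpt \<iota> (u A)))) (graph R (u A) ?W (cpt \<iota> (u A))) = Dia R ?W"
    by (rule iso_functional[OF _ _ _ j(1) j(3)]) (use A in simp_all)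
  have g: "graph Q (dis A) A (Idt R (u A)) = e A" using A by (simp add: graph_Q)
  have eR: "e A \<in> Rel Q (dis A) A" using Q.graph_Rel[of "dis A" A "Idt R (u A)"] A by (simp add: g)
  have eC: "e A \<in> Rel Q A (dis A)" using Q.Conv_Rel[OF _ _ eR] A by simp
  have G: "graph R ?W (fo a A) ?f = fr a (dis A) A (e A)"
    using a.fr_graph[of "dis A" A "Idt R (u A)"] A g by simp
  have C: "Conv R ?W (fo a A) (fr a (dis A) A (e A)) = fr a A (dis A) (e A)"
    using a.mr_Conv[OF _ _ eR] A by simp
  have "Rcmp R (fo a A) (u A) (fo a A) (Conv R (u A) (fo a A) (graph R (u A) (fo a A) (proj A)))
    (graph R (u A) (fo a A) (proj A)) =
    Rcmp R (fo a A) ?W (fo a A) (Rcmp R (fo a A) ?W ?W (Conv R ?W (fo a A) (graph R ?W (fo a A) ?f))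
      (Rcmp R ?W (u A) ?W (Conv R (u A) ?W (graph R (u A) ?W (cpt \<iota> (u A)))) (graph R (u A) ?W (cpt \<iota> (u A)))))
      (graph R ?W (fo a A) ?f)"
    unfolding proj_def using A by (simp add: graph_Cmp Conv_Rcmp Rcmp_assoc)
  also have "\<dots> = Rcmp R (fo a A) ?W (fo a A) (fr a A (dis A) (e A)) (fr a (dis A) A (e A))"
    using A eR eC by (simp add: i G C)
  also have "\<dots> = fr a A A (e A)"
    using a.mr_Rcmp[OF _ _ _ eC eR] A by simp
  also have "\<dots> = Dia R (fo a A)" using a.mr_Dia[OF A] by simp
  finally show ?thesis .
qed

text \<open>
  Let \<open>B = ((X, \<rho>), \<sigma>)\<close>. By definition \<open>a (proj (X, \<rho>))\<close> is \<open>a (a (id)) \<circ> a (\<iota>\<^sub>X)\<close>, for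
  \<open>id : ((X, d), \<sigma>) \<rightarrow> ((X, \<rho>), \<sigma>)\<close>. The multiplication of the monad sends this arrow to an
  identity, so naturality of \<open>\<kappa>\<close> absorbs \<open>a (a (id))\<close>, and what remains is the first unit law.
  For \<open>\<sigma> = \<rho>\<close> the result makes \<open>proj\<close> epic; in general it identifies \<open>\<kappa>\<close> with the comparison of
  quotients.
\<close>

lemma kappa_proj:
  assumes B: "B \<in> Ob QQ.Q"
  shows "proj (u B) \<in> Hom Q (fo (M R) B) (fo (T a) B)"
    and "Cmp R (fo a (fo (M R) B)) (fo a (fo (T a) B)) (fo a (fo (M R) B))
      (cpt \<kappa> B) (fa a (fo (M R) B) (fo (T a) B) (proj (u B))) = Idt R (fo a (fo (M R) B))"
proof -
  let ?A = "u B" and ?M = "fo (M R) B" and ?T = "fo (T a) B"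
  have M: "?M \<in> Ob Q" "?T \<in> Ob Q" "u ?M = u ?A" "e ?M = e B" "u ?T = fo a ?A" "e ?T = fr a ?A ?A (e B)"
    using B M.fo_Ob[OF B] Ta.fo_Ob[OF B] by simp_all
  have eB: "e B \<in> Rel Q ?A ?A" using B QQ.e_simps(1)[OF B] by simp
  show P: "proj ?A \<in> Hom Q ?M ?T"
    by (rule Hom_QI) (use B M eB proj_Rix[of ?A ?A "e B"] in \<open>simp_all add: M\<close>)
  define B0 where "B0 = fo (T (E R)) ?M"
  define T0 where "T0 = fo (T a) B0"
  have uB0: "u B0 = dis ?A" and eB0: "e B0 = e B"
    using M B eB E.fr_Rel[of "u ?A" "u ?A" "e B"] by (simp_all add: B0_def)
  have B0: "B0 \<in> Ob QQ.Q" unfolding B0_def by (rule TE.fo_Ob[OF M(1)])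
  have T0: "T0 \<in> Ob Q" unfolding T0_def by (rule Ta.fo_Ob[OF B0])
  have uT0: "u T0 = fo a (dis ?A)" using B0 by (simp add: T0_def uB0)
  have M0: "fo (M R) B0 = ?M" using B B0 by (simp add: uB0 eB0)
  have idB: "Idt R (u ?A) \<in> Hom QQ.Q B0 B"
    by (rule QQ.Hom_QI) (use B eB in \<open>simp_all add: uB0 eB0\<close>)
  have i: "cpt \<iota> (u ?A) \<in> Hom Q ?M T0"
  proof -
    have "fo (T (rd_comp a (E R))) ?M = T0"
      using arg_cong[OF Tq_map_comp[OF E.arr a.arr], of "\<lambda>F. fo F ?M"] M(1)
      by (simp add: T0_def B0_def del: Tq_map_simps(3-))
    then show ?thesis using T\<iota>.cpt_Hom[OF M(1)] M(1) by (simp add: M(3) Tq_map_id[OF doctrine] del: Tq_map_simps(3-))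
  qed
  have f: "fa (T a) B0 B (Idt R (u ?A)) = fa a (dis ?A) ?A (Idt R (u ?A))"
    using B B0 idB by (simp add: uB0)
  then have fH: "fa a (dis ?A) ?A (Idt R (u ?A)) \<in> Hom Q T0 ?T"
    using Ta.fa_Hom[OF B0 B idB] by (simp add: T0_def)
  have idM: "fa (M R) B0 B (Idt R (u ?A)) = Idt R (u ?M)"
    using B B0 idB by (simp add: M)
  note [simp del] = Tq_map_simps(3-) Tq_mult_simps(3-)
  have n: "Cmp R (fo a T0) (fo a ?T) (fo a ?M) (cpt \<kappa> B) (fa a T0 ?T (fa a (dis ?A) ?A (Idt R (u ?A)))) = cpt \<kappa> B0"
    using \<kappa>.t_natural[OF B0 B idB] B B0 idB M T0 \<kappa>.cpt_Hom[OF B0] a.ma_Idt[OF M(1)]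
    by (simp add: f idM M0 flip: T0_def)
  have k: "cpt \<kappa> B0 \<in> Hom R (fo a T0) (fo a ?M)" "cpt \<kappa> B \<in> Hom R (fo a ?T) (fo a ?M)"
    using \<kappa>.cpt_Hom[OF B0] \<kappa>.cpt_Hom[OF B] B B0 by (simp_all add: M0 T0_def)
  have "fa a ?M ?T (proj ?A) = Cmp R (fo a ?M) (fo a T0) (fo a ?T) (fa a T0 ?T (fa a (dis ?A) ?A (Idt R (u ?A)))) (fa a ?M T0 (cpt \<iota> (u ?A)))"
    using a.ma_Cmp[OF M(1) T0 M(2) i fH] by (simp add: proj_def M uT0)
  then have "Cmp R (fo a ?M) (fo a ?T) (fo a ?M) (cpt \<kappa> B) (fa a ?M ?T (proj ?A)) =
    Cmp R (fo a ?M) (fo a T0) (fo a ?M) (cpt \<kappa> B0) (fa a ?M T0 (cpt \<iota> (u ?A)))"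
    using M T0 i fH k by (simp add: Cmp_assoc n)
  also have "\<dots> = cpt (rd_id2 a) ?M"
    using unit_components(1)[OF M(1)] unit1 by (simp add: M(3) flip: B0_def T0_def)
  finally show "Cmp R (fo a ?M) (fo a ?T) (fo a ?M) (cpt \<kappa> B) (fa a ?M ?T (proj ?A)) = Idt R (fo a ?M)"
    using M by simp
qed

text \<open>The lemma \<open>kappa_proj\<close> and the second unit law exhibit both sides as right inverses of the same component
  of \<open>\<kappa>\<close>, which is invertible.\<close>

lemma action_proj:
  assumes A: "A \<in> Ob Q"
  shows "proj A \<in> Hom Q A (fo (E R) (fo a A))"
    and "fa a A (fo (E R) (fo a A)) (proj A) = cpt \<iota> (fo a A)"
proof -
  let ?B = "fo (E Q) A" and ?T = "fo (E R) (fo a A)"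
  have B: "?B \<in> Ob QQ.Q" "u ?B = A" using A EQ.fo_Ob[OF A] by (simp_all add: Tq_unit_simps(3))
  have M: "fo (M R) ?B = A"
    using B A by (simp add: Tq_unit_simps(3))
  have T: "fo (T a) ?B = ?T"
    using B A a.mr_Dia[OF A] by (simp add: Tq_unit_simps(3))
  have T': "?T \<in> Ob Q" using A by simp
  note k = kappa_proj[OF B(1), unfolded M T B(2)]
  show "proj A \<in> Hom Q A ?T" by (rule k(1))
  note [simp del] = Tq_map_simps(3-) Tq_mult_simps(3-)
  obtain \<phi> where \<phi>: "rd_cel QQ.Q R (rd_comp a (M R)) (rd_comp a (T a)) \<phi>"
    "\<And>X. X \<in> Ob QQ.Q \<Longrightarrow> Cmp R (fo (rd_comp a (T a)) X) (fo (rd_comp a (M R)) X)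
       (fo (rd_comp a (T a)) X) (cpt \<phi> X) (cpt \<kappa> X) = Idt R (fo (rd_comp a (T a)) X)"
    using iso2_RDE[OF \<kappa>.cel iso_kappa] by metis
  interpret p: rd_cel QQ.Q R "rd_comp a (M R)" "rd_comp a (T a)" \<phi> by fact
  let ?j = "cpt \<phi> ?B" and ?k = "cpt \<kappa> ?B"
  have j: "?j \<in> Hom R (fo a A) (fo a ?T)" "?k \<in> Hom R (fo a ?T) (fo a A)"
    "Cmp R (fo a ?T) (fo a A) (fo a ?T) ?j ?k = Idt R (fo a ?T)"
    using p.cpt_Hom[OF B(1)] \<kappa>.cpt_Hom[OF B(1)] \<phi>(2)[OF B(1)] B by (simp_all add: M T)
  have mono: "x = y" if "x \<in> Hom R (fo a A) (fo a ?T)" "y \<in> Hom R (fo a A) (fo a ?T)"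
    "Cmp R (fo a A) (fo a ?T) (fo a A) ?k x = Cmp R (fo a A) (fo a ?T) (fo a A) ?k y" for x y
  proof -
    have "Cmp R (fo a A) (fo a A) (fo a ?T) ?j (Cmp R (fo a A) (fo a ?T) (fo a A) ?k z) = z"
      if "z \<in> Hom R (fo a A) (fo a ?T)" for z
      using A T' j that by (simp add: Cmp_assoc)
    from this[OF that(1)] this[OF that(2)] that(3) show ?thesis by metis
  qed
  show "fa a A ?T (proj A) = cpt \<iota> (fo a A)"
  proof (rule mono)
    have "cpt unit2 A = Idt R (fo a A)" using unit2 A by simp
    then have "Cmp R (fo a A) (fo a ?T) (fo a A) ?k (cpt \<iota> (fo a A)) = Idt R (fo a A)"
      using unit_components(2)[OF A] by simp
    then show "Cmp R (fo a A) (fo a ?T) (fo a A) ?k (fa a A ?T (proj A)) =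
      Cmp R (fo a A) (fo a ?T) (fo a A) ?k (cpt \<iota> (fo a A))"
      using k(2) by simp
  qed (use A T' k(1) in simp_all)
qed

text \<open>An arrow \<open>f : X \<rightarrow> Z\<close> whose kernel contains \<open>\<rho>\<close> is an arrow \<open>(X, \<rho>) \<rightarrow> (Z, d)\<close>, and
  \<open>a f : a (X, \<rho>) \<rightarrow> a (Z, d)\<close> followed by the inverse of \<open>\<iota>\<^sub>Z\<close> is the factorization.\<close>

lemma proj_edq:
  assumes A: "A \<in> Ob Q"
  shows "edq R (u A) (e A) (fo a A) (proj A)"
proof (rule edqI)
  show "Rix R (u A) (fo a A) (u A) (fo a A) (proj A) (proj A) (Dia R (fo a A)) = e A"
    using proj_Rix[OF A A Q.Dia_Rel[OF A]] a.mr_Dia[OF A] by simp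
next
  fix Z f assume Z: "Z \<in> Ob R" "f \<in> Hom R (u A) Z"
    "Leq R (u A) (u A) (e A) (Rix R (u A) Z (u A) Z f f (Dia R Z))"
  let ?Z = "fo (E R) Z"
  have Z': "?Z \<in> Ob Q" "u ?Z = Z" "e ?Z = Dia R Z" using Z by (simp_all add: Tq_unit_simps(3))
  have f: "f \<in> Hom Q A ?Z" by (rule Hom_QI) (use Z Z' in simp_all)
  obtain j where j: "j \<in> Hom R (fo a ?Z) Z" "Cmp R Z (fo a ?Z) Z j (cpt \<iota> Z) = Idt R Z"
    using iota_inverse[OF Z(1)] by metis
  have "Cmp R (u A) (fo a A) Z (Cmp R (fo a A) (fo a ?Z) Z j (fa a A ?Z f)) (proj A) =
    Cmp R (u A) (fo a ?Z) Z j (Cmp R (u A) (fo a A) (fo a ?Z) (fa a A ?Z f) (proj A))"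
    using A Z Z' f j by (simp add: Cmp_assoc)
  also have "\<dots> = Cmp R (u A) Z Z (Cmp R Z (fo a ?Z) Z j (cpt \<iota> Z)) f"
    using A Z Z' f j(1) proj_natural[OF A Z'(1) f] by (simp add: proj_discrete Cmp_assoc)
  also have "\<dots> = f" using A Z by (simp add: j)
  finally show "\<exists>h\<in>Hom R (fo a A) Z. Cmp R (u A) (fo a A) Z h (proj A) = f"
    using A Z Z' f j(1) by (intro bexI[of _ "Cmp R (fo a A) (fo a ?Z) Z j (fa a A ?Z f)"]) simp_all
next
  fix Z h k assume Z: "Z \<in> Ob R" "h \<in> Hom R (fo a A) Z" "k \<in> Hom R (fo a A) Z"
    "Cmp R (u A) (fo a A) Z h (proj A) = Cmp R (u A) (fo a A) Z k (proj A)"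
  let ?Z = "fo (E R) Z" and ?A = "fo (E R) (fo a A)"
  have Z': "?Z \<in> Ob Q" "u ?Z = Z" "?A \<in> Ob Q" "u ?A = fo a A"
    using Z A by (simp_all add: Tq_unit_simps(3))
  obtain j where j: "j \<in> Hom R (fo a ?Z) Z" "Cmp R Z (fo a ?Z) Z j (cpt \<iota> Z) = Idt R Z"
    using iota_inverse[OF Z(1)] by metis
  \<comment> \<open>\<open>h\<close> is recovered from \<open>h \<circ> proj A\<close> as \<open>\<iota>\<^sup>-\<^sup>1 \<circ> a (h \<circ> proj A)\<close>\<close>
  have rec: "l = Cmp R (fo a A) (fo a ?Z) Z j (fa a A ?Z (Cmp R (u A) (fo a A) Z l (proj A)))"
    if l: "l \<in> Hom R (fo a A) Z" for l
  proof -
    have lQ: "l \<in> Hom Q ?A ?Z" using E.fa_Hom[of "fo a A" Z l] A Z l by simp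
    have "fa a A ?Z (Cmp R (u A) (fo a A) Z l (proj A)) =
      Cmp R (fo a A) (fo a ?A) (fo a ?Z) (fa a ?A ?Z l) (cpt \<iota> (fo a A))"
      using a.ma_Cmp[OF A Z'(3,1) action_proj(1)[OF A] lQ] Z' action_proj(2)[OF A] by simp
    also have "\<dots> = Cmp R (fo a A) Z (fo a ?Z) (cpt \<iota> Z) l"
      using \<iota>.t_natural[of "fo a A" Z l] A Z l by simp
    finally have "Cmp R (fo a A) (fo a ?Z) Z j (fa a A ?Z (Cmp R (u A) (fo a A) Z l (proj A))) =
      Cmp R (fo a A) (fo a ?Z) Z j (Cmp R (fo a A) Z (fo a ?Z) (cpt \<iota> Z) l)"
      by simp
    also have "\<dots> = l" using A Z Z' j l by (simp add: Cmp_assoc)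
    finally show ?thesis ..
  qed
  from rec[OF Z(2)] rec[OF Z(3)] Z(4) show "h = k" by metis
qed (use A proj_descent in simp_all)

text \<open>Naturality of \<open>proj\<close> turns \<open>kappa_proj\<close> into the equation that characterizes \<open>\<kappa>\<close> on the covering
  object.\<close>

sublocale choice: choice_data R pr a proj \<iota> \<kappa>
proof (unfold_locales, goal_cases)
  case (6 X) then show ?case by (simp add: proj_discrete)
next
  case (7 B)
  let ?M = "fo (M R) B" and ?T = "fo (T a) B"
  have MT: "?M \<in> Ob Q" "?T \<in> Ob Q" "u ?M = u (u B)" "u ?T = fo a (u B)"
    using 7 M.fo_Ob[OF 7] Ta.fo_Ob[OF 7] by simp_all
  note [simp del] = Tq_map_simps(3-) Tq_mult_simps(3-)
  note k = kappa_proj[OF 7]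
  have "Cmp R (u (u B)) (fo a (u B)) (fo a ?T) (proj ?T) (proj (u B)) =
    Cmp R (u (u B)) (fo a ?M) (fo a ?T) (fa a ?M ?T (proj (u B))) (proj ?M)"
    using proj_natural[OF MT(1,2) k(1)] by (simp add: MT)
  then show ?case
    using 7 MT k \<kappa>.cpt_Hom[OF 7] proj_Hom[OF MT(1)] by (simp add: Cmp_assoc)
qed (simp_all add: proj_edq proj_natural proj_Rix)

end

section \<open>Pseudomorphisms\<close>

text \<open>The 1-arrow underlying a pseudomorphism, before a structure 2-arrow is given.\<close>

locale ps_square = pairing pr + A: ps_algebra R pr a \<iota> \<kappa> + B: ps_algebra S pr b \<iota>' \<kappa>' + F: rd_arr R S F
  for R S :: "('o, 'a, 'r) rel_doctrine" and pr :: "'o \<times> 'r \<Rightarrow> 'o" and a \<iota> \<kappa> b \<iota>' \<kappa>' F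
begin

sublocale TF: rd_arr "quot_compl pr R" "quot_compl pr S" "T F"
  by (rule Tq_map_arr[OF F.arr])
sublocale TTF: rd_arr "quot_compl pr (quot_compl pr R)" "quot_compl pr (quot_compl pr S)" "T (T F)"
  by (rule Tq_map_arr[OF TF.arr])

lemma source_covering:
  "covering A.Q S (rd_comp b (T F)) (\<lambda>P. fo F (A.u P)) (\<lambda>P P' f. fa F (A.u P) (A.u P') f)
    (\<lambda>P P' \<alpha>. fr F (A.u P) (A.u P') \<alpha>) (\<lambda>P. B.proj (fo (T F) P))"
  by (rule covering_cong[OF covering_restrict[OF B.choice.cov.covering_axioms TF.arr]]) simp_all

lemma target_covering:
  "preserves_quotient_arrows F \<Longrightarrow>
    covering A.Q S (rd_comp F a) (\<lambda>P. fo F (A.u P)) (\<lambda>P P' f. fa F (A.u P) (A.u P') f)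
    (\<lambda>P P' \<alpha>. fr F (A.u P) (A.u P') \<alpha>) (\<lambda>P. fa F (A.u P) (fo a P) (A.proj P))"
  by (rule covering_compose[OF A.choice.cov.covering_axioms F.arr])

text \<open>The structure 2-arrow of a pseudomorphism compares the chosen quotient of the image under \<open>F\<close> with
  the image of the chosen quotient; it is required to commute with the quotient arrows.\<close>

definition mates :: "('o, 'a, 'r) rd_cell \<Rightarrow> bool" where
  "mates \<phi> \<longleftrightarrow> rd_cel A.Q S (rd_comp b (T F)) (rd_comp F a) \<phi> \<and>
    (\<forall>P\<in>Ob A.Q. Cmp S (fo F (A.u P)) (fo b (fo (T F) P)) (fo F (fo a P)) (cpt \<phi> P)
      (B.proj (fo (T F) P)) = fa F (A.u P) (fo a P) (A.proj P))"

lemma matesD: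
  assumes "mates \<phi>"
  shows "rd_cel A.Q S (rd_comp b (T F)) (rd_comp F a) \<phi>"
    and "P \<in> Ob A.Q \<Longrightarrow> Cmp S (fo F (A.u P)) (fo b (fo (T F) P)) (fo F (fo a P)) (cpt \<phi> P)
      (B.proj (fo (T F) P)) = fa F (A.u P) (fo a P) (A.proj P)"
  using assms unfolding mates_def by blast+

lemma mates_ex: "preserves_quotient_arrows F \<Longrightarrow> \<exists>\<phi>. mates \<phi>"
proof -
  assume "preserves_quotient_arrows F"
  then obtain \<phi> where "rd_cel A.Q S (rd_comp b (T F)) (rd_comp F a) \<phi>"
    "\<And>P. P \<in> Ob A.Q \<Longrightarrow> Cmp S (fo F (A.u P)) (fo (rd_comp b (T F)) P) (fo (rd_comp F a) P) (cpt \<phi> P)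
      (B.proj (fo (T F) P)) = fa F (A.u P) (fo a P) (A.proj P)"
    using covering_comparison[OF source_covering target_covering] by metis
  then have "mates \<phi>" by (simp add: mates_def)
  then show ?thesis ..
qed

lemma mates_unique: "mates \<phi> \<Longrightarrow> mates \<psi> \<Longrightarrow> \<phi> = \<psi>"
  by (rule covering.cel_eqI[OF source_covering]) (auto simp: mates_def)

lemma mates_iso: "preserves_quotient_arrows F \<Longrightarrow> mates \<phi> \<Longrightarrow> iso2 RD \<phi>"
  by (rule covering_comparison_iso[OF source_covering target_covering]) (auto simp: mates_def)

text \<open>Up to the isomorphism \<open>\<phi>\<close>, the image under \<open>F\<close> of a chosen quotient arrow is a chosen quotient
  arrow, and by uniqueness of quotients it suffices to consider the chosen ones.\<close>

lemma mates_preserves: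
  assumes "mates \<phi>" "iso2 RD \<phi>"
  shows "preserves_quotient_arrows F"
proof (rule F.preserves_quotient_arrowsI)
  fix X \<rho> assume X: "X \<in> Ob R" "equiv_rel R X \<rho>"
  let ?P = "pr (X, \<rho>)" and ?T = "fo (T F) (pr (X, \<rho>))"
  have P: "?P \<in> Ob A.Q" "A.u ?P = X" "A.e ?P = \<rho>" using X by simp_all
  have T: "?T \<in> Ob B.Q" "B.u ?T = fo F X" "B.e ?T = fr F X X \<rho>"
    using TF.fo_Ob[OF P(1)] P by simp_all
  have \<phi>: "rd_cel A.Q S (rd_comp b (T F)) (rd_comp F a) \<phi>"
    using assms(1) by (simp add: mates_def)
  obtain \<psi> where \<psi>: "rd_cel A.Q S (rd_comp F a) (rd_comp b (T F)) \<psi>"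
    "\<And>P. P \<in> Ob A.Q \<Longrightarrow> Cmp S (fo (rd_comp b (T F)) P) (fo (rd_comp F a) P) (fo (rd_comp b (T F)) P)
       (cpt \<psi> P) (cpt \<phi> P) = Idt S (fo (rd_comp b (T F)) P)"
    "\<And>P. P \<in> Ob A.Q \<Longrightarrow> Cmp S (fo (rd_comp F a) P) (fo (rd_comp b (T F)) P) (fo (rd_comp F a) P)
       (cpt \<phi> P) (cpt \<psi> P) = Idt S (fo (rd_comp F a) P)"
    using iso2_RDE[OF \<phi> assms(2)] by metis
  interpret \<phi>: rd_cel A.Q S "rd_comp b (T F)" "rd_comp F a" \<phi> by fact
  interpret \<psi>: rd_cel A.Q S "rd_comp F a" "rd_comp b (T F)" \<psi> by fact
  note [simp del] = Tq_map_simps(3-)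
  have "edq S (fo F X) (fr F X X \<rho>) (fo F (fo a ?P))
      (Cmp S (fo F X) (fo b ?T) (fo F (fo a ?P)) (cpt \<phi> ?P) (B.proj ?T))"
    by (rule B.edq_iso[where k = "cpt \<psi> ?P"])
      (use X P T B.proj_edq[OF T(1)] \<phi>.cpt_Hom[OF P(1)] \<psi>.cpt_Hom[OF P(1)] \<psi>(2,3)[OF P(1)] in simp_all)
  moreover have "Cmp S (fo F X) (fo b ?T) (fo F (fo a ?P)) (cpt \<phi> ?P) (B.proj ?T) = fa F X (fo a ?P) (A.proj ?P)"
    using matesD(2)[OF assms(1) P(1)] P by simp
  ultimately show "\<exists>W q. edq R X \<rho> W q \<and> edq S (fo F X) (fr F X X \<rho>) (fo F W) (fa F X W q)"
    using A.proj_edq[OF P(1)] P by auto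
qed

lemma boundary_eqs:
  "rd_comp (rd_comp b (T F)) (E R) = rd_comp (rd_comp b (E S)) F"
  "rd_comp (rd_comp F a) (E R) = rd_comp F (rd_comp a (E R))"
  "rd_comp F (rd_id R) = F" "rd_comp (rd_id S) F = F"
  "rd_comp b (T (rd_comp b (T F))) = rd_comp (rd_comp b (T b)) (T (T F))"
  "rd_comp b (T (rd_comp F a)) = rd_comp (rd_comp b (T F)) (T a)"
  "rd_comp (rd_comp F a) (T a) = rd_comp F (rd_comp a (T a))"
  "rd_comp (rd_comp F a) (M R) = rd_comp F (rd_comp a (M R))"
  "rd_comp (rd_comp b (M S)) (T (T F)) = rd_comp (rd_comp b (T F)) (M R)"
  using rd_comp_id[OF F.arr] Tq_unit_natural[OF F.arr] Tq_mult_natural[OF F.arr]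
    Tq_map_comp[OF TF.arr B.a.arr] Tq_map_comp[OF A.a.arr F.arr]
    rd_comp_assoc[OF A.E.arr TF.arr B.a.arr]
    rd_comp_assoc[OF F.arr B.E.arr B.a.arr]
    rd_comp_assoc[OF A.E.arr A.a.arr F.arr]
    rd_comp_assoc[OF A.Ta.arr A.a.arr F.arr]
    rd_comp_assoc[OF A.M.arr A.a.arr F.arr]
    rd_comp_assoc[OF TTF.arr B.Ta.arr B.a.arr]
    rd_comp_assoc[OF TTF.arr B.M.arr B.a.arr]
    rd_comp_assoc[OF A.Ta.arr TF.arr B.a.arr]
    rd_comp_assoc[OF A.M.arr TF.arr B.a.arr]
  by simp_all

lemma unit_object: "X \<in> Ob R \<Longrightarrow> fo (T F) (fo (E R) X) = fo (E S) (fo F X)"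
  using A.E.fo_Ob[of X] by (simp add: Tq_unit_simps(3))

text \<open>The unit law fixes the component of \<open>\<phi>\<close> at \<open>(X, d)\<close>; naturality along
  \<open>(X, d) \<rightarrow> (X, \<rho>)\<close> then fixes it everywhere.\<close>

lemma unit_law_iff_mates:
  assumes "rd_cel A.Q S (rd_comp b (T F)) (rd_comp F a) \<phi>"
  shows "rd_vcomp (rd_hcomp \<phi> (rd_id2 (E R))) (rd_hcomp \<iota>' (rd_id2 F)) = rd_hcomp (rd_id2 F) \<iota>
    \<longleftrightarrow> mates \<phi>" (is "?l = ?r \<longleftrightarrow> _")
proof -
  interpret \<phi>: rd_cel A.Q S "rd_comp b (T F)" "rd_comp F a" \<phi> by fact
  have cells: "rd_cel R S F (rd_comp F (rd_comp a (E R))) ?l"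
    "rd_cel R S F (rd_comp F (rd_comp a (E R))) ?r"
    using rd_vcomp_cel[OF rd_hcomp_cel[OF rd_id2_cel[OF F.arr] B.\<iota>.cel, unfolded boundary_eqs(4)]
      rd_hcomp_cel[OF rd_id2_cel[OF A.E.arr] \<phi>.cel, unfolded boundary_eqs(1,2)]]
      rd_hcomp_cel[OF A.\<iota>.cel rd_id2_cel[OF F.arr], unfolded boundary_eqs(3)]
    by simp_all
  have cpt: "cpt ?l X = Cmp S (fo F X) (fo b (fo (E S) (fo F X))) (fo F (fo a (fo (E R) X)))
      (cpt \<phi> (fo (E R) X)) (cpt \<iota>' (fo F X))"
    "cpt ?r X = fa F X (fo a (fo (E R) X)) (cpt \<iota> X)" if "X \<in> Ob R" for X
    using that cpt_whisker_right[OF \<phi>.cel A.E.arr that]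
      cpt_whisker_right[OF B.\<iota>.cel F.arr that]
      cpt_whisker_left[OF F.arr A.\<iota>.cel that]
    by (simp_all del: rd_hcomp_simps(3))
  show ?thesis
  proof
    assume law: "?l = ?r"
    have "Cmp S (fo F (A.u P)) (fo b (fo (T F) P)) (fo F (fo a P)) (cpt \<phi> P)
      (B.proj (fo (T F) P)) = fa F (A.u P) (fo a P) (A.proj P)" if P: "P \<in> Ob A.Q" for P
    proof -
      let ?T = "fo (T F) P" and ?D = "A.dis P"
      let ?TD = "fo (E S) (fo F (A.u P))"
      have T: "?T \<in> Ob B.Q" "B.u ?T = fo F (A.u P)" "B.dis ?T = ?TD" "fo (T F) ?D = ?TD"
        "B.dis ?T \<in> Ob B.Q"
        using TF.fo_Ob[OF P] P unit_object[of "A.u P"] by simp_all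
      have idD: "Idt R (A.u P) \<in> Hom A.Q ?D P" "Idt S (fo F (A.u P)) \<in> Hom B.Q ?TD ?T"
        using A.Idt_discrete[OF P] B.Idt_discrete[OF T(1)] by (simp_all add: T)
      have Fid: "fa (T F) ?D P (Idt R (A.u P)) = Idt S (fo F (A.u P))"
        using P idD by simp
      note [simp del] = Tq_map_simps(3-)
      have h: "cpt \<phi> P \<in> Hom S (fo b ?T) (fo F (fo a P))" "cpt \<phi> ?D \<in> Hom S (fo b ?TD) (fo F (fo a ?D))"
        using \<phi>.cpt_Hom[OF P] \<phi>.cpt_Hom[OF A.dis(1)[OF P]] P by (simp_all add: T)
      have n: "Cmp S (fo b ?TD) (fo b ?T) (fo F (fo a P)) (cpt \<phi> P) (fa b ?TD ?T (Idt S (fo F (A.u P)))) =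
        Cmp S (fo b ?TD) (fo F (fo a ?D)) (fo F (fo a P)) (fa F (fo a ?D) (fo a P) (fa a ?D P (Idt R (A.u P)))) (cpt \<phi> ?D)"
        using \<phi>.t_natural[OF A.dis(1)[OF P] P idD(1)] P idD by (simp add: T Fid)
      have l: "Cmp S (fo F (A.u P)) (fo b ?TD) (fo F (fo a ?D)) (cpt \<phi> ?D) (cpt \<iota>' (fo F (A.u P))) =
        fa F (A.u P) (fo a ?D) (cpt \<iota> (A.u P))"
        by (rule trans[OF cpt(1)[symmetric] trans[OF arg_cong[OF law, of "\<lambda>\<psi>. cpt \<psi> (A.u P)"] cpt(2)]])
          (use P in simp_all)
      have i': "cpt \<iota>' (fo F (A.u P)) \<in> Hom S (fo F (A.u P)) (fo b ?TD)" using B.iota_Hom[of "fo F (A.u P)"] P by simp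
      have "Cmp S (fo F (A.u P)) (fo b ?T) (fo F (fo a P)) (cpt \<phi> P) (B.proj ?T) =
        Cmp S (fo F (A.u P)) (fo b ?TD) (fo F (fo a P))
          (Cmp S (fo b ?TD) (fo b ?T) (fo F (fo a P)) (cpt \<phi> P) (fa b ?TD ?T (Idt S (fo F (A.u P)))))
          (cpt \<iota>' (fo F (A.u P)))"
        unfolding B.proj_def using P T h idD i' by (simp add: B.Cmp_assoc)
      also have "\<dots> = Cmp S (fo F (A.u P)) (fo F (fo a ?D)) (fo F (fo a P))
         (fa F (fo a ?D) (fo a P) (fa a ?D P (Idt R (A.u P)))) (fa F (A.u P) (fo a ?D) (cpt \<iota> (A.u P)))"
        unfolding n using P T h idD i' by (simp add: l flip: B.Cmp_assoc)
      also have "\<dots> = fa F (A.u P) (fo a P) (A.proj P)"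
        unfolding A.proj_def using P idD by simp
      finally show ?thesis .
    qed
    then show "mates \<phi>" using assms by (simp add: mates_def)
  next
    assume m: "mates \<phi>"
    show "?l = ?r"
    proof (rule rd_cel_eqI[OF cells])
      fix X assume X: "X \<in> Ob R"
      let ?P = "fo (E R) X"
      have P: "?P \<in> Ob A.Q" "A.u ?P = X" using X A.E.fo_Ob[OF X] by (simp_all add: Tq_unit_simps(3))
      have "Cmp S (fo F (A.u ?P)) (fo b (fo (T F) ?P)) (fo F (fo a ?P)) (cpt \<phi> ?P)
        (B.proj (fo (T F) ?P)) = fa F (A.u ?P) (fo a ?P) (A.proj ?P)"
        using m P(1) by (simp add: mates_def del: Tq_map_simps(3-))
      then show "cpt ?l X = cpt ?r X"
        unfolding cpt(1)[OF X] cpt(2)[OF X]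
        using X P by (simp add: A.proj_discrete B.proj_discrete unit_object del: Tq_map_simps(3-))
    qed
  qed
qed

text \<open>The multiplication law compares two 2-arrows out of an iterated quotient; on the covering
  object both are the image of a single quotient arrow.\<close>

lemma mates_mult_law:
  assumes "mates \<phi>"
  shows "rd_vcomp (rd_hcomp (rd_id2 F) \<kappa>)
          (rd_vcomp (rd_hcomp \<phi> (rd_id2 (T a))) (rd_hcomp (rd_id2 b) (Tq_cell pr \<phi>))) =
       rd_vcomp (rd_hcomp \<phi> (rd_id2 (M R))) (rd_hcomp \<kappa>' (rd_id2 (T (T F))))"
    (is "?l = ?r")
proof -
  have \<phi>: "rd_cel A.Q S (rd_comp b (T F)) (rd_comp F a) \<phi>"
    and m: "\<And>P. P \<in> Ob A.Q \<Longrightarrow> Cmp S (fo F (A.u P)) (fo b (fo (T F) P)) (fo F (fo a P)) (cpt \<phi> P)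
      (B.proj (fo (T F) P)) = fa F (A.u P) (fo a P) (A.proj P)"
    using assms by (simp_all add: mates_def)
  interpret \<phi>: rd_cel A.Q S "rd_comp b (T F)" "rd_comp F a" \<phi> by fact
  interpret T\<phi>: rd_cel A.QQ.Q B.Q "T (rd_comp b (T F))" "T (rd_comp F a)" "Tq_cell pr \<phi>"
    by (rule Tq_cell_cel[OF \<phi>])
  have cells: "rd_cel A.QQ.Q S (rd_comp (rd_comp b (T b)) (T (T F)))
      (rd_comp F (rd_comp a (M R))) ?l"
    "rd_cel A.QQ.Q S (rd_comp (rd_comp b (T b)) (T (T F)))
      (rd_comp F (rd_comp a (M R))) ?r"
    using rd_vcomp_cel[OF rd_vcomp_cel[OF
        rd_hcomp_cel[OF T\<phi>.cel rd_id2_cel[OF B.a.arr], unfolded boundary_eqs(5,6)]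
        rd_hcomp_cel[OF rd_id2_cel[OF A.Ta.arr] \<phi>, unfolded boundary_eqs(7)]]
        rd_hcomp_cel[OF A.\<kappa>.cel rd_id2_cel[OF F.arr]]]
      rd_vcomp_cel[OF rd_hcomp_cel[OF rd_id2_cel[OF TTF.arr] B.\<kappa>.cel, unfolded boundary_eqs(9)]
        rd_hcomp_cel[OF rd_id2_cel[OF A.M.arr] \<phi>, unfolded boundary_eqs(8)]]
    by simp_all
  show ?thesis
  proof (rule covering.cel_eqI[OF covering_restrict[OF B.choice.act_covering TTF.arr] cells], goal_cases)
    case P: (1 P)
    let ?TT = "fo (T (T F)) P" and ?uP = "A.u P"
    let ?N = "fo (T b) ?TT" and ?M = "fo (M R) P" and ?Ta = "fo (T a) P"
    let ?X = "fo F (A.u (A.u P))" and ?W1 = "fo b (fo (T F) ?uP)" and ?W2 = "fo b ?N"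
    have O: "?uP \<in> Ob A.Q" "?TT \<in> Ob B.QQ.Q" "?N \<in> Ob B.Q" "?M \<in> Ob A.Q" "?Ta \<in> Ob A.Q"
      "fo (T F) ?uP \<in> Ob B.Q" "fo (T F) ?Ta \<in> Ob B.Q" "fo (T F) ?M \<in> Ob B.Q"
      using P by (simp_all del: Tq_map_simps(3-) Tq_mult_simps(3-))
    have e: "B.u ?TT = fo (T F) ?uP" "B.u (fo (T F) ?uP) = ?X" "B.u ?N = ?W1"
      "fo (M S) ?TT = fo (T F) ?M" "A.u ?M = A.u ?uP" "A.u ?Ta = fo a ?uP"
      "B.u (fo (T F) ?Ta) = fo F (fo a ?uP)"
      using P O by simp_all
    have pH: "cpt \<phi> ?uP \<in> Hom B.Q ?N (fo (T F) ?Ta)"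
      using T\<phi>.cpt_Hom[OF P] P O arg_cong[OF Tq_map_comp[OF TF.arr B.a.arr], of "\<lambda>F. fo F P"]
        arg_cong[OF Tq_map_comp[OF A.a.arr F.arr], of "\<lambda>F. fo F P"]
      by (simp del: Tq_map_simps(3-))
    have TP: "fo (T (rd_comp b (T F))) P = ?N" "fo (T (rd_comp F a)) P = fo (T F) ?Ta"
      using P O arg_cong[OF Tq_map_comp[OF TF.arr B.a.arr], of "\<lambda>F. fo F P"]
        arg_cong[OF Tq_map_comp[OF A.a.arr F.arr], of "\<lambda>F. fo F P"]
      by (simp_all del: Tq_map_simps(3-))
    note [simp del] = Tq_map_simps(3-) Tq_mult_simps(3-)
    define p1 p2 where "p1 = B.proj (fo (T F) ?uP)" and "p2 = B.proj ?N"
    have [simp]: "p1 \<in> Hom S ?X ?W1" "p2 \<in> Hom S ?W1 ?W2"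
      using B.proj_Hom[OF O(6)] B.proj_Hom[OF O(3)] by (simp_all add: p1_def p2_def e)
    let ?V = "fo b (fo (T F) ?Ta)" and ?VM = "fo b (fo (T F) ?M)"
    have H [simp]: "cpt \<phi> ?uP \<in> Hom S ?W1 (fo F (fo a ?uP))" "cpt \<phi> ?Ta \<in> Hom S ?V (fo F (fo a ?Ta))"
      "cpt \<phi> ?M \<in> Hom S ?VM (fo F (fo a ?M))" "cpt \<kappa>' ?TT \<in> Hom S ?W2 ?VM"
      "cpt \<kappa> P \<in> Hom R (fo a ?Ta) (fo a ?M)" "fa b ?N (fo (T F) ?Ta) (cpt \<phi> ?uP) \<in> Hom S ?W2 ?V"
      "B.proj (fo (T F) ?Ta) \<in> Hom S (fo F (fo a ?uP)) ?V"
      using \<phi>.cpt_Hom[OF O(1)] \<phi>.cpt_Hom[OF O(5)] \<phi>.cpt_Hom[OF O(4)] B.\<kappa>.cpt_Hom[OF O(2)] A.\<kappa>.cpt_Hom[OF P]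
        B.proj_Hom[OF O(7)] P O pH by (simp_all add: e)
    have Ob [simp]: "?X \<in> Ob S" "?W1 \<in> Ob S" "?W2 \<in> Ob S" "?V \<in> Ob S" "?VM \<in> Ob S" using P O by simp_all
    have cl: "cpt ?l P = Cmp S ?W2 (fo F (fo a ?Ta)) (fo F (fo a ?M)) (fa F (fo a ?Ta) (fo a ?M) (cpt \<kappa> P))
      (Cmp S ?W2 ?V (fo F (fo a ?Ta)) (cpt \<phi> ?Ta) (fa b ?N (fo (T F) ?Ta) (cpt \<phi> ?uP)))"
      using P O cpt_whisker_left[OF F.arr A.\<kappa>.cel P] cpt_whisker_right[OF \<phi> A.Ta.arr P]
        cpt_whisker_left[OF B.a.arr T\<phi>.cel P]
      by (simp add: TP del: rd_hcomp_simps(3))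
    have cr: "cpt ?r P = Cmp S ?W2 ?VM (fo F (fo a ?M)) (cpt \<phi> ?M) (cpt \<kappa>' ?TT)"
      using P O cpt_whisker_right[OF \<phi> A.M.arr P] cpt_whisker_right[OF B.\<kappa>.cel TTF.arr P]
      by (simp add: e del: rd_hcomp_simps(3))
    have nat: "Cmp S ?W1 ?W2 ?V (fa b ?N (fo (T F) ?Ta) (cpt \<phi> ?uP)) p2 =
      Cmp S ?W1 (fo F (fo a ?uP)) ?V (B.proj (fo (T F) ?Ta)) (cpt \<phi> ?uP)"
      using B.proj_natural[OF O(3,7) pH] by (simp add: p2_def e)
    have m1: "Cmp S ?X ?W1 (fo F (fo a ?uP)) (cpt \<phi> ?uP) p1 = fa F (A.u ?uP) (fo a ?uP) (A.proj ?uP)"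
      using m[OF O(1)] by (simp add: p1_def)
    have m2: "Cmp S (fo F (fo a ?uP)) ?V (fo F (fo a ?Ta)) (cpt \<phi> ?Ta) (B.proj (fo (T F) ?Ta)) =
      fa F (fo a ?uP) (fo a ?Ta) (A.proj ?Ta)"
      using m[OF O(5)] by (simp add: e)
    have m3: "Cmp S ?X ?VM (fo F (fo a ?M)) (cpt \<phi> ?M) (B.proj (fo (T F) ?M)) =
      fa F (A.u ?uP) (fo a ?M) (A.proj ?M)"
      using m[OF O(4)] by (simp add: e)
    have k: "Cmp S ?X ?W2 ?VM (cpt \<kappa>' ?TT) (Cmp S ?X ?W1 ?W2 p2 p1) = B.proj (fo (T F) ?M)"
      using B.choice.kappa_pp[OF O(2)] by (simp add: e p1_def p2_def)
    have kA: "Cmp R (A.u ?uP) (fo a ?Ta) (fo a ?M) (cpt \<kappa> P) (Cmp R (A.u ?uP) (fo a ?uP) (fo a ?Ta) (A.proj ?Ta) (A.proj ?uP)) = A.proj ?M"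
      using A.choice.kappa_pp[OF P] .
    have q: "A.proj ?Ta \<in> Hom R (fo a ?uP) (fo a ?Ta)" "A.proj ?uP \<in> Hom R (A.u ?uP) (fo a ?uP)"
      using A.proj_Hom[OF O(5)] A.proj_Hom[OF O(1)] by (simp_all add: e)
    have "Cmp S ?X ?W2 (fo F (fo a ?M)) (cpt ?l P) (Cmp S ?X ?W1 ?W2 p2 p1) =
      Cmp S ?X (fo F (fo a ?Ta)) (fo F (fo a ?M)) (fa F (fo a ?Ta) (fo a ?M) (cpt \<kappa> P))
        (Cmp S ?X ?V (fo F (fo a ?Ta)) (cpt \<phi> ?Ta)
          (Cmp S ?X ?W1 ?V (Cmp S ?W1 ?W2 ?V (fa b ?N (fo (T F) ?Ta) (cpt \<phi> ?uP)) p2) p1))"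
      unfolding cl using O P by (simp add: B.Cmp_assoc)
    also have "\<dots> = Cmp S ?X (fo F (fo a ?Ta)) (fo F (fo a ?M)) (fa F (fo a ?Ta) (fo a ?M) (cpt \<kappa> P))
        (Cmp S ?X (fo F (fo a ?uP)) (fo F (fo a ?Ta))
          (Cmp S (fo F (fo a ?uP)) ?V (fo F (fo a ?Ta)) (cpt \<phi> ?Ta) (B.proj (fo (T F) ?Ta)))
          (Cmp S ?X ?W1 (fo F (fo a ?uP)) (cpt \<phi> ?uP) p1))"
      unfolding nat using O P by (simp add: B.Cmp_assoc)
    also have "\<dots> = fa F (A.u ?uP) (fo a ?M) (A.proj ?M)"
      unfolding m1 m2 using P O q by (simp flip: kA F.ma_Cmp)
    also have "\<dots> = Cmp S ?X ?W2 (fo F (fo a ?M)) (cpt ?r P) (Cmp S ?X ?W1 ?W2 p2 p1)"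
      unfolding cr m3[symmetric] k[symmetric] using O P by (simp add: B.Cmp_assoc)
    finally show ?case
      using P O by (simp add: e p1_def p2_def del: rd_vcomp_simps(3))
  qed
qed

end

lemma preserves_comp:
  assumes "rd_arr R S F" "rd_arr S T G" "preserves_quotient_arrows F" "preserves_quotient_arrows G"
  shows "preserves_quotient_arrows (rd_comp G F)"
proof -
  interpret F: rd_arr R S F by fact
  interpret G: rd_arr S T G by fact
  show ?thesis unfolding preserves_quotient_arrows_def
  proof (intro ballI allI impI)
    fix X \<rho> W q assume X: "X \<in> Ob (dsrc (rd_comp G F))" "equiv_rel (dsrc (rd_comp G F)) X \<rho>"
      and q: "quotient_arrow (dsrc (rd_comp G F)) X \<rho> W q"
    then have "W \<in> Ob R" "q \<in> Hom R X W" "\<rho> \<in> Rel R X X" by (simp_all add: quotient_arrow_def equiv_rel_def)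
    moreover have "quotient_arrow T (fo G (fo F X)) (fr G (fo F X) (fo F X) (fr F X X \<rho>)) (fo G (fo F W))
        (fa G (fo F X) (fo F W) (fa F X W q))"
      using assms(3,4) X q F.fr_equiv_rel unfolding preserves_quotient_arrows_def by simp
    ultimately show "quotient_arrow (dtrg (rd_comp G F)) (fo (rd_comp G F) X) (fr (rd_comp G F) X X \<rho>)
       (fo (rd_comp G F) W) (fa (rd_comp G F) X W q)"
      using X by simp
  qed
qed

lemma preserves_id: "preserves_quotient_arrows (rd_id R)"
  by (auto simp: preserves_quotient_arrows_def quotient_arrow_def equiv_rel_def)

lemma Tq_simps [simp]:
  "on0 (Tq pr) = quot_compl pr" "on1 (Tq pr) = Tq_map pr" "on2 (Tq pr) = Tq_cell pr"
  "unit (Tq pr) = Tq_unit pr" "mult (Tq pr) = Tq_mult pr"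
  by (simp_all add: Tq_def)

context pairing
begin

abbreviation "mate h \<equiv> ps_square.mates (carr (psrc h)) (carr (ptrg h)) pr (act (psrc h)) (iota (psrc h))
  (act (ptrg h)) (iota (ptrg h)) (pmap h) (pcell h)"

lemma ps_algebraI:
  "pseudoalgebra RD (Tq pr) \<A> \<Longrightarrow> ps_algebra (carr \<A>) pr (act \<A>) (iota \<A>) (kappa \<A>)"
  by (simp add: pseudoalgebra_iff ps_algebra_def ps_algebra_axioms_def)

lemma ps_squareI:
  assumes "pseudoalgebra RD (Tq pr) \<A>" "pseudoalgebra RD (Tq pr) \<B>" "rd_arr (carr \<A>) (carr \<B>) F"
  shows "ps_square (carr \<A>) (carr \<B>) pr (act \<A>) (iota \<A>) (kappa \<A>) (act \<B>) (iota \<B>) (kappa \<B>) F"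
  using assms by (simp add: ps_square_def ps_algebraI pairing_axioms)

text \<open>A pseudomorphism is a 1-arrow that preserves quotient arrows, together with the only possible
  structure 2-arrow.\<close>

lemma pseudomorphism_iff:
  "pseudomorphism RD (Tq pr) h \<longleftrightarrow> pseudoalgebra RD (Tq pr) (psrc h) \<and> pseudoalgebra RD (Tq pr) (ptrg h) \<and>
    rd_arr (carr (psrc h)) (carr (ptrg h)) (pmap h) \<and> preserves_quotient_arrows (pmap h) \<and> mate h"
proof (cases "pseudoalgebra RD (Tq pr) (psrc h) \<and> pseudoalgebra RD (Tq pr) (ptrg h) \<and>
    rd_arr (carr (psrc h)) (carr (ptrg h)) (pmap h)")
  case False
  then show ?thesis by (auto simp: pseudomorphism_def Let_def)
next
  case True
  then interpret ps_square "carr (psrc h)" "carr (ptrg h)" pr "act (psrc h)" "iota (psrc h)" "kappa (psrc h)"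
    "act (ptrg h)" "iota (ptrg h)" "kappa (ptrg h)" "pmap h" by (intro ps_squareI) simp_all
  have two: "\<phi> \<in> two RD (rd_comp (act (ptrg h)) (T (pmap h))) (rd_comp (pmap h) (act (psrc h))) \<longleftrightarrow>
    rd_cel A.Q (carr (ptrg h)) (rd_comp (act (ptrg h)) (T (pmap h))) (rd_comp (pmap h) (act (psrc h))) \<phi>" for \<phi>
    by (rule two_RD[OF rd_comp_arr[OF TF.arr B.a.arr]])
  show ?thesis
    using True two mates_mult_law unit_law_iff_mates mates_iso mates_preserves matesD(1)
    by (auto simp add: pseudomorphism_def Let_def)
qed

lemma pseudomorphism_eqI:
  assumes "pseudomorphism RD (Tq pr) h" "pseudomorphism RD (Tq pr) k"
    "psrc h = psrc k" "ptrg h = ptrg k" "pmap h = pmap k"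
  shows "h = k"
proof -
  have h: "pseudoalgebra RD (Tq pr) (psrc h)" "pseudoalgebra RD (Tq pr) (ptrg h)"
    "rd_arr (carr (psrc h)) (carr (ptrg h)) (pmap h)" "mate h" "mate k"
    using assms by (simp_all add: pseudomorphism_iff)
  interpret ps_square "carr (psrc h)" "carr (ptrg h)" pr "act (psrc h)" "iota (psrc h)" "kappa (psrc h)"
    "act (ptrg h)" "iota (ptrg h)" "kappa (ptrg h)" "pmap h" by (rule ps_squareI) fact+
  have "pcell h = pcell k" using mates_unique[of "pcell h" "pcell k"] h assms(3-5) by simp
  then show ?thesis using assms(3-5) by (intro psmor.equality) simp_all
qed

lemma pseudomorphism_ex:
  assumes "pseudoalgebra RD (Tq pr) \<A>" "pseudoalgebra RD (Tq pr) \<B>" "rd_arr (carr \<A>) (carr \<B>) F"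
    "preserves_quotient_arrows F"
  shows "\<exists>h. pseudomorphism RD (Tq pr) h \<and> psrc h = \<A> \<and> ptrg h = \<B> \<and> pmap h = F"
proof -
  interpret ps_square "carr \<A>" "carr \<B>" pr "act \<A>" "iota \<A>" "kappa \<A>" "act \<B>" "iota \<B>" "kappa \<B>" F
    by (rule ps_squareI) fact+
  obtain \<phi> where "mates \<phi>" using mates_ex[OF assms(4)] ..
  then have "pseudomorphism RD (Tq pr) \<lparr>psrc = \<A>, ptrg = \<B>, pmap = F, pcell = \<phi>\<rparr>"
    using assms by (simp add: pseudomorphism_iff)
  then show ?thesis by (intro exI[of _ "\<lparr>psrc = \<A>, ptrg = \<B>, pmap = F, pcell = \<phi>\<rparr>"]) simp
qed

text \<open>The pasted structure 2-arrow commutes with the quotient arrows, because its two factors do and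
  the second 1-arrow preserves composition.\<close>

lemma pseudomorphism_comp:
  assumes h: "pseudomorphism RD (Tq pr) h" and k: "pseudomorphism RD (Tq pr) k" and hk: "psrc k = ptrg h"
  shows "pseudomorphism RD (Tq pr) (ps_comp RD (Tq pr) k h)"
proof -
  let ?R = "carr (psrc h)" and ?S = "carr (ptrg h)" and ?T = "carr (ptrg k)"
  let ?F = "pmap h" and ?G = "pmap k" and ?\<phi> = "pcell h" and ?\<psi> = "pcell k"
  let ?a = "act (psrc h)" and ?b = "act (ptrg h)" and ?c = "act (ptrg k)"
  note h' = h[unfolded pseudomorphism_iff] and k' = k[unfolded pseudomorphism_iff hk]
  interpret H: ps_square ?R ?S pr ?a "iota (psrc h)" "kappa (psrc h)"
    ?b "iota (ptrg h)" "kappa (ptrg h)" ?F using h' by (intro ps_squareI) simp_all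
  interpret K: ps_square ?S ?T pr ?b "iota (ptrg h)" "kappa (ptrg h)"
    ?c "iota (ptrg k)" "kappa (ptrg k)" ?G using k' by (intro ps_squareI) simp_all
  have GF: "rd_arr ?R ?T (rd_comp ?G ?F)" by (rule rd_comp_arr[OF H.F.arr K.F.arr])
  interpret KH: ps_square ?R ?T pr ?a "iota (psrc h)" "kappa (psrc h)"
    ?c "iota (ptrg k)" "kappa (ptrg k)" "rd_comp ?G ?F" using h' k' GF by (intro ps_squareI) simp_all
  have mH: "H.mates ?\<phi>" and mK: "K.mates ?\<psi>" using h' k' by simp_all
  note cH = H.matesD(1)[OF mH] and cK = K.matesD(1)[OF mK]
  interpret \<phi>: rd_cel H.A.Q ?S "rd_comp ?b (T ?F)" "rd_comp ?F ?a" ?\<phi> by (rule cH)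
  interpret \<psi>: rd_cel H.B.Q ?T "rd_comp ?c (T ?G)" "rd_comp ?G ?b" ?\<psi> by (rule cK)
  let ?\<chi> = "rd_vcomp (rd_hcomp (rd_id2 ?G) ?\<phi>) (rd_hcomp ?\<psi> (rd_id2 (T ?F)))"
  have eqs: "rd_comp (rd_comp ?c (T ?G)) (T ?F) = rd_comp ?c (T (rd_comp ?G ?F))"
    "rd_comp (rd_comp ?G ?b) (T ?F) = rd_comp ?G (rd_comp ?b (T ?F))"
    "rd_comp ?G (rd_comp ?F ?a) = rd_comp (rd_comp ?G ?F) ?a"
    using rd_comp_assoc[OF H.TF.arr K.TF.arr K.B.a.arr]
      rd_comp_assoc[OF H.TF.arr H.B.a.arr K.F.arr]
      rd_comp_assoc[OF H.A.a.arr H.F.arr K.F.arr]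
      Tq_map_comp[OF H.F.arr K.F.arr] by simp_all
  have cel: "rd_cel H.A.Q ?T (rd_comp ?c (T (rd_comp ?G ?F))) (rd_comp (rd_comp ?G ?F) ?a) ?\<chi>"
    using rd_vcomp_cel[OF rd_hcomp_cel[OF rd_id2_cel[OF H.TF.arr] cK, unfolded eqs(1,2)]
      rd_hcomp_cel[OF cH rd_id2_cel[OF K.F.arr], unfolded eqs(3)]] .
  have "KH.mates ?\<chi>"
    unfolding KH.mates_def
  proof (intro conjI cel ballI)
    fix P assume P: "P \<in> Ob H.A.Q"
    let ?X = "und pr P" and ?T1 = "fo (T ?F) P" and ?T2 = "fo (T ?G) (fo (T ?F) P)"
    have O: "?T1 \<in> Ob H.B.Q" "?T2 \<in> Ob K.B.Q" using P by (simp_all del: Tq_map_simps(3-))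
    have e: "und pr ?T1 = fo ?F ?X" "und pr ?T2 = fo ?G (fo ?F ?X)" "fo (T (rd_comp ?G ?F)) P = ?T2"
      using P O arg_cong[OF Tq_map_comp[OF H.F.arr K.F.arr], of "\<lambda>F. fo F P"] by simp_all
    note [simp del] = Tq_map_simps(3-)
    have H: "cpt ?\<phi> P \<in> Hom ?S (fo ?b ?T1) (fo ?F (fo ?a P))" "cpt ?\<psi> ?T1 \<in> Hom ?T (fo ?c ?T2) (fo ?G (fo ?b ?T1))"
      "K.B.proj ?T2 \<in> Hom ?T (fo ?G (fo ?F ?X)) (fo ?c ?T2)" "H.B.proj ?T1 \<in> Hom ?S (fo ?F ?X) (fo ?b ?T1)"
      "H.A.proj P \<in> Hom ?R ?X (fo ?a P)"
      using \<phi>.cpt_Hom[OF P] \<psi>.cpt_Hom[OF O(1)] K.B.proj_Hom[OF O(2)] H.B.proj_Hom[OF O(1)] P O H.A.proj_Hom[OF P]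
      by (simp_all add: e)
    have c: "cpt ?\<chi> P = Cmp ?T (fo ?c ?T2) (fo ?G (fo ?b ?T1)) (fo ?G (fo ?F (fo ?a P)))
      (fa ?G (fo ?b ?T1) (fo ?F (fo ?a P)) (cpt ?\<phi> P)) (cpt ?\<psi> ?T1)"
      using P O cpt_whisker_left[OF K.F.arr cH P] cpt_whisker_right[OF cK H.TF.arr P]
      by (simp del: rd_hcomp_simps(3))
    have m: "Cmp ?S (fo ?F ?X) (fo ?b ?T1) (fo ?F (fo ?a P)) (cpt ?\<phi> P) (H.B.proj ?T1) = fa ?F ?X (fo ?a P) (H.A.proj P)"
      "Cmp ?T (fo ?G (fo ?F ?X)) (fo ?c ?T2) (fo ?G (fo ?b ?T1)) (cpt ?\<psi> ?T1) (K.B.proj ?T2) =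
        fa ?G (fo ?F ?X) (fo ?b ?T1) (H.B.proj ?T1)"
      using H.matesD(2)[OF mH P] K.matesD(2)[OF mK O(1)] by (simp_all add: e)
    have "Cmp ?T (fo ?G (fo ?F ?X)) (fo ?c ?T2) (fo ?G (fo ?F (fo ?a P))) (cpt ?\<chi> P) (K.B.proj ?T2) =
      Cmp ?T (fo ?G (fo ?F ?X)) (fo ?G (fo ?b ?T1)) (fo ?G (fo ?F (fo ?a P)))
        (fa ?G (fo ?b ?T1) (fo ?F (fo ?a P)) (cpt ?\<phi> P)) (fa ?G (fo ?F ?X) (fo ?b ?T1) (H.B.proj ?T1))"
      unfolding c using P O H by (simp add: m flip: K.B.Cmp_assoc)
    also have "\<dots> = fa ?G (fo ?F ?X) (fo ?F (fo ?a P)) (fa ?F ?X (fo ?a P) (H.A.proj P))"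
      unfolding m(1)[symmetric] using P O H by simp
    finally show "Cmp ?T (fo (rd_comp ?G ?F) ?X) (fo ?c (fo (T (rd_comp ?G ?F)) P)) (fo (rd_comp ?G ?F) (fo ?a P))
       (cpt ?\<chi> P) (K.B.proj (fo (T (rd_comp ?G ?F)) P)) = fa (rd_comp ?G ?F) ?X (fo ?a P) (H.A.proj P)"
      using P O H by (simp add: e del: rd_vcomp_simps(3))
  qed
  then show ?thesis
    using h' k' GF preserves_comp[OF H.F.arr K.F.arr]
    by (simp add: pseudomorphism_iff ps_comp_def)
qed

lemma pseudomorphism_id:
  assumes "pseudoalgebra RD (Tq pr) \<A>"
  shows "pseudomorphism RD (Tq pr) \<lparr>psrc = \<A>, ptrg = \<A>, pmap = rd_id (carr \<A>), pcell = rd_id2 (act \<A>)\<rparr>"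
proof -
  interpret A: ps_algebra "carr \<A>" pr "act \<A>" "iota \<A>" "kappa \<A>" using assms by (rule ps_algebraI)
  have i: "rd_arr (carr \<A>) (carr \<A>) (rd_id (carr \<A>))" by (rule rd_id_arr[OF A.doctrine])
  interpret ps_square "carr \<A>" "carr \<A>" pr "act \<A>" "iota \<A>" "kappa \<A>" "act \<A>" "iota \<A>" "kappa \<A>" "rd_id (carr \<A>)"
    using assms i by (intro ps_squareI)
  have "mates (rd_id2 (act \<A>))"
    using rd_id2_cel[OF A.a.arr]
    by (simp add: mates_def A.boundary_eqs(1,2) rd_comp_id(1)[OF A.a.arr] Tq_map_id[OF A.doctrine] del: Tq_map_simps(3-))
  then show ?thesis using assms i preserves_id by (simp add: pseudomorphism_iff)
qed

text \<open>The algebra 2-cell condition is automatic, being an equation that can be checked on the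
  covering objects, where it is naturality.\<close>

lemma algebra_cell_iff:
  "algebra_cell RD (Tq pr) t \<longleftrightarrow> pseudomorphism RD (Tq pr) (pcsrc t) \<and> pseudomorphism RD (Tq pr) (pctrg t) \<and>
    psrc (pcsrc t) = psrc (pctrg t) \<and> ptrg (pcsrc t) = ptrg (pctrg t) \<and>
    under t \<in> two RD (pmap (pcsrc t)) (pmap (pctrg t))" (is "_ \<longleftrightarrow> ?r")
proof
  assume r: ?r
  let ?h = "pcsrc t" and ?k = "pctrg t" and ?\<theta> = "under t"
  let ?R = "carr (psrc ?h)" and ?S = "carr (ptrg ?h)" and ?F = "pmap ?h" and ?G = "pmap ?k"
    and ?\<phi> = "pcell ?h" and ?\<psi> = "pcell ?k" and ?a = "act (psrc ?h)" and ?b = "act (ptrg ?h)"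
  have st: "psrc ?k = psrc ?h" "ptrg ?k = ptrg ?h" using r by simp_all
  have h: "pseudomorphism RD (Tq pr) ?h" and k: "pseudomorphism RD (Tq pr) ?k" using r by simp_all
  note h'' = h[unfolded pseudomorphism_iff] and k'' = k[unfolded pseudomorphism_iff st]
  have h': "pseudoalgebra RD (Tq pr) (psrc ?h)" "pseudoalgebra RD (Tq pr) (ptrg ?h)" "rd_arr ?R ?S ?F" "rd_arr ?R ?S ?G"
    using h'' k'' by simp_all
  interpret H: ps_square ?R ?S pr ?a "iota (psrc ?h)" "kappa (psrc ?h)" ?b "iota (ptrg ?h)" "kappa (ptrg ?h)" ?F
    using h' by (intro ps_squareI) simp_all
  interpret K: ps_square ?R ?S pr ?a "iota (psrc ?h)" "kappa (psrc ?h)" ?b "iota (ptrg ?h)" "kappa (ptrg ?h)" ?G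
    using h' by (intro ps_squareI) simp_all
  have mH: "H.mates ?\<phi>" and mK: "K.mates ?\<psi>" using h'' k'' by simp_all
  note cH = H.matesD(1)[OF mH] and cK = K.matesD(1)[OF mK]
  have c\<theta>: "rd_cel ?R ?S ?F ?G ?\<theta>" using r h'(3) by (simp add: rd_cel_iff in_two_RD rd_arr_iff)
  note cT = Tq_cell_cel[OF c\<theta>]
  interpret \<theta>: rd_cel ?R ?S ?F ?G ?\<theta> by (rule c\<theta>)
  interpret T\<theta>: rd_cel H.A.Q H.B.Q "T ?F" "T ?G" "Tq_cell pr ?\<theta>" by (rule cT)
  interpret \<phi>: rd_cel H.A.Q ?S "rd_comp ?b (T ?F)" "rd_comp ?F ?a" ?\<phi> by (rule cH)
  interpret \<psi>: rd_cel H.A.Q ?S "rd_comp ?b (T ?G)" "rd_comp ?G ?a" ?\<psi> by (rule cK)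
  let ?l = "rd_vcomp (rd_hcomp ?\<theta> (rd_id2 ?a)) ?\<phi>"
  let ?r = "rd_vcomp ?\<psi> (rd_hcomp (rd_id2 ?b) (Tq_cell pr ?\<theta>))"
  have "?l = ?r"
  proof (rule covering.cel_eqI[OF H.source_covering, where H = "rd_comp ?G ?a"], goal_cases)
    case 1
    show ?case
      by (rule rd_vcomp_cel[OF cH rd_hcomp_cel[OF rd_id2_cel[OF H.A.a.arr] c\<theta>]])
  next
    case 2
    show ?case
      by (rule rd_vcomp_cel[OF rd_hcomp_cel[OF cT rd_id2_cel[OF H.B.a.arr]] cK])
  next
    case P: (3 P)
    let ?X = "und pr P" and ?TF = "fo (T ?F) P" and ?TG = "fo (T ?G) P"
    have O: "?TF \<in> Ob H.B.Q" "?TG \<in> Ob H.B.Q" using P by (simp_all del: Tq_map_simps(3-))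
    have e: "und pr ?TF = fo ?F ?X" "und pr ?TG = fo ?G ?X" using P by simp_all
    note [simp del] = Tq_map_simps(3-)
    have t: "cpt ?\<theta> ?X \<in> Hom H.B.Q ?TF ?TG" using T\<theta>.cpt_Hom[OF P] P by simp
    have H: "cpt ?\<phi> P \<in> Hom ?S (fo ?b ?TF) (fo ?F (fo ?a P))" "cpt ?\<psi> P \<in> Hom ?S (fo ?b ?TG) (fo ?G (fo ?a P))"
      "H.B.proj ?TF \<in> Hom ?S (fo ?F ?X) (fo ?b ?TF)" "H.B.proj ?TG \<in> Hom ?S (fo ?G ?X) (fo ?b ?TG)"
      "H.A.proj P \<in> Hom ?R ?X (fo ?a P)"
      using \<phi>.cpt_Hom[OF P] \<psi>.cpt_Hom[OF P] H.B.proj_Hom[OF O(1)] H.B.proj_Hom[OF O(2)] H.A.proj_Hom[OF P] P O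
      by (simp_all add: e)
    have mF: "Cmp ?S (fo ?F ?X) (fo ?b ?TF) (fo ?F (fo ?a P)) (cpt ?\<phi> P) (H.B.proj ?TF) = fa ?F ?X (fo ?a P) (H.A.proj P)"
      and mG: "Cmp ?S (fo ?G ?X) (fo ?b ?TG) (fo ?G (fo ?a P)) (cpt ?\<psi> P) (H.B.proj ?TG) = fa ?G ?X (fo ?a P) (H.A.proj P)"
      using H.matesD(2)[OF mH P] K.matesD(2)[OF mK P] by simp_all
    have n: "Cmp ?S (fo ?F ?X) (fo ?b ?TF) (fo ?b ?TG) (fa ?b ?TF ?TG (cpt ?\<theta> ?X)) (H.B.proj ?TF) =
      Cmp ?S (fo ?F ?X) (fo ?G ?X) (fo ?b ?TG) (H.B.proj ?TG) (cpt ?\<theta> ?X)"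
      using H.B.proj_natural[OF O t] by (simp add: e)
    have cl: "cpt ?l P = Cmp ?S (fo ?b ?TF) (fo ?F (fo ?a P)) (fo ?G (fo ?a P)) (cpt ?\<theta> (fo ?a P)) (cpt ?\<phi> P)"
      using P O cpt_whisker_right[OF c\<theta> H.A.a.arr P] by (simp del: rd_hcomp_simps(3))
    have cr: "cpt ?r P = Cmp ?S (fo ?b ?TF) (fo ?b ?TG) (fo ?G (fo ?a P)) (cpt ?\<psi> P) (fa ?b ?TF ?TG (cpt ?\<theta> ?X))"
      using P O cpt_whisker_left[OF H.B.a.arr cT P] by (simp del: rd_hcomp_simps(3))
    have "Cmp ?S (fo ?F ?X) (fo ?b ?TF) (fo ?G (fo ?a P)) (cpt ?l P) (H.B.proj ?TF) =
      Cmp ?S (fo ?F ?X) (fo ?F (fo ?a P)) (fo ?G (fo ?a P)) (cpt ?\<theta> (fo ?a P)) (fa ?F ?X (fo ?a P) (H.A.proj P))"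
      unfolding cl mF[symmetric] using P O H by (simp add: H.B.Cmp_assoc)
    also have "\<dots> = Cmp ?S (fo ?F ?X) (fo ?G ?X) (fo ?G (fo ?a P)) (fa ?G ?X (fo ?a P) (H.A.proj P)) (cpt ?\<theta> ?X)"
      using \<theta>.t_natural[of ?X "fo ?a P" "H.A.proj P"] P H by simp
    also have "\<dots> = Cmp ?S (fo ?F ?X) (fo ?b ?TG) (fo ?G (fo ?a P)) (cpt ?\<psi> P)
       (Cmp ?S (fo ?F ?X) (fo ?b ?TF) (fo ?b ?TG) (fa ?b ?TF ?TG (cpt ?\<theta> ?X)) (H.B.proj ?TF))"
      unfolding mG[symmetric] n using P O H by (simp add: H.B.Cmp_assoc)
    also have "\<dots> = Cmp ?S (fo ?F ?X) (fo ?b ?TF) (fo ?G (fo ?a P)) (cpt ?r P) (H.B.proj ?TF)"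
      unfolding cr using P O H t by (simp add: H.B.Cmp_assoc)
    finally show ?case
      using P O by (simp del: rd_vcomp_simps(3))
  qed
  then show "algebra_cell RD (Tq pr) t"
    using r by (simp add: algebra_cell_def Let_def)
qed (simp add: algebra_cell_def Let_def)

end


section \<open>The equivalence\<close>

lemma QRD_simps [simp]:
  "R \<in> Obj QRD \<longleftrightarrow> relational_doctrine R \<and> has_quotients R" "F \<in> One QRD \<longleftrightarrow> qrd_arrow F"
  "\<theta> \<in> Two QRD \<longleftrightarrow> rd_two_arrow \<theta> \<and> qrd_arrow (msrc \<theta>) \<and> qrd_arrow (mtrg \<theta>)"
  "src1 QRD = dsrc" "trg1 QRD = dtrg" "src2 QRD = msrc" "trg2 QRD = mtrg"
  "id1 QRD = rd_id" "c1 QRD = rd_comp" "id2 QRD = rd_id2" "vc QRD = rd_vcomp" "hc QRD = rd_hcomp"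
  by (simp_all add: QRD_def RD_def)

lemma qrd_arrow_comp:
  assumes "qrd_arrow F" "qrd_arrow G" "dsrc G = dtrg F"
  shows "qrd_arrow (rd_comp G F)"
proof -
  interpret two_category RD by (rule two_category_RD)
  have "rd_arrow (rd_comp G F)" using cell_simps(4)[of F G] assms by (simp add: qrd_arrow_def)
  moreover have "preserves_quotient_arrows (rd_comp G F)"
    using assms by (intro preserves_comp[of "dsrc F" "dtrg F" F "dtrg G" G])
      (simp_all add: qrd_arrow_def rd_arr_iff)
  ultimately show ?thesis using assms by (simp add: qrd_arrow_def)
qed

text \<open>The inclusion into the 2-category of all doctrines is faithful.\<close>

lemma two_category_QRD: "two_category QRD"
proof -
  interpret R: two_category RD by (rule two_category_RD)
  have q: "rd_arrow F" "relational_doctrine (dsrc F)" "relational_doctrine (dtrg F)"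
    "has_quotients (dsrc F)" "has_quotients (dtrg F)" if "qrd_arrow F" for F
    using that R.bd1[of F] by (simp_all add: qrd_arrow_def)
  interpret Q: two_graph QRD
  proof (rule two_graph.intro, goal_cases)
    case (7 R)
    then show ?case using R.id1_one[of R] by (simp add: one_def qrd_arrow_def rd_arr_iff preserves_id)
  next
    case (8 F G) then show ?case using R.c1_one[of F G] q by (simp add: one_def qrd_arrow_comp)
  next
    case (9 F) then show ?case using R.id2_two[of F] q(1)[of F] by (simp add: two_def)
  next
    case (10 \<theta> \<phi>) then show ?case using R.vc_two[of \<theta> \<phi>] by (simp add: two_def)
  next
    case (11 \<theta> \<phi>)
    then show ?case using R.hc_two[of \<theta> \<phi>] rd_two_arrow_bd[of \<theta>] rd_two_arrow_bd[of \<phi>]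
      by (simp add: two_def qrd_arrow_comp)
  qed (simp_all add: q rd_two_arrow_bd)
  interpret F: two_functor QRD RD two_id
    by (rule two_functor.intro) (simp_all add: two_id_def one_def two_def q rd_arr_iff)
  interpret faithful_map RD QRD two_id
    by unfold_locales (simp_all add: two_id_def)
  show ?thesis by (rule two_category_L)
qed

context pairing
begin

abbreviation "Alg \<equiv> PsAlg (RD :: ('o, 'a, 'r) rd_two_cat) (Tq pr)"

lemma Alg_simps [simp]:
  "\<A> \<in> Obj Alg \<longleftrightarrow> pseudoalgebra RD (Tq pr) \<A>" "h \<in> One Alg \<longleftrightarrow> pseudomorphism RD (Tq pr) h"
  "t \<in> Two Alg \<longleftrightarrow> algebra_cell RD (Tq pr) t"
  "src1 Alg = psrc" "trg1 Alg = ptrg" "src2 Alg = pcsrc" "trg2 Alg = pctrg"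
  "id1 Alg \<A> = \<lparr>psrc = \<A>, ptrg = \<A>, pmap = rd_id (carr \<A>), pcell = rd_id2 (act \<A>)\<rparr>"
  "c1 Alg = ps_comp RD (Tq pr)"
  "id2 Alg h = \<lparr>pcsrc = h, pctrg = h, under = rd_id2 (pmap h)\<rparr>"
  "vc Alg t' t = \<lparr>pcsrc = pcsrc t, pctrg = pctrg t', under = rd_vcomp (under t') (under t)\<rparr>"
  "hc Alg t' t = \<lparr>pcsrc = ps_comp RD (Tq pr) (pcsrc t') (pcsrc t),
     pctrg = ps_comp RD (Tq pr) (pctrg t') (pctrg t), under = rd_hcomp (under t') (under t)\<rparr>"
  by (simp_all add: PsAlg_def)

lemma ps_comp_simps [simp]:
  "psrc (ps_comp K D k h) = psrc h" "ptrg (ps_comp K D k h) = ptrg k"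
  "pmap (ps_comp K D k h) = c1 K (pmap k) (pmap h)"
  by (simp_all add: ps_comp_def)

lemma pseudomorphismD:
  assumes "pseudomorphism RD (Tq pr) h"
  shows "pseudoalgebra RD (Tq pr) (psrc h)" "pseudoalgebra RD (Tq pr) (ptrg h)"
    "rd_arrow (pmap h)" "dsrc (pmap h) = carr (psrc h)" "dtrg (pmap h) = carr (ptrg h)"
    "qrd_arrow (pmap h)"
proof -
  show h: "pseudoalgebra RD (Tq pr) (psrc h)" "pseudoalgebra RD (Tq pr) (ptrg h)"
    "rd_arrow (pmap h)" "dsrc (pmap h) = carr (psrc h)" "dtrg (pmap h) = carr (ptrg h)"
    using assms by (simp_all add: pseudomorphism_iff rd_arr_iff)
  interpret A: ps_algebra "carr (psrc h)" pr "act (psrc h)" "iota (psrc h)" "kappa (psrc h)"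
    using h(1) by (rule ps_algebraI)
  interpret B: ps_algebra "carr (ptrg h)" pr "act (ptrg h)" "iota (ptrg h)" "kappa (ptrg h)"
    using h(2) by (rule ps_algebraI)
  show "qrd_arrow (pmap h)"
    using h assms A.choice.has_quotients B.choice.has_quotients
    by (simp add: qrd_arrow_def pseudomorphism_iff)
qed

lemma algebra_cellD:
  assumes "algebra_cell RD (Tq pr) t"
  shows "pseudomorphism RD (Tq pr) (pcsrc t)" "pseudomorphism RD (Tq pr) (pctrg t)"
    "psrc (pctrg t) = psrc (pcsrc t)" "ptrg (pctrg t) = ptrg (pcsrc t)"
    "rd_two_arrow (under t)" "msrc (under t) = pmap (pcsrc t)" "mtrg (under t) = pmap (pctrg t)"
  using assms by (simp_all add: algebra_cell_iff in_two_RD)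

lemma algebra_cellI:
  assumes "pseudomorphism RD (Tq pr) h" "pseudomorphism RD (Tq pr) k" "psrc k = psrc h" "ptrg k = ptrg h"
    "rd_two_arrow \<theta>" "msrc \<theta> = pmap h" "mtrg \<theta> = pmap k"
  shows "algebra_cell RD (Tq pr) \<lparr>pcsrc = h, pctrg = k, under = \<theta>\<rparr>"
  using assms by (simp add: algebra_cell_iff in_two_RD)

lemma two_graph_Alg: "two_graph Alg"
proof -
  interpret R: two_category RD by (rule two_category_RD)
  show ?thesis
  proof (rule two_graph.intro, goal_cases)
    case (7 \<A>) then show ?case using pseudomorphism_id by (simp add: one_def)
  next
    case (8 h k) then show ?case using pseudomorphism_comp[of h k] by (simp add: one_def)
  next
    case (9 h)
    then show ?case using R.id2_two[of "pmap h"] pseudomorphismD(3)[of h]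
      by (simp add: two_def algebra_cellI)
  next
    case (10 t t')
    then show ?case using R.vc_two[of "under t" "under t'"] algebra_cellD[of t] algebra_cellD[of t']
      by (simp add: two_def algebra_cellI)
  next
    case (11 t t')
    then show ?case
      using R.hc_two[of "under t" "under t'"] algebra_cellD[of t] algebra_cellD[of t']
        pseudomorphismD[of "pcsrc t"] pseudomorphismD[of "pcsrc t'"]
        pseudomorphism_comp[of "pcsrc t" "pcsrc t'"] pseudomorphism_comp[of "pctrg t" "pctrg t'"]
      by (simp add: two_def algebra_cellI)
  qed (simp_all add: pseudomorphismD algebra_cellD)
qed

text \<open>This 2-functor is bijective on parallel cells, and it is surjective on objects because a doctrine
  with quotients admits a choice of them.\<close>

definition forget where
  "forget = \<lparr>on0 = carr, on1 = pmap, on2 = under\<rparr>"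

lemma forget_functor: "two_functor Alg QRD forget"
proof (rule two_functor.intro, goal_cases)
  case (1 \<A>)
  then interpret A: ps_algebra "carr \<A>" pr "act \<A>" "iota \<A>" "kappa \<A>" by (intro ps_algebraI) simp
  show ?case by (simp add: forget_def A.doctrine A.choice.has_quotients)
qed (simp_all add: forget_def one_def two_def pseudomorphismD algebra_cellD)

lemma pseudoalgebra_ex:
  assumes "relational_doctrine R" "has_quotients R"
  shows "\<exists>\<A>. pseudoalgebra RD (Tq pr) \<A> \<and> carr \<A> = R"
proof -
  interpret quot_doctrine R pr using assms(1) by (rule quot_doctrineI)
  obtain a p where "quotient_choice R pr a p" using quotient_choice_ex[OF assms(2)] by blast
  then interpret quotient_choice R pr a p .
  obtain \<iota> \<kappa> where "choice_data R pr a p \<iota> \<kappa>" using choice_data_ex by blast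
  then interpret choice_data R pr a p \<iota> \<kappa> .
  show ?thesis using pseudoalgebra by (intro exI[of _ "\<lparr>carr = R, act = a, iota = \<iota>, kappa = \<kappa>\<rparr>"]) simp
qed

lemma QRD_equivalent_Alg: "two_equivalent (QRD :: ('o, 'a, 'r) rd_two_cat) (PsAlg (RD :: ('o, 'a, 'r) rd_two_cat) (Tq pr))"
proof -
  define s where "s R = (SOME \<A>. pseudoalgebra RD (Tq pr) \<A> \<and> carr \<A> = R)" for R :: "('o, 'a, 'r) rel_doctrine"
  have s: "pseudoalgebra RD (Tq pr) (s R)" "carr (s R) = R" if "relational_doctrine R" "has_quotients R" for R
    using someI_ex[OF pseudoalgebra_ex[OF that]] by (simp_all add: s_def)
  let ?K = "QRD :: ('o, 'a, 'r) rd_two_cat" and ?L = "PsAlg (RD :: ('o, 'a, 'r) rd_two_cat) (Tq pr)"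
  interpret K: two_category ?K by (rule two_category_QRD)
  interpret L: two_graph ?L by (rule two_graph_Alg)
  interpret G: two_functor ?L ?K forget by (rule forget_functor)
  interpret hom_bijection ?K ?L forget s
  proof (unfold_locales, goal_cases)
    case (1 h k) then show ?case by (simp add: forget_def pseudomorphism_eqI)
  next
    case (2 t t') then show ?case by (simp add: forget_def pscell.equality)
  next
    case (3 R) then show ?case by (simp add: s)
  next
    case (4 R) then show ?case by (simp add: forget_def s)
  next
    case (5 \<A> \<B> F)
    then have "rd_arr (carr \<A>) (carr \<B>) F" "preserves_quotient_arrows F"
      by (simp_all add: forget_def one_def qrd_arrow_def rd_arr_iff)
    with 5 pseudomorphism_ex[of \<A> \<B> F] show ?case by (auto simp: forget_def one_def)
  next
    case (6 h k \<theta>)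
    then show ?case
      by (intro bexI[of _ "\<lparr>pcsrc = h, pctrg = k, under = \<theta>\<rparr>"])
        (simp_all add: forget_def two_def algebra_cellI)
  qed
  show ?thesis by (rule equivalent)
qed

end

theorem theorem3p21:
  fixes pr :: "'o \<times> 'r \<Rightarrow> 'o"
  assumes "inj pr"
  shows "two_equivalent (QRD :: ('o, 'a, 'r) rd_two_cat)
           (PsAlg (RD :: ('o, 'a, 'r) rd_two_cat) (Tq pr))"
proof -
  interpret pairing pr by unfold_locales fact
  show ?thesis by (rule QRD_equivalent_Alg)
qed

end
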